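(* Let $(K,\nu)$ be a henselian valued field such that the residue field $K\nu$ is perfect. Let $(L_1/K,\nu)$ be a finite tame extension and $(L_2/K,\nu)$ a finite extension. Set $L=L_1\cdot L_2$, $L_2'=L_2\cap K^r$ and $L'=L_1\cdot L_2'$, where $K^r$ is the absolute ramification field of $(K,\nu)$. Set $e_1=[\nu L_1:\nu K]$ and $e_2'=[\nu L_2':\nu K]$. For any $\theta\in\mathfrak{O}_{L'}$ let $d_\theta=[L_1\nu(\theta\nu):L_1\nu]$. Then $$(L/L_2,\nu)\text{ is unramified if and only if } e_2'\, d_\theta = e_1\,[L':L_1]\ \text{ for some } \theta\in\mathfrak{O}_{L'}.$$ In this case (for such a $\theta$), $L'\nu=L_1\nu(\theta\nu)$ and $e_1$ divides $e_2'$.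
   Context: Valuations are written additively with values in an arbitrary ordered abelian group. For a valued field $(F,\nu)$, $\nu F$ is the value group, $\mathfrak{O}_F$ the valuation ring, $F\nu$ the residue field, and $x\nu\in F\nu$ the residue of $x\in\mathfrak{O}_F$; thus $L_1\nu(\theta\nu)$ is the subfield of $L'\nu$ generated over $L_1\nu$ by the residue $\theta\nu$. A valued field is henselian if its valuation extends uniquely to its algebraic closure (equivalently, Hensel's Lemma holds). For henselian $(K,\nu)$ all algebraic extensions of $K$ are taken inside a fixed algebraic closure $\overline{K}$ and carry the unique extension of $\nu$, again denoted $\nu$; they are again henselian. $F_1\cdot F_2$ denotes the compositum. The residue characteristic is $p=\operatorname{char} K\nu$ if this is positive, and $p=1$ otherwise. A finite extension $(F'/F,\nu)$ of henselian valued fields is defectless if $[F':F]=[\nu F':\nu F]\,[F'\nu:F\nu]$. An algebraic extension $(F'/F,\nu)$ of henselian valued fields is tame if for every finite subextension $F''/F$: (i) $p$ does not divide $[\nu F'':\nu F]$ (no condition when $\operatorname{char} F\nu=0$); (ii) $F''\nu/F\nu$ is separable; (iii) $(F''/F,\nu)$ is defectless. It is unramified if it is tame and $\nu F'=\nu F$. The absolute ramification group of henselian $(K,\nu)$ is $G^r=\{\sigma\in \operatorname{Aut}(\overline{K}/K) : \nu(\sigma x-x)>\nu(x)\ \text{for all } x\in\mathfrak{O}_{\overline{K}}\}$ (the condition being understood for $x\neq 0$), and the absolute ramification field $K^r$ is the fixed field of $G^r$ in the separable closure of $K$ in $\overline{K}$. *)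

theory Defs
  imports "HOL-Algebra.Algebra" "HOL-Algebra.Algebraic_Closure"
begin

section \<open>Characteristic, perfect fields, separable elements\<close>

text \<open>
  The additive order of the unit; by the convention of \<^const>\<open>group.ord\<close> it is 0 if no positive
  multiple of the unit vanishes.
\<close>

definition ring_char :: "('a, 'b) ring_scheme \<Rightarrow> nat"
  where "ring_char R = group.ord (add_monoid R) \<one>\<^bsub>R\<^esub>"

definition perfect_subfield :: "('a, 'b) ring_scheme \<Rightarrow> 'a set \<Rightarrow> bool"
  where "perfect_subfield R F \<longleftrightarrow>
    subfield F R \<and>
    (ring_char R = 0 \<or> (\<forall>x\<in>F. \<exists>y\<in>F. y [^]\<^bsub>R\<^esub> ring_char R = x))"

text \<open>
  Separability of \<open>x\<close> over \<open>F\<close>: the minimal polynomial has as many distinct roots as its degree.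
  The roots are counted in \<open>R\<close>, which is always an algebraically closed field below (the algebraic
  closure of the base field, or the residue field of that closure).
\<close>

definition separable_element :: "('a, 'b) ring_scheme \<Rightarrow> 'a set \<Rightarrow> 'a \<Rightarrow> bool"
  where "separable_element R F x \<longleftrightarrow>
    ring.algebraic R F x \<and>
    card {a \<in> carrier R. ring.eval R (ring.Irr R F x) a = \<zero>\<^bsub>R\<^esub>} = Polynomials.degree (ring.Irr R F x)"

definition separable_extension :: "('a, 'b) ring_scheme \<Rightarrow> 'a set \<Rightarrow> 'a set \<Rightarrow> bool"
  where "separable_extension R F E \<longleftrightarrow> (\<forall>x\<in>E. separable_element R F x)"


section \<open>Valued fields\<close>

text \<open>
  Throughout, \<open>R\<close> is a large field (later: an algebraic closure) carrying a valuation \<open>v\<close>, and the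
  valued fields under consideration are subfields \<open>F\<close> of \<open>R\<close> with the restriction of \<open>v\<close>.
  Valuations are total functions into an ordered abelian group; the value at zero is irrelevant and
  is read as infinity, so every use of \<open>v\<close> treats zero separately. No surjectivity is required, so
  the value group is a subgroup of the type \<open>'g\<close>.
\<close>

definition valuation :: "('a, 'b) ring_scheme \<Rightarrow> ('a \<Rightarrow> 'g::linordered_ab_group_add) \<Rightarrow> bool"
  where "valuation R v \<longleftrightarrow>
    (\<forall>x \<in> carrier R - {\<zero>\<^bsub>R\<^esub>}. \<forall>y \<in> carrier R - {\<zero>\<^bsub>R\<^esub>}. v (x \<otimes>\<^bsub>R\<^esub> y) = v x + v y) \<and>
    (\<forall>x \<in> carrier R - {\<zero>\<^bsub>R\<^esub>}. \<forall>y \<in> carrier R - {\<zero>\<^bsub>R\<^esub>}.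
        x \<oplus>\<^bsub>R\<^esub> y \<noteq> \<zero>\<^bsub>R\<^esub> \<longrightarrow> min (v x) (v y) \<le> v (x \<oplus>\<^bsub>R\<^esub> y))"

definition value_group ::
    "('a, 'b) ring_scheme \<Rightarrow> ('a \<Rightarrow> 'g::linordered_ab_group_add) \<Rightarrow> 'a set \<Rightarrow> 'g monoid"
  where "value_group R v F = \<lparr>carrier = v ` (F - {\<zero>\<^bsub>R\<^esub>}), monoid.mult = (+), one = 0\<rparr>"

definition valuation_ring ::
    "('a, 'b) ring_scheme \<Rightarrow> ('a \<Rightarrow> 'g::linordered_ab_group_add) \<Rightarrow> 'a set \<Rightarrow> 'a set"
  where "valuation_ring R v F = {x \<in> F. x = \<zero>\<^bsub>R\<^esub> \<or> 0 \<le> v x}"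

definition valuation_ideal ::
    "('a, 'b) ring_scheme \<Rightarrow> ('a \<Rightarrow> 'g::linordered_ab_group_add) \<Rightarrow> 'a set \<Rightarrow> 'a set"
  where "valuation_ideal R v F = {x \<in> F. x = \<zero>\<^bsub>R\<^esub> \<or> 0 < v x}"

definition residue_field ::
    "('a, 'b) ring_scheme \<Rightarrow> ('a \<Rightarrow> 'g::linordered_ab_group_add) \<Rightarrow> 'a set ring"
  where "residue_field R v =
    (R\<lparr>carrier := valuation_ring R v (carrier R)\<rparr>) Quot (valuation_ideal R v (carrier R))"

definition residue ::
    "('a, 'b) ring_scheme \<Rightarrow> ('a \<Rightarrow> 'g::linordered_ab_group_add) \<Rightarrow> 'a \<Rightarrow> 'a set"
  where "residue R v x = valuation_ideal R v (carrier R) +>\<^bsub>R\<^esub> x"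

text \<open>
  The residue field of a subfield \<open>F\<close>, under the usual identification with a subfield of the
  residue field of \<open>R\<close>.
\<close>

definition residue_subfield ::
    "('a, 'b) ring_scheme \<Rightarrow> ('a \<Rightarrow> 'g::linordered_ab_group_add) \<Rightarrow> 'a set \<Rightarrow> 'a set set"
  where "residue_subfield R v F = residue R v ` valuation_ring R v F"

definition ramification_index ::
    "('a, 'b) ring_scheme \<Rightarrow> ('a \<Rightarrow> 'g::linordered_ab_group_add) \<Rightarrow> 'a set \<Rightarrow> 'a set \<Rightarrow> nat"
  where "ramification_index R v F E =
    card (rcosets\<^bsub>value_group R v E\<^esub> (carrier (value_group R v F)))"

definition inertia_degree ::
    "('a, 'b) ring_scheme \<Rightarrow> ('a \<Rightarrow> 'g::linordered_ab_group_add) \<Rightarrow> 'a set \<Rightarrow> 'a set \<Rightarrow> nat"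
  where "inertia_degree R v F E =
    ring.dim (residue_field R v) (residue_subfield R v F) (residue_subfield R v E)"

text \<open>
  \<open>R\<close> is an algebraic closure of \<open>K\<close>, and \<open>v\<close> is the only extension of its restriction to \<open>K\<close>.
  It suffices to let the competing extensions take values in \<open>'g\<close> as well: the value group of \<open>R\<close>
  is the divisible hull of that of \<open>K\<close>, and any extension to \<open>R\<close> can be transported into it.
\<close>

definition henselian ::
    "('a, 'b) ring_scheme \<Rightarrow> ('a \<Rightarrow> 'g::linordered_ab_group_add) \<Rightarrow> 'a set \<Rightarrow> bool"
  where "henselian R v K \<longleftrightarrow>
    algebraic_closure R K \<and> valuation R v \<and>
    (\<forall>w :: 'a \<Rightarrow> 'g. valuation R w \<and> (\<forall>x \<in> K - {\<zero>\<^bsub>R\<^esub>}. w x = v x) \<longrightarrow>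
        (\<forall>x \<in> carrier R - {\<zero>\<^bsub>R\<^esub>}. w x = v x))"


section \<open>Tame and unramified extensions\<close>

definition defectless ::
    "('a, 'b) ring_scheme \<Rightarrow> ('a \<Rightarrow> 'g::linordered_ab_group_add) \<Rightarrow> 'a set \<Rightarrow> 'a set \<Rightarrow> bool"
  where "defectless R v F E \<longleftrightarrow>
    ring.dim R F E = ramification_index R v F E * inertia_degree R v F E"

text \<open>The residue field of \<open>F\<close> has the same characteristic as that of \<open>R\<close>.\<close>

definition tame_extension ::
    "('a, 'b) ring_scheme \<Rightarrow> ('a \<Rightarrow> 'g::linordered_ab_group_add) \<Rightarrow> 'a set \<Rightarrow> 'a set \<Rightarrow> bool"
  where "tame_extension R v F E \<longleftrightarrow>
    subfield F R \<and> subfield E R \<and> F \<subseteq> E \<and> (\<forall>x\<in>E. ring.algebraic R F x) \<and>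
    (\<forall>E'. subfield E' R \<and> F \<subseteq> E' \<and> E' \<subseteq> E \<and> ring.finite_dimension R F E' \<longrightarrow>
        (ring_char (residue_field R v) = 0 \<or>
           \<not> ring_char (residue_field R v) dvd ramification_index R v F E') \<and>
        separable_extension (residue_field R v) (residue_subfield R v F) (residue_subfield R v E') \<and>
        defectless R v F E')"

definition unramified_extension ::
    "('a, 'b) ring_scheme \<Rightarrow> ('a \<Rightarrow> 'g::linordered_ab_group_add) \<Rightarrow> 'a set \<Rightarrow> 'a set \<Rightarrow> bool"
  where "unramified_extension R v F E \<longleftrightarrow>
    tame_extension R v F E \<and> value_group R v E = value_group R v F"


section \<open>The absolute ramification field\<close>

definition ramification_group ::
    "('a, 'b) ring_scheme \<Rightarrow> ('a \<Rightarrow> 'g::linordered_ab_group_add) \<Rightarrow> 'a set \<Rightarrow> ('a \<Rightarrow> 'a) set"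
  where "ramification_group R v K =
    {\<sigma> \<in> ring_iso R R. (\<forall>x\<in>K. \<sigma> x = x) \<and>
       (\<forall>x \<in> valuation_ring R v (carrier R) - {\<zero>\<^bsub>R\<^esub>}.
          \<sigma> x \<ominus>\<^bsub>R\<^esub> x = \<zero>\<^bsub>R\<^esub> \<or> v x < v (\<sigma> x \<ominus>\<^bsub>R\<^esub> x))}"

definition ramification_field ::
    "('a, 'b) ring_scheme \<Rightarrow> ('a \<Rightarrow> 'g::linordered_ab_group_add) \<Rightarrow> 'a set \<Rightarrow> 'a set"
  where "ramification_field R v K =
    {x \<in> carrier R. separable_element R K x \<and> (\<forall>\<sigma> \<in> ramification_group R v K. \<sigma> x = x)}"

end

theory Submission
  imports Defs
begin

text \<open>
  Let \<open>p\<close> be the residue characteristic. Call a nonzero separable \<open>a\<close> well separated over \<open>F\<close> if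
  no other conjugate \<open>a'\<close> of \<open>a\<close> satisfies \<open>\<nu>(a' - a) > \<nu>(a)\<close>. Adjoining such an element
  gives a defectless extension whose ramification index is prime to \<open>p\<close>, and equals one if \<open>\<nu>(a)\<close> is
  already a value of \<open>F\<close> (\<open>well_separated_extension\<close>): the residues of \<open>a'\<^sup>m / c\<close>, where
  \<open>\<nu>(a\<^sup>m) = \<nu>(c)\<close> with \<open>c \<in> F\<close> and \<open>m\<close> minimal, allow one to bound the number of conjugates by \<open>f m\<close>,
  and the fundamental inequality \<open>e f \<le> n\<close> turns the bound into an equality.

  An element that is well separated over \<open>F\<close> is so over every larger field. Hence the towers of
  successive adjunctions form a directed family, and their union \<open>tame_closure UNIV F\<close>, as well as the
  union \<open>tame_closure {0} F\<close> of the towers whose generators are units, is a field and grows with \<open>F\<close>.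
  This monotonicity is what makes tameness and unramifiedness stable under composita.

  When the residue field is perfect, these unions contain enough. Nonzero residues lift to well
  separated units, radicals of exponent prime to \<open>p\<close> are well separated, and Krasner's lemma
  (\<open>well_separated_mem\<close>) places them in any field that contains a good approximation. So the
  intersection of a field \<open>E\<close> with \<open>tame_closure UNIV K\<close> has all the residues of \<open>E\<close>, and among its
  values all those \<open>g \<in> \<nu>E\<close> some multiple \<open>n g\<close> of which, \<open>n\<close> prime to \<open>p\<close>, it has
  (\<open>values_tame_part\<close>). It follows that a finite extension of \<open>K\<close> is tame if and only if it lies in
  \<open>tame_closure UNIV K\<close>, and that this field is \<open>K\<^sup>r\<close> (\<open>ramification_field_eq_tame_closure\<close>).

  In the situation of the theorem, \<open>L' / L\<^sub>2'\<close> and \<open>L / L\<^sub>2\<close> are therefore tame. If \<open>\<nu>L = \<nu>L\<^sub>2\<close>, then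
  \<open>\<nu>L' \<subseteq> \<nu>L\<^sub>2\<close>, and these values already belong to the tame part \<open>L\<^sub>2'\<close> of \<open>L\<^sub>2\<close>; conversely, if
  \<open>\<nu>L' = \<nu>L\<^sub>2'\<close>, then \<open>L'\<close> lies in \<open>tame_closure {0} L\<^sub>2'\<close>, and therefore \<open>L\<close> in \<open>tame_closure {0} L\<^sub>2\<close>.
  So \<open>L / L\<^sub>2\<close> is unramified exactly when \<open>e(L' / L\<^sub>2') = 1\<close>. Since \<open>L' / L\<^sub>1\<close> is defectless and
  ramification indices are multiplicative,
  \<open>e\<^sub>1 [L' : L\<^sub>1] = e\<^sub>1 e(L' / L\<^sub>1) f(L' / L\<^sub>1) = e\<^sub>2' e(L' / L\<^sub>2') f(L' / L\<^sub>1)\<close>. As \<open>d\<^sub>\<theta> \<le> f(L' / L\<^sub>1)\<close>,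
  with equality exactly for residues that generate \<open>L'\<nu>\<close> over \<open>L\<^sub>1\<nu>\<close> (they exist by the primitive
  element theorem), the equation \<open>e\<^sub>2' d\<^sub>\<theta> = e\<^sub>1 [L' : L\<^sub>1]\<close> says that \<open>e(L' / L\<^sub>2') = 1\<close> and that
  \<open>\<theta>\<nu>\<close> is a generator. Then \<open>e\<^sub>2' = e\<^sub>1 e(L' / L\<^sub>1)\<close>.
\<close>


section \<open>Dimensions and intermediate fields\<close>

lemma (in field) subfield_closed:
  assumes "subfield F R"
  shows "F \<subseteq> carrier R" "\<zero> \<in> F" "\<one> \<in> F" "x \<in> F \<Longrightarrow> \<ominus> x \<in> F" "x \<in> F \<Longrightarrow> y \<in> F \<Longrightarrow> x \<oplus> y \<in> F"
    "x \<in> F \<Longrightarrow> y \<in> F \<Longrightarrow> x \<otimes> y \<in> F" "x \<in> F \<Longrightarrow> x \<noteq> \<zero> \<Longrightarrow> inv x \<in> F" "x \<in> F \<Longrightarrow> y \<in> F \<Longrightarrow> x \<ominus> y \<in> F"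
    "x \<in> F \<Longrightarrow> x [^] (n::nat) \<in> F"
proof -
  note s = subringE[OF subfieldE(1)[OF assms]]
  show p: "F \<subseteq> carrier R" "\<zero> \<in> F" "\<one> \<in> F" "x \<in> F \<Longrightarrow> \<ominus> x \<in> F" "x \<in> F \<Longrightarrow> y \<in> F \<Longrightarrow> x \<oplus> y \<in> F"
    "x \<in> F \<Longrightarrow> y \<in> F \<Longrightarrow> x \<otimes> y \<in> F" using s by blast+
  show "x \<in> F \<Longrightarrow> x \<noteq> \<zero> \<Longrightarrow> inv x \<in> F" using subfield_m_inv(1)[OF assms, of x] by blast
  show "x \<in> F \<Longrightarrow> y \<in> F \<Longrightarrow> x \<ominus> y \<in> F" unfolding minus_eq using s(5,7) by blast
  show "x \<in> F \<Longrightarrow> x [^] (n::nat) \<in> F" by (induction n) (use s in auto)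
qed

lemma (in field) subfield_subalgebra:
  assumes "subfield F R" "subfield E R" "F \<subseteq> E"
  shows "subalgebra F E R"
  unfolding subalgebra_def subalgebra_axioms_def
  using subring.axioms(1)[OF subfieldE(1)[OF assms(2)]] subfield_closed(6)[OF assms(2)] assms(3) by blast

lemma (in field) inter_subfield:
  assumes "subfield E R" "subfield F R"
  shows "subfield (E \<inter> F) R"
proof (rule subfieldI'[OF subring_inter[OF subfieldE(1)[OF assms(1)] subfieldE(1)[OF assms(2)]]])
  fix x assume "x \<in> E \<inter> F - {\<zero>}"
  then show "inv x \<in> E \<inter> F" using subfield_closed(7)[OF assms(1)] subfield_closed(7)[OF assms(2)] by blast
qed

lemma (in ring) dimension_le:
  assumes "subfield F R" "dimension n F W" "dimension m F E" "W \<subseteq> E"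
  shows "n \<le> m"
proof -
  obtain Us where Us: "set Us \<subseteq> carrier R" "independent F Us" "length Us = n" "Span F Us = W"
    using exists_base[OF assms(1,2)] by blast
  then have "set Us \<subseteq> E" using Span_base_incl[OF assms(1) Us(1)] assms(4) by simp
  then show ?thesis using independent_length_le_dimension[OF assms(1,3) Us(2)] Us(3) by simp
qed

lemma (in ring) same_dimension_imp_eq:
  assumes "subfield F R" "dimension n F W" "dimension n F E" "W \<subseteq> E"
  shows "W = E"
proof -
  obtain Us where Us: "set Us \<subseteq> carrier R" "independent F Us" "length Us = n" "Span F Us = W"
    using exists_base[OF assms(1,2)] by blast
  then have "set Us \<subseteq> E" using Span_base_incl[OF assms(1) Us(1)] assms(4) by simp
  then show ?thesis using independent_length_eq_dimension[OF assms(1,3) Us(2)] Us(3,4) by simp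
qed

lemma (in ring) dim_1_imp_eq:
  assumes "subfield F R" "F \<subseteq> E" "finite_dimension F E" "dim F E = 1"
  shows "E = F"
proof -
  have "dimension 1 F E" using finite_dimensionE[OF assms(1,3)] assms(4) by (simp add: over_def)
  then show ?thesis
    using same_dimension_imp_eq[OF assms(1) dimension_one[OF assms(1)] _ assms(2)] by simp
qed

lemma (in domain) finite_dimension_over_finite:
  assumes "subfield F R" "finite F" "finite_dimension F E"
  shows "finite E"
proof -
  obtain n where "dimension n F E" using assms(3) by (rule finite_dimensionE')
  then obtain Us where Us: "set Us \<subseteq> carrier R" "length Us = n" "Span F Us = E"
    using exists_base[OF assms(1)] by blast
  have "E \<subseteq> (\<lambda>Ks. combine Ks Us) ` {Ks. set Ks \<subseteq> F \<and> length Ks = length Us}"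
    using Span_mem_iff_length_version[OF assms(1) Us(1)] Us(3) by blast
  then show ?thesis using finite_lists_length_eq[OF assms(2)] finite_surj by blast
qed

lemma (in field) dimension_scale:
  assumes "subfield F R" "y \<in> carrier R" "y \<noteq> \<zero>" "dimension n F W"
  shows "dimension n F ((\<otimes>) y ` W)"
proof -
  obtain Us where Us: "set Us \<subseteq> carrier R" "independent F Us" "length Us = n" "Span F Us = W"
    using exists_base[OF assms(1,4)] by blast
  note F = subfield_closed(1)[OF assms(1)]
  have *: "y \<otimes> combine Ks Vs = combine Ks (map ((\<otimes>) y) Vs)"
    if "set Ks \<subseteq> carrier R" "set Vs \<subseteq> carrier R" for Ks Vs
    using that
  proof (induction Ks Vs rule: combine.induct)
    case (1 k Ks u Vs)
    then show ?case using assms(2) by (simp add: r_distr m_lcomm)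
  qed (use assms(2) in auto)
  have c: "set (map ((\<otimes>) y) Us) \<subseteq> carrier R" using Us(1) assms(2) by auto
  have "independent F (map ((\<otimes>) y) Us)"
  proof (rule trivial_combine_imp_independent[OF assms(1) c])
    fix Ks assume Ks: "set Ks \<subseteq> F" "combine Ks (map ((\<otimes>) y) Us) = \<zero>"
    then have "y \<otimes> combine Ks Us = \<zero>" using * Us(1) F by auto
    then have "combine Ks Us = \<zero>"
      using assms(2,3) Us(1) Ks(1) F integral_iff combine_in_carrier[of Ks Us] by blast
    then show "set (take (length (map ((\<otimes>) y) Us)) Ks) \<subseteq> {\<zero>}"
      using independent_imp_trivial_combine[OF assms(1) Us(2) Ks(1)] by simp
  qed
  moreover have "Span F (map ((\<otimes>) y) Us) = (\<otimes>) y ` W"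
  proof -
    have "Span F (map ((\<otimes>) y) Us) = {combine Ks (map ((\<otimes>) y) Us) |Ks. set Ks \<subseteq> F}"
      using Span_eq_combine_set[OF assms(1) c] .
    also have "\<dots> = (\<otimes>) y ` {combine Ks Us |Ks. set Ks \<subseteq> F}"
      using *[OF _ Us(1)] F by (auto simp: image_iff) (metis subset_trans)+
    also have "{combine Ks Us |Ks. set Ks \<subseteq> F} = W"
      using Span_eq_combine_set[OF assms(1) Us(1)] Us(4) by simp
    finally show ?thesis .
  qed
  ultimately show ?thesis
    using dimensionI[OF assms(1), of "map ((\<otimes>) y) Us"] Us(3) by simp
qed

text \<open>
  A finite spanning family over \<open>F\<close> still spans over the larger field \<open>M\<close>.
\<close>

lemma (in field) finite_dimension_intermediate:
  assumes "subfield F R" "subfield M R" "subfield E R" "F \<subseteq> M" "M \<subseteq> E" "finite_dimension F E"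
  shows "finite_dimension F M" "finite_dimension M E" "dim F E = dim F M * dim M E"
proof -
  have "subalgebra F M R" by (rule subfield_subalgebra[OF assms(1,2,4)])
  then show FM: "finite_dimension F M"
    using subalbegra_incl_imp_finite_dimension[OF assms(1,6) _ assms(5)] by blast
  obtain n where "dimension n F E" using assms(6) by (rule finite_dimensionE')
  then obtain Us where Us: "set Us \<subseteq> carrier R" "Span F Us = E"
    using exists_base[OF assms(1)] by blast
  have UE: "set Us \<subseteq> E" using Span_base_incl[OF assms(1) Us(1)] Us(2) by simp
  have "subalgebra M E R" by (rule subfield_subalgebra[OF assms(2,3,5)])
  then have "Span M Us \<subseteq> E" using subalgebra_Span_incl[OF assms(2) _ UE] by blast
  moreover have "Span F Us \<subseteq> Span M Us"
    unfolding Span_eq_combine_set[OF assms(1) Us(1)] Span_eq_combine_set[OF assms(2) Us(1)]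
    using assms(4) by blast
  ultimately have "Span M Us = E" using Us(2) by blast
  then show ME: "finite_dimension M E" using Span_finite_dimension[OF assms(2) Us(1)] by simp
  show "dim F E = dim F M * dim M E"
    using telescopic_base_dim(2)[OF assms(1,2) FM ME] by (simp add: over_def)
qed

lemma (in domain) simple_extension_props:
  assumes "subfield F R" "x \<in> carrier R" "(algebraic over F) x"
  shows "subfield (simple_extension F x) R" "F \<subseteq> simple_extension F x" "x \<in> simple_extension F x"
    "finite_dimension F (simple_extension F x)" "dim F (simple_extension F x) = degree (Irr F x)"
  using simple_extension_is_subfield[OF assms(1,2)] assms(3) simple_extension_mem[OF subfieldE(1)[OF assms(1)] assms(2)]
    simple_extension_incl[OF subfieldE(3)[OF assms(1)] assms(2)]
    finite_dimension_simple_extension[OF assms(1,2)] simple_extension_dim[OF assms]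
  by (auto simp: over_def)

lemma (in field) generate_field_eq_simple_extension:
  assumes "subfield F R" "x \<in> carrier R" "(algebraic over F) x"
  shows "generate_field R (F \<union> {x}) = simple_extension F x"
proof (rule generate_fieldI[symmetric])
  show "F \<union> {x} \<subseteq> carrier R" using subfieldE(3)[OF assms(1)] assms(2) by blast
  show "subfield (simple_extension F x) R" using simple_extension_is_subfield[OF assms(1,2)] assms(3) by simp
  show "F \<union> {x} \<subseteq> simple_extension F x"
    using simple_extension_incl[OF subfieldE(3)[OF assms(1)] assms(2)] simple_extension_mem[OF subfieldE(1)[OF assms(1)] assms(2)]
    by blast
  fix M assume "subfield M R" "F \<union> {x} \<subseteq> M"
  then show "simple_extension F x \<subseteq> M" using simple_extension_subring_incl[OF subfieldE(1)] by blast
qed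

text \<open>
  A basis of \<open>E\<close> over \<open>K\<close> consists of algebraic elements over \<open>F\<close>, and adjoining it to \<open>F\<close> gives a
  field containing the compositum.
\<close>

lemma (in field) compositum_finite_dimension:
  assumes "subfield K R" "subfield E R" "subfield F R" "K \<subseteq> E" "K \<subseteq> F" "finite_dimension K E"
  shows "finite_dimension F (generate_field R (E \<union> F))"
proof -
  obtain n where "dimension n K E" using assms(6) by (rule finite_dimensionE')
  then obtain Us where Us: "set Us \<subseteq> carrier R" "Span K Us = E"
    using exists_base[OF assms(1)] by blast
  have UE: "set Us \<subseteq> E" using Span_base_incl[OF assms(1) Us(1)] Us(2) by simp
  have alg: "(algebraic over F) x" if "x \<in> set Us" for x
    using algebraic_mono[OF assms(5)] finite_dimension_imp_algebraic[OF assms(1) subfieldE(1)[OF assms(2)] assms(6)]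
      UE that by (auto simp: over_def)
  let ?C = "finite_extension F Us" and ?G = "generate_field R (E \<union> F)"
  have C: "subfield ?C R" "finite_dimension F ?C" "F \<subseteq> ?C" "set Us \<subseteq> ?C"
    using finite_extension_is_subfield[OF assms(3) Us(1) alg] finite_extension_finite_dimension(1)[OF assms(3) Us(1) alg]
      finite_extension_incl[OF subfieldE(3)[OF assms(3)] Us(1)] finite_extension_mem[OF subfieldE(1)[OF assms(3)] Us(1)]
    by auto
  have "subalgebra K ?C R"
    by (rule subfield_subalgebra[OF assms(1) C(1) subset_trans[OF assms(5) C(3)]])
  from subalgebra_Span_incl[OF assms(1) this C(4)] have "E \<subseteq> ?C" unfolding Us(2) .
  then have EF: "E \<union> F \<subseteq> ?C" using C(3) by (rule Un_least)
  have c: "E \<union> F \<subseteq> carrier R" using subfieldE(3)[OF assms(2)] subfieldE(3)[OF assms(3)] by (rule Un_least)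
  have GC: "?G \<subseteq> ?C" by (rule generate_field_min_subfield1[OF c C(1) EF])
  have G: "subfield ?G R" "F \<subseteq> ?G" using generate_fieldE(1,2)[OF c refl] by auto
  have "subalgebra F ?G R" by (rule subfield_subalgebra[OF assms(3) G])
  then show ?thesis using subalbegra_incl_imp_finite_dimension[OF assms(3) C(2) _ GC] by blast
qed


section \<open>Polynomials as sums of monomials, and roots\<close>

context ring
begin

text \<open>
  Polynomial expressions with coefficients indexed by the exponents. In contrast to the normalised
  coefficient lists with descending exponents, coefficients may vanish anywhere, so that sums and
  derivatives can be formed coefficientwise.
\<close>

primrec psum :: "nat \<Rightarrow> (nat \<Rightarrow> 'a) \<Rightarrow> 'a \<Rightarrow> 'a"
  where "psum 0 c x = \<zero>"
  | "psum (Suc n) c x = psum n c x \<oplus> c n \<otimes> x [^] n"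

lemma psum_closed [simp, intro]:
  "\<lbrakk> \<And>i. i < n \<Longrightarrow> c i \<in> carrier R; x \<in> carrier R \<rbrakk> \<Longrightarrow> psum n c x \<in> carrier R"
  by (induction n) auto

lemma psum_cong:
  "\<lbrakk> \<And>i. i < n \<Longrightarrow> c i = d i \<rbrakk> \<Longrightarrow> psum n c x = psum n d x"
  by (induction n) auto

lemma eval_eq_psum:
  assumes "set p \<subseteq> carrier R" "x \<in> carrier R"
  shows "eval p x = psum (length p) (coeff p) x"
  using assms
proof (induction p)
  case (Cons a p)
  have "psum (length p) (coeff (a # p)) x = psum (length p) (coeff p) x"
    by (rule psum_cong) auto
  with Cons show ?case
    by (simp add: a_comm)
qed simp

lemma psum_eq_eval:
  assumes "\<And>i. i < n \<Longrightarrow> c i \<in> carrier R" "x \<in> carrier R"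
  shows "psum n c x = eval (map c (rev [0..<n])) x"
  using assms
proof (induction n)
  case (Suc n)
  then show ?case
    using psum_closed[of n c x] by (simp add: a_comm)
qed simp

lemma psum_add:
  assumes "\<And>i. i < n \<Longrightarrow> c i \<in> carrier R" "\<And>i. i < n \<Longrightarrow> d i \<in> carrier R" "x \<in> carrier R"
  shows "psum n (\<lambda>i. c i \<oplus> d i) x = psum n c x \<oplus> psum n d x"
  using assms
proof (induction n)
  case (Suc n)
  then show ?case
    by (simp add: l_distr a_ac)
qed simp

lemma psum_smult:
  assumes "\<And>i. i < n \<Longrightarrow> c i \<in> carrier R" "a \<in> carrier R" "x \<in> carrier R"
  shows "psum n (\<lambda>i. a \<otimes> c i) x = a \<otimes> psum n c x"
  using assms
proof (induction n)
  case (Suc n)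
  then show ?case
    by (simp add: r_distr m_assoc)
qed simp

end

lemma (in cring) psum_shift:
  assumes "\<And>i. i < n \<Longrightarrow> c i \<in> carrier R" "x \<in> carrier R"
  shows "x \<otimes> psum n c x = psum (Suc n) (\<lambda>i. if i = 0 then \<zero> else c (i - 1)) x"
  using assms
proof (induction n)
  case (Suc n)
  have "x \<otimes> psum (Suc n) c x = x \<otimes> psum n c x \<oplus> x \<otimes> (c n \<otimes> x [^] n)"
    using Suc.prems by (simp add: r_distr)
  also have "x \<otimes> (c n \<otimes> x [^] n) = c n \<otimes> x [^] Suc n"
    using Suc.prems by (simp add: m_ac)
  finally show ?case
    using Suc by simp
qed simp

text \<open>
  The binomial theorem, read as a polynomial expression in \<open>a\<close>: in prime characteristic all its
  coefficients but the first and the last vanish.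
\<close>

lemma (in cring) binomial_psum:
  assumes "a \<in> carrier R" "b \<in> carrier R"
  shows "(a \<oplus> b) [^] n = psum (Suc n) (\<lambda>i. [(n choose i)] \<cdot> (b [^] (n - i))) a"
proof (induction n)
  case 0
  then show ?case using assms by simp
next
  case (Suc n)
  define c where "c = (\<lambda>i. [(n choose i)] \<cdot> (b [^] (n - i)))"
  have c: "c i \<in> carrier R" for i
    using assms by (simp add: c_def)
  have "(a \<oplus> b) [^] Suc n = (a \<oplus> b) \<otimes> psum (Suc n) c a"
    using assms Suc by (simp add: c_def m_comm)
  also have "\<dots> = a \<otimes> psum (Suc n) c a \<oplus> b \<otimes> psum (Suc n) c a"
    using assms c by (simp add: l_distr del: psum.simps)
  also have "a \<otimes> psum (Suc n) c a = psum (Suc (Suc n)) (\<lambda>i. if i = 0 then \<zero> else c (i - 1)) a"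
    using assms c by (intro psum_shift) auto
  also have "b \<otimes> psum (Suc n) c a = psum (Suc n) (\<lambda>i. b \<otimes> c i) a"
    using assms c by (intro psum_smult[symmetric]) auto
  also have "\<dots> = psum (Suc (Suc n)) (\<lambda>i. b \<otimes> c i) a"
    using assms by (simp add: c_def binomial_eq_0)
  also have "psum (Suc (Suc n)) (\<lambda>i. if i = 0 then \<zero> else c (i - 1)) a \<oplus>
      psum (Suc (Suc n)) (\<lambda>i. b \<otimes> c i) a =
      psum (Suc (Suc n)) (\<lambda>i. (if i = 0 then \<zero> else c (i - 1)) \<oplus> b \<otimes> c i) a"
    using assms c by (intro psum_add[symmetric]) auto
  also have "\<dots> = psum (Suc (Suc n)) (\<lambda>i. [(Suc n choose i)] \<cdot> (b [^] (Suc n - i))) a"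
  proof (rule psum_cong)
    fix i assume "i < Suc (Suc n)"
    have b: "b \<otimes> c i = [(n choose i)] \<cdot> (b [^] (Suc n - i))"
    proof (cases "i \<le> n")
      case True
      then have "b [^] (Suc n - i) = b \<otimes> b [^] (n - i)"
        using assms by (simp add: Suc_diff_le m_comm)
      then show ?thesis
        using assms by (simp add: c_def add_pow_rdistr)
    qed (use assms in \<open>simp add: c_def binomial_eq_0\<close>)
    show "(if i = 0 then \<zero> else c (i - 1)) \<oplus> b \<otimes> c i = [(Suc n choose i)] \<cdot> (b [^] (Suc n - i))"
    proof (cases i)
      case 0
      then show ?thesis using b assms by simp
    next
      case (Suc j)
      then show ?thesis using b assms
        by (simp add: c_def add.nat_pow_mult)
    qed
  qed
  finally show ?case .
qed

lemma (in cring) prime_char_add_pow: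
  assumes "Factorial_Ring.prime p" "[p] \<cdot> \<one> = \<zero>" "a \<in> carrier R" "b \<in> carrier R"
  shows "(a \<oplus> b) [^] (p::nat) = a [^] p \<oplus> b [^] p"
proof -
  have p: "p > 0" using assms(1) by (simp add: prime_gt_0_nat)
  have van: "[m] \<cdot> x = \<zero>" if "p dvd m" "x \<in> carrier R" for m x
  proof -
    from that obtain k where "m = k * p" by (metis dvd_def mult.commute)
    have "[m] \<cdot> x = [m] \<cdot> (\<one> \<otimes> x)" using that by simp
    also have "\<dots> = ([m] \<cdot> \<one>) \<otimes> x" using that by (simp add: add_pow_ldistr)
    also have "[m] \<cdot> \<one> = \<zero>"
      using assms(2) \<open>m = k * p\<close> add.nat_pow_pow[of \<one> k p]
      by (metis add.nat_pow_one add.nat_pow_pow mult.commute one_closed)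
    finally show ?thesis using that by simp
  qed
  obtain q where q: "p = Suc q" using p by (cases p) auto
  define d where "d = (\<lambda>i::nat. if i = 0 then b [^] p else \<zero>)"
  have z: "psum (Suc n) d a = b [^] p" for n
    using assms by (induction n) (auto simp: d_def)
  have "(a \<oplus> b) [^] p = psum p (\<lambda>i. [(p choose i)] \<cdot> (b [^] (p - i))) a \<oplus> a [^] p"
    using assms binomial_psum[of a b p] by simp
  also have "psum p (\<lambda>i. [(p choose i)] \<cdot> (b [^] (p - i))) a = psum p d a"
  proof (rule psum_cong)
    fix i assume "i < p"
    then have "p dvd (p choose i)" if "i \<noteq> 0"
      using that assms(1) by (intro dvd_choose_prime) auto
    then show "[(p choose i)] \<cdot> (b [^] (p - i)) = d i"
      using van assms by (auto simp: d_def)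
  qed
  also have "\<dots> = b [^] p" using z q by simp
  finally show ?thesis using assms by (simp add: a_comm)
qed

lemma (in domain) nat_pow_nonzero [simp]:
  "\<lbrakk> x \<in> carrier R; x \<noteq> \<zero> \<rbrakk> \<Longrightarrow> x [^] (n::nat) \<noteq> \<zero>"
  by (induction n) (auto simp: integral_iff)

lemma (in domain) prime_char_pow_inj:
  assumes "Factorial_Ring.prime p" "[p] \<cdot> \<one> = \<zero>" "a \<in> carrier R" "b \<in> carrier R" "a [^] (p::nat) = b [^] p"
  shows "a = b"
proof -
  have "a = (a \<ominus> b) \<oplus> b" using assms by (simp add: minus_eq a_assoc l_neg)
  then have "a [^] p = (a \<ominus> b) [^] p \<oplus> b [^] p"
    using prime_char_add_pow[OF assms(1,2), of "a \<ominus> b" b] assms(3,4) by simp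
  then have "(a \<ominus> b) [^] p = \<zero>"
    using assms(3-5) add.r_cancel_one[of "b [^] p" "(a \<ominus> b) [^] p"] by simp
  then have "a \<ominus> b = \<zero>"
    using nat_pow_nonzero[of "a \<ominus> b"] assms(3,4) by (metis minus_closed)
  then show ?thesis using assms by simp
qed


section \<open>Derivatives and multiple roots\<close>

text \<open>
  The ring of dual numbers \<open>a + b \<epsilon>\<close>, \<open>\<epsilon>\<^sup>2 = 0\<close>. The coefficient of \<open>\<epsilon>\<close> in \<open>f (a + \<epsilon>)\<close> is the
  formal derivative of \<open>f\<close> at \<open>a\<close>, so that the product rule is the multiplicativity of evaluation.
\<close>

definition dual_numbers :: "('a, 'b) ring_scheme \<Rightarrow> ('a \<times> 'a) ring"
  where "dual_numbers R =
    \<lparr> carrier = carrier R \<times> carrier R,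
      monoid.mult = (\<lambda>(a, a') (b, b'). (a \<otimes>\<^bsub>R\<^esub> b, a \<otimes>\<^bsub>R\<^esub> b' \<oplus>\<^bsub>R\<^esub> a' \<otimes>\<^bsub>R\<^esub> b)),
      monoid.one = (\<one>\<^bsub>R\<^esub>, \<zero>\<^bsub>R\<^esub>), ring.zero = (\<zero>\<^bsub>R\<^esub>, \<zero>\<^bsub>R\<^esub>),
      ring.add = (\<lambda>(a, a') (b, b'). (a \<oplus>\<^bsub>R\<^esub> b, a' \<oplus>\<^bsub>R\<^esub> b')) \<rparr>"

lemma dual_numbers_simps [simp]:
  "carrier (dual_numbers R) = carrier R \<times> carrier R"
  "(a, a') \<otimes>\<^bsub>dual_numbers R\<^esub> (b, b') = (a \<otimes>\<^bsub>R\<^esub> b, a \<otimes>\<^bsub>R\<^esub> b' \<oplus>\<^bsub>R\<^esub> a' \<otimes>\<^bsub>R\<^esub> b)"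
  "\<one>\<^bsub>dual_numbers R\<^esub> = (\<one>\<^bsub>R\<^esub>, \<zero>\<^bsub>R\<^esub>)" "\<zero>\<^bsub>dual_numbers R\<^esub> = (\<zero>\<^bsub>R\<^esub>, \<zero>\<^bsub>R\<^esub>)"
  "(a, a') \<oplus>\<^bsub>dual_numbers R\<^esub> (b, b') = (a \<oplus>\<^bsub>R\<^esub> b, a' \<oplus>\<^bsub>R\<^esub> b')"
  by (simp_all add: dual_numbers_def)

context cring
begin

lemma dual_numbers_cring: "cring (dual_numbers R)"
proof (rule cringI)
  show "abelian_group (dual_numbers R)"
  proof (rule abelian_groupI)
    fix x assume "x \<in> carrier (dual_numbers R)"
    then show "\<exists>y\<in>carrier (dual_numbers R). y \<oplus>\<^bsub>dual_numbers R\<^esub> x = \<zero>\<^bsub>dual_numbers R\<^esub>"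
      by (intro bexI[of _ "(\<ominus> fst x, \<ominus> snd x)"]) (auto simp: l_neg)
  qed (auto simp: a_ac)
  show "Group.comm_monoid (dual_numbers R)"
    by (rule comm_monoidI) (auto simp: m_ac r_distr l_distr a_ac)
qed (auto simp: l_distr a_ac)

lemma dual_numbers_hom: "ring_hom_ring R (dual_numbers R) (\<lambda>a. (a, \<zero>))"
  by (rule ring_hom_ringI2[OF ring_axioms cring.axioms(1)[OF dual_numbers_cring]])
    (rule ring_hom_memI; simp)

lemma dual_numbers_pow:
  assumes "a \<in> carrier R"
  shows "(a, \<one>) [^]\<^bsub>dual_numbers R\<^esub> (n::nat) = (a [^] n, [n] \<cdot> (a [^] (n - 1)))"
proof (induction n)
  case (Suc n)
  interpret D: cring "dual_numbers R" by (rule dual_numbers_cring)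
  have "a [^] n \<oplus> ([n] \<cdot> (a [^] (n - 1))) \<otimes> a = [Suc n] \<cdot> (a [^] n)"
  proof (cases n)
    case (Suc m)
    then show ?thesis using assms by (simp add: add_pow_ldistr a_comm l_distr)
  qed (use assms in simp)
  then show ?case
    using Suc assms by simp
qed simp

lemma eval_dual_numbers:
  assumes "set p \<subseteq> carrier R" "a \<in> carrier R"
  shows "ring.eval (dual_numbers R) (map (\<lambda>a. (a, \<zero>)) p) (a, \<one>) =
    (eval p a, psum (length p - 1) (\<lambda>i. [Suc i] \<cdot> (coeff p (Suc i))) a)"
  using assms(1)
proof (induction p)
  case Nil
  interpret D: cring "dual_numbers R" by (rule dual_numbers_cring)
  show ?case by simp
next
  case (Cons c p)
  interpret D: cring "dual_numbers R" by (rule dual_numbers_cring)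
  show ?case
  proof (cases p)
    case Nil
    then show ?thesis using Cons assms by (simp add: dual_numbers_pow)
  next
    case (Cons d q)
    define l where "l = length q"
    have l: "length p = Suc l" using Cons by (simp add: l_def)
    have c: "c \<in> carrier R" and p: "set p \<subseteq> carrier R" using Cons.prems by auto
    have "psum l (\<lambda>i. [Suc i] \<cdot> (coeff (c # p) (Suc i))) a =
        psum l (\<lambda>i. [Suc i] \<cdot> (coeff p (Suc i))) a"
      by (rule psum_cong) (use l in auto)
    moreover have "psum l (\<lambda>i. [Suc i] \<cdot> (coeff p (Suc i))) a \<in> carrier R"
      using p assms by (intro psum_closed) auto
    moreover have "c \<otimes> ([Suc l] \<cdot> (a [^] l)) = ([Suc l] \<cdot> c) \<otimes> a [^] l"
      using c assms by (metis add_pow_ldistr add_pow_rdistr nat_pow_closed)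
    moreover have "(a, \<one>) [^]\<^bsub>dual_numbers R\<^esub> length p = (a [^] length p, [Suc l] \<cdot> (a [^] l))"
      using dual_numbers_pow[OF assms(2), of "length p"] l by simp
    then have "D.eval (map (\<lambda>a. (a, \<zero>)) (c # p)) (a, \<one>) =
        (c, \<zero>) \<otimes>\<^bsub>dual_numbers R\<^esub> (a [^] length p, [Suc l] \<cdot> (a [^] l)) \<oplus>\<^bsub>dual_numbers R\<^esub>
        D.eval (map (\<lambda>a. (a, \<zero>)) p) (a, \<one>)"
      by simp
    ultimately show ?thesis
      using Cons.IH c p assms l by (simp add: a_comm del: add.nat_pow_Suc nat_pow_Suc)
  qed
qed

end

text \<open>
  The polynomial \<open>X - b\<close> takes the value \<open>\<epsilon>\<close> at \<open>b + \<epsilon>\<close>, so the multiples of its square vanish there,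
  and with them the coefficient of \<open>\<epsilon>\<close>.
\<close>

lemma (in domain) derivative_at_double_root:
  assumes "p \<in> carrier (poly_ring R)" "b \<in> carrier R"
    and "([\<one>, \<ominus> b] [^]\<^bsub>poly_ring R\<^esub> (2::nat)) pdivides p"
  shows "psum (length p - 1) (\<lambda>i. [Suc i] \<cdot> (coeff p (Suc i))) b = \<zero>"
proof -
  interpret D: cring "dual_numbers R" by (rule dual_numbers_cring)
  interpret P: domain "poly_ring R" by (rule univ_poly_is_domain[OF carrier_is_subring])
  define l where "l = [\<one>, \<ominus> b]"
  let ?e = "\<lambda>p. D.eval (map (\<lambda>a. (a, \<zero>)) p) (b, \<one>)"
  have l: "l \<in> carrier (poly_ring R)"
    using assms(2) by (simp add: l_def univ_poly_carrier[symmetric] polynomial_def)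
  have mult: "?e (poly_mult u w) = ?e u \<otimes>\<^bsub>dual_numbers R\<^esub> ?e w"
    if "set u \<subseteq> carrier R" "set w \<subseteq> carrier R" for u w
  proof -
    have "?e (poly_mult u w) = D.eval (D.normalize (map (\<lambda>a. (a, \<zero>)) (poly_mult u w))) (b, \<one>)"
      using poly_mult_in_carrier[OF that] assms(2) by (intro D.eval_normalize[symmetric]) auto
    also have "\<dots> = D.eval (D.poly_mult (map (\<lambda>a. (a, \<zero>)) u) (map (\<lambda>a. (a, \<zero>)) w)) (b, \<one>)"
      using ring_hom_ring.poly_mult_hom'[OF dual_numbers_hom that] by simp
    also have "\<dots> = ?e u \<otimes>\<^bsub>dual_numbers R\<^esub> ?e w"
      using that assms(2) by (intro D.eval_poly_mult) auto
    finally show ?thesis .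
  qed
  from assms(3) obtain q where q: "q \<in> carrier (poly_ring R)"
    and "p = (l [^]\<^bsub>poly_ring R\<^esub> (2::nat)) \<otimes>\<^bsub>poly_ring R\<^esub> q"
    unfolding pdivides_def factor_def l_def by blast
  then have p: "p = poly_mult (poly_mult l l) q"
    using P.nat_pow_Suc[of l 1] P.nat_pow_eone[OF l] unfolding univ_poly_mult 
    by (simp only: numeral_2_eq_2 One_nat_def)
  have sq: "set q \<subseteq> carrier R"
    using q polynomial_incl univ_poly_carrier by blast
  have sl: "set l \<subseteq> carrier R" using assms(2) by (simp add: l_def)
  have el: "?e l = (\<zero>, \<one>)"
  proof -
    have "eval l b = \<zero>"
      using monic_degree_one_root_condition[OF assms(2), of b] unfolding is_root_def l_def by blast
    moreover have "length l = 2" "coeff l (Suc 0) = \<one>" by (simp_all add: l_def)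
    then have "psum (length l - 1) (\<lambda>i. [Suc i] \<cdot> (coeff l (Suc i))) b = \<one>"
      using assms(2) by simp
    ultimately show ?thesis unfolding eval_dual_numbers[OF sl assms(2)] by (simp only:)
  qed
  have ell: "?e (poly_mult l l) = (\<zero>, \<zero>)"
    unfolding mult[OF sl sl] el by simp
  have "?e q \<in> carrier (dual_numbers R)"
    using sq assms(2) by (intro D.eval_in_carrier) auto
  then have "?e p = (\<zero>, \<zero>)"
    unfolding p mult[OF poly_mult_in_carrier[OF sl sl] sq] ell using D.l_null
    by (simp only: dual_numbers_simps(4))
  moreover have "set p \<subseteq> carrier R"
    using assms(1) polynomial_incl univ_poly_carrier by blast
  ultimately show ?thesis
    using eval_dual_numbers[OF _ assms(2), of p] by simp
qed


section \<open>Separable elements\<close>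

context ring
begin

definition zeros :: "'a list \<Rightarrow> 'a set"
  where "zeros p = {a \<in> carrier R. eval p a = \<zero>}"

lemma add_pow_one_eq_zero_iff: "[(n::nat)] \<cdot> \<one> = \<zero> \<longleftrightarrow> ring_char R dvd n"
  using add.pow_eq_id[of \<one> n] by (simp add: ring_char_def)

end

lemma (in domain) prime_ring_char:
  assumes "ring_char R \<noteq> 0"
  shows "Factorial_Ring.prime (ring_char R)"
proof (rule prime_natI)
  show "2 \<le> ring_char R"
    using assms add_pow_one_eq_zero_iff[of 1] by (cases "ring_char R = 1") auto
  fix n m :: nat
  assume "ring_char R dvd n * m"
  then have "[(n * m)] \<cdot> \<one> = \<zero>" by (simp add: add_pow_one_eq_zero_iff)
  moreover have "[(n * m)] \<cdot> \<one> = ([n] \<cdot> \<one>) \<otimes> ([m] \<cdot> \<one>)"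
    using add_pow_ldistr[of \<one> "[m] \<cdot> \<one>" n] add.nat_pow_pow[of \<one> n m]
    by (simp add: mult.commute)
  ultimately show "ring_char R dvd n \<or> ring_char R dvd m"
    using integral_iff by (simp add: add_pow_one_eq_zero_iff)
qed

context domain
begin

lemma zeros_eq_set_roots:
  assumes "p \<in> carrier (poly_ring R)" "p \<noteq> []"
  shows "zeros p = set_mset (roots p)"
  using roots_mem_iff_is_root[OF assms(1)] assms(2) by (auto simp: zeros_def is_root_def)

lemma Irr_degree_less:
  assumes "subfield F R" "x \<in> carrier R" "psum n c x = \<zero>"
    and "\<And>i. i < n \<Longrightarrow> c i \<in> F" "i < n" "c i \<noteq> \<zero>"
  shows "(algebraic over F) x" and "degree (Irr F x) < n"
proof -
  have F: "F \<subseteq> carrier R" "subring F R" using assms(1) subfieldE by auto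
  define p where "p = map c (rev [0..<n])"
  have p: "set p \<subseteq> F" using assms(4) by (auto simp: p_def)
  have np: "normalize p \<in> carrier (F[X])"
    using normalize_gives_polynomial[OF p] univ_poly_carrier by blast
  have "psum n c x = eval p x"
    using assms(2,4) F(1) unfolding p_def by (intro psum_eq_eval) auto
  then have ev: "eval (normalize p) x = \<zero>"
    using eval_normalize[of p x] p F(1) assms(2,3) by auto
  have "p ! (n - 1 - i) = c i"
    using assms(5) by (simp add: p_def rev_nth)
  then have "coeff p i \<noteq> \<zero>"
    using assms(5,6) coeff_nth[of i p] by (simp add: p_def)
  then have ne: "normalize p \<noteq> []"
    using normalize_coeff[of p] by auto
  show alg: "(algebraic over F) x"
    using algebraicI[OF np ne ev] .
  have "degree (Irr F x) \<le> degree (normalize p)"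
    using pdivides_imp_degree_le[OF F(2) IrrE(1)[OF assms(1,2) alg] np ne]
      Irr_minimal[OF assms(1,2) alg np ev] by simp
  also have "\<dots> < n"
    using normalize_length_le[of p] ne assms(5) by (simp add: p_def)
  finally show "degree (Irr F x) < n" .
qed

lemma Irr_not_Nil:
  assumes "subfield F R" "x \<in> carrier R" "(algebraic over F) x"
  shows "Irr F x \<noteq> []" "degree (Irr F x) \<ge> 1" "Irr F x \<in> carrier (poly_ring R)" "set (Irr F x) \<subseteq> F"
proof -
  show "degree (Irr F x) \<ge> 1"
    using pirreducible_degree[OF assms(1) IrrE(1,2)[OF assms]] .
  then show "Irr F x \<noteq> []" by auto
  show "Irr F x \<in> carrier (poly_ring R)"
    using carrier_polynomial_shell[OF subfieldE(1)[OF assms(1)] IrrE(1)[OF assms]] .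
  show "set (Irr F x) \<subseteq> F"
    using IrrE(1)[OF assms] polynomial_incl univ_poly_carrier by blast
qed

lemma Irr_eq_if_root:
  assumes "subfield F R" "x \<in> carrier R" "(algebraic over F) x" "y \<in> carrier R" "eval (Irr F x) y = \<zero>"
  shows "(algebraic over F) y" "Irr F y = Irr F x"
proof -
  show alg: "(algebraic over F) y"
    using algebraicI[OF IrrE(1)[OF assms(1-3)] Irr_not_Nil(1)[OF assms(1-3)] assms(5)] .
  show "Irr F y = Irr F x"
    using minimal_polynomial_is_unique[OF assms(1,4) alg] IrrE[OF assms(1,4) alg] IrrE[OF assms(1-3)] assms(5)
    by blast
qed

lemma mem_if_Irr_degree_1:
  assumes "subfield F R" "x \<in> carrier R" "(algebraic over F) x" "degree (Irr F x) = 1"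
  shows "x \<in> F"
proof -
  note s = simple_extension_props[OF assms(1-3)]
  have "simple_extension F x = F"
    using dim_1_imp_eq[OF assms(1) s(2,4)] s(5) assms(4) by simp
  then show ?thesis using s(3) by simp
qed

end

context field
begin

lemma card_zeros_le:
  assumes "p \<in> carrier (poly_ring R)" "p \<noteq> []"
  shows "finite (zeros p)" "card (zeros p) \<le> degree p"
proof -
  show "finite (zeros p)" using zeros_eq_set_roots[OF assms] by simp
  have "card (zeros p) \<le> size (roots p)"
    unfolding zeros_eq_set_roots[OF assms] size_multiset_overloaded_eq
    using sum_mono[of "set_mset (roots p)" "\<lambda>_. 1" "count (roots p)"]
    by (auto simp: Suc_leI)
  also have "\<dots> \<le> degree p" using size_roots_le_degree[OF assms(1)] .
  finally show "card (zeros p) \<le> degree p" .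
qed

lemma card_set_mset_eq_size_iff:
  "card (set_mset M) = size M \<longleftrightarrow> (\<forall>a. count M a \<le> 1)"
proof
  assume "card (set_mset M) = size M"
  then have "mset_set (set_mset M) = M"
    by (metis finite_set_mset mset_set_set_mset_msubset size_mset_set
        subset_mset.antisym_conv2 mset_subset_size order_less_irrefl)
  then show "\<forall>a. count M a \<le> 1"
    by (metis count_mset_set(1) count_mset_set(3) finite_set_mset le_numeral_extra(4) zero_le_one)
next
  assume "\<forall>a. count M a \<le> 1"
  then have "count M a = 1" if "a \<in># M" for a
    using that by (metis count_greater_eq_one_iff le_antisym)
  then show "card (set_mset M) = size M"
    by (simp add: size_multiset_overloaded_eq)
qed

text \<open>
  An element is separable as soon as it is a root of some polynomial with as many roots as its
  degree: such a polynomial has only simple roots, hence so has its divisor, the minimal polynomial.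
\<close>

lemma separable_if_many_zeros:
  assumes "subfield F R" "x \<in> carrier R" "p \<in> carrier (F[X])" "p \<noteq> []" "eval p x = \<zero>"
    and "degree p \<le> card (zeros p)"
  shows "separable_element R F x"
proof -
  have alg: "(algebraic over F) x" using algebraicI[OF assms(3-5)] .
  note irr = Irr_not_Nil[OF assms(1,2) alg]
  have p: "p \<in> carrier (poly_ring R)"
    using carrier_polynomial_shell[OF subfieldE(1)[OF assms(1)] assms(3)] .
  interpret P: domain "poly_ring R" by (rule univ_poly_is_domain[OF carrier_is_subring])
  obtain q where q: "q \<in> carrier (poly_ring R)" and pq: "p = Irr F x \<otimes>\<^bsub>poly_ring R\<^esub> q"
    using Irr_minimal[OF assms(1,2) alg assms(3,5)] unfolding pdivides_def factor_def by blast
  have q0: "q \<noteq> []" using pq assms(4) P.r_null[OF irr(3)] by (auto simp: univ_poly_zero)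
  have rts: "roots p = roots (Irr F x) + roots q"
    unfolding pq using associated_polynomials_imp_same_roots[OF irr(3,1) q q0] .
  have "degree p = degree (Irr F x) + degree q"
    using poly_mult_degree_eq[OF carrier_is_subring, of "Irr F x" q] irr q q0
    by (simp add: pq univ_poly_mult univ_poly_carrier)
  moreover have "size (roots q) \<le> degree q" "size (roots (Irr F x)) \<le> degree (Irr F x)"
    "size (roots p) \<le> degree p"
    using size_roots_le_degree q irr(3) p by auto
  moreover have "card (set_mset (roots p)) = size (roots p)"
  proof (rule antisym)
    show "card (set_mset (roots p)) \<le> size (roots p)"
      unfolding size_multiset_overloaded_eq
      using sum_mono[of "set_mset (roots p)" "\<lambda>_. 1" "count (roots p)"] by (auto simp: Suc_leI)
  qed (use assms(6) size_roots_le_degree[OF p] zeros_eq_set_roots[OF p assms(4)] in simp)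
  moreover from this have "\<forall>a. count (roots (Irr F x)) a \<le> 1"
    unfolding card_set_mset_eq_size_iff rts by (metis add_leE count_union)
  then have "card (set_mset (roots (Irr F x))) = size (roots (Irr F x))"
    unfolding card_set_mset_eq_size_iff .
  moreover have "size (roots p) = size (roots (Irr F x)) + size (roots q)" using rts by simp
  ultimately have "card (zeros (Irr F x)) = degree (Irr F x)"
    using assms(6) unfolding zeros_eq_set_roots[OF irr(3,1)] zeros_eq_set_roots[OF p assms(4)]
    by linarith
  then show ?thesis
    using alg by (simp add: separable_element_def zeros_def over_def)
qed

lemma separable_iff_zeros:
  "separable_element R F x \<longleftrightarrow> (algebraic over F) x \<and> card (zeros (Irr F x)) = degree (Irr F x)"
  by (simp add: separable_element_def zeros_def over_def)

lemma Irr_zeros_antimono: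
  assumes "subfield F R" "subfield E R" "F \<subseteq> E" "x \<in> carrier R" "(algebraic over F) x"
  shows "zeros (Irr E x) \<subseteq> zeros (Irr F x)" "Irr F x \<in> carrier (E[X])"
proof -
  show F: "Irr F x \<in> carrier (E[X])"
    using IrrE(1)[OF assms(1,4,5)] assms(3) unfolding univ_poly_carrier[symmetric] polynomial_def by auto
  have alg: "(algebraic over E) x" using algebraic_mono[OF assms(3,5)] .
  have "Irr E x pdivides Irr F x"
    using Irr_minimal[OF assms(2,4) alg F IrrE(4)[OF assms(1,4,5)]] .
  then show "zeros (Irr E x) \<subseteq> zeros (Irr F x)"
    using pdivides_imp_root_sharing[OF Irr_not_Nil(3)[OF assms(2,4) alg]] by (auto simp: zeros_def)
qed

lemma separable_mono:
  assumes "subfield F R" "subfield E R" "F \<subseteq> E" "x \<in> carrier R" "separable_element R F x"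
  shows "separable_element R E x"
proof (rule separable_if_many_zeros[OF assms(2,4)])
  have alg: "(algebraic over F) x" using assms(5) by (simp add: separable_iff_zeros)
  show "Irr F x \<in> carrier (E[X])" using Irr_zeros_antimono(2)[OF assms(1-4) alg] .
  show "Irr F x \<noteq> []" "eval (Irr F x) x = \<zero>"
    using Irr_not_Nil(1)[OF assms(1,4) alg] IrrE(4)[OF assms(1,4) alg] .
  show "degree (Irr F x) \<le> card (zeros (Irr F x))" using assms(5) by (simp add: separable_iff_zeros)
qed

end

text \<open>
  An inseparable minimal polynomial has a multiple root. This root also annihilates the derivative,
  which has smaller degree and hence vanishes identically: \<open>i c\<^sub>i = 0\<close> for all coefficients \<open>c\<^sub>i\<close>.
\<close>

lemma (in algebraically_closed) inseparable_Irr_coeff: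
  assumes "subfield F L" "x \<in> carrier L" "(algebraic over F) x" "\<not> separable_element L F x"
  shows "ring_char L \<noteq> 0" and "\<And>i. \<not> ring_char L dvd i \<Longrightarrow> coeff (Irr F x) i = \<zero>"
proof -
  let ?f = "Irr F x"
  note irr = Irr_not_Nil[OF assms(1-3)]
  have F: "F \<subseteq> carrier L" "subring F L" using assms(1) subfieldE by auto
  have "size (roots ?f) = degree ?f"
    using roots_over_carrier[OF irr(3)] by (simp add: splitted_def)
  then have "\<not> (\<forall>b. count (roots ?f) b \<le> 1)"
    using assms(3,4) zeros_eq_set_roots[OF irr(3,1)]
    unfolding card_set_mset_eq_size_iff[symmetric] separable_iff_zeros by auto
  then obtain b where "2 \<le> alg_mult ?f b"
    using alg_mult_eq_count_roots[OF irr(3)] by (auto simp: not_le Suc_le_eq numeral_2_eq_2)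
  then have "is_root ?f b" using alg_mult_gt_zero_iff_is_root[OF irr(3), of b] by simp
  then have b: "b \<in> carrier L" "eval ?f b = \<zero>" by (auto simp: is_root_def)
  define c where "c = (\<lambda>i. [Suc i] \<cdot> (coeff ?f (Suc i)))"
  have d0: "psum (degree ?f) c b = \<zero>"
    unfolding c_def by (rule derivative_at_double_root[OF irr(3) b(1)
      le_alg_mult_imp_pdivides[OF b(1) irr(3) \<open>2 \<le> alg_mult ?f b\<close>]])
  have cF: "coeff ?f i \<in> F" for i
    using irr(4) rangeI[of "coeff ?f" i] subringE(2)[OF F(2)] unfolding coeff_img(3) by auto
  have addF: "[n] \<cdot> y \<in> F" if "y \<in> F" for n :: nat and y
    by (induction n) (use that F subringE in auto)
  have "c i = \<zero>" if "i < degree ?f" for i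
  proof (rule ccontr)
    assume ci: "c i \<noteq> \<zero>"
    have cc: "c j \<in> F" for j unfolding c_def by (rule addF[OF cF])
    have "degree (Irr F b) < degree ?f"
      by (rule Irr_degree_less(2)[OF assms(1) b(1) d0 cc that ci])
    then show False
      using Irr_eq_if_root(2)[OF assms(1-3) b] by simp
  qed
  then have *: "[i] \<cdot> (coeff ?f i) = \<zero>" if "1 \<le> i" "i \<le> degree ?f" for i
    using that by (cases i) (auto simp: c_def)
  have **: "[i] \<cdot> \<one> = \<zero> \<or> coeff ?f i = \<zero>" if "1 \<le> i" "i \<le> degree ?f" for i
  proof -
    have cc: "coeff ?f i \<in> carrier L" using cF F by auto
    have "([i] \<cdot> \<one>) \<otimes> coeff ?f i = [i] \<cdot> (coeff ?f i)"
      using cc add_pow_ldistr[of \<one> "coeff ?f i" i] by simp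
    then show ?thesis using *[OF that] cc integral_iff[of "[i] \<cdot> \<one>" "coeff ?f i"] by simp
  qed
  have "coeff ?f (degree ?f) = \<one>"
    using IrrE(3)[OF assms(1-3)] lead_coeff_simp[OF irr(1)] by (simp only:)
  then have "[(degree ?f)] \<cdot> \<one> = \<zero>" using **[of "degree ?f"] irr(2) by simp
  then show "ring_char L \<noteq> 0" using irr(2) unfolding add_pow_one_eq_zero_iff by auto
  fix i assume i: "\<not> ring_char L dvd i"
  then have "1 \<le> i" by (cases i) auto
  show "coeff ?f i = \<zero>"
  proof (cases "i \<le> degree ?f")
    case True
    then show ?thesis using **[OF \<open>1 \<le> i\<close> True] i by (simp add: add_pow_one_eq_zero_iff)
  next
    case False
    then show ?thesis by (simp add: coeff_degree)
  qed
qed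

lemma (in ring) psum_multiples:
  assumes "\<And>i. \<not> p dvd i \<Longrightarrow> c i = \<zero>" "p > 0" "\<And>i. c i \<in> carrier R" "x \<in> carrier R"
  shows "psum (p * n) c x = psum n (\<lambda>j. c (p * j)) (x [^] p)"
proof (induction n)
  case (Suc n)
  have "psum (p * n + Suc k) c x = psum (p * n) c x \<oplus> c (p * n) \<otimes> x [^] (p * n)" if "k < p" for k
    using that
  proof (induction k)
    case (Suc k)
    have "\<not> p dvd p * n + Suc k"
      using Suc.prems nat_dvd_not_less[of "Suc k" p] dvd_add_right_iff[of p "p * n" "Suc k"] by simp
    then have "c (p * n + Suc k) = \<zero>" using assms(1) by blast
    then show ?case using Suc assms by simp
  qed simp
  from this[of "p - 1"] have "psum (p * Suc n) c x = psum (p * n) c x \<oplus> c (p * n) \<otimes> x [^] (p * n)"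
    using assms(2) by (simp add: add.commute)
  then show ?case using Suc assms by (simp add: nat_pow_pow)
qed simp

lemma (in cring) psum_frobenius:
  assumes "Factorial_Ring.prime p" "[p] \<cdot> \<one> = \<zero>" "\<And>i. i < n \<Longrightarrow> c i \<in> carrier R" "x \<in> carrier R"
  shows "psum n (\<lambda>i. c i [^] p) (x [^] (p::nat)) = (psum n c x) [^] p"
  using assms(3)
proof (induction n)
  case 0
  then show ?case using assms(1) prime_gt_0_nat[of p] by (simp add: nat_pow_zero)
next
  case (Suc n)
  then have "(psum (Suc n) c x) [^] p = (psum n c x) [^] p \<oplus> (c n \<otimes> x [^] n) [^] p"
    using prime_char_add_pow[OF assms(1,2)] assms(4) by simp
  also have "(c n \<otimes> x [^] n) [^] p = c n [^] p \<otimes> (x [^] p) [^] n"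
    using Suc assms(4) by (simp add: nat_pow_distrib nat_pow_pow mult.commute)
  finally show ?case using Suc by simp
qed

text \<open>
  The minimal polynomial of an inseparable element has the form \<open>g(X\<^sup>p)\<close>; here \<open>c\<close> lists the
  coefficients of \<open>g\<close>, whose degree \<open>m\<close> is strictly smaller.
\<close>

lemma (in algebraically_closed) inseparable_psum:
  assumes "subfield F L" "x \<in> carrier L" "(algebraic over F) x" "\<not> separable_element L F x"
  obtains m c where "\<And>i. c i \<in> F" "c m = \<one>" "m < degree (Irr F x)" 
    "psum (Suc m) c (x [^] ring_char L) = \<zero>"
proof -
  let ?f = "Irr F x" and ?p = "ring_char L"
  note irr = Irr_not_Nil[OF assms(1-3)] and ins = inseparable_Irr_coeff[OF assms]
  have F: "F \<subseteq> carrier L" "subring F L" using assms(1) subfieldE by auto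
  have p: "2 \<le> ?p" using prime_ring_char[OF ins(1)] prime_ge_2_nat by blast
  have lc: "coeff ?f (degree ?f) = \<one>"
    using IrrE(3)[OF assms(1-3)] lead_coeff_simp[OF irr(1)] by (simp only:)
  then have "?p dvd degree ?f" using ins(2)[of "degree ?f"] by force
  then obtain m where m: "degree ?f = ?p * m" by blast
  have cF: "coeff ?f i \<in> F" for i
    using irr(4) rangeI[of "coeff ?f" i] subringE(2)[OF F(2)] unfolding coeff_img(3) by auto
  have len: "length ?f = Suc (?p * m)" using m irr(1) by (metis Suc_pred' length_greater_0_conv)
  have "psum (Suc (?p * m) + k) (coeff ?f) x = \<zero>" for k
  proof (induction k)
    case 0
    have "psum (length ?f) (coeff ?f) x = \<zero>"
      using IrrE(4)[OF assms(1-3)] eval_eq_psum[of ?f x] irr(4) F(1) assms(2) by auto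
    then show ?case using len by simp
  next
    case (Suc k)
    have "coeff ?f (Suc (?p * m) + k) = \<zero>" using len by (intro coeff_length) simp
    then show ?case using Suc assms(2) by simp
  qed
  from this[of "?p - 1"] have "psum (?p * Suc m) (coeff ?f) x = \<zero>"
    using p by (simp add: add.commute)
  moreover have cL: "coeff ?f i \<in> carrier L" for i using cF F(1) by auto
  have "psum (?p * Suc m) (coeff ?f) x = psum (Suc m) (\<lambda>j. coeff ?f (?p * j)) (x [^] ?p)"
    using p by (intro psum_multiples[OF ins(2) _ cL assms(2)]) auto
  ultimately have "psum (Suc m) (\<lambda>j. coeff ?f (?p * j)) (x [^] ?p) = \<zero>"
    by (simp only:)
  moreover have "0 < m" using m irr(2) by (cases m) auto
  then have "m < degree ?f" using p m by simp
  ultimately show ?thesis using that[of "\<lambda>j. coeff ?f (?p * j)" m] cF lc m by auto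
qed

text \<open>
  Otherwise the minimal polynomial is \<open>g(X\<^sup>p)\<close>. With the \<open>p\<close>-th roots of the coefficients of \<open>g\<close> it
  becomes a \<open>p\<close>-th power \<open>h(X)\<^sup>p\<close>, and \<open>h\<close> contradicts minimality.
\<close>

lemma (in algebraically_closed) separable_over_perfect:
  assumes "perfect_subfield L F" "x \<in> carrier L" "(algebraic over F) x"
  shows "separable_element L F x"
proof (rule ccontr)
  assume ins: "\<not> separable_element L F x"
  have F: "subfield F L" using assms(1) by (simp add: perfect_subfield_def)
  then have sub: "F \<subseteq> carrier L" using subfieldE(3) by blast
  let ?p = "ring_char L"
  have p: "?p \<noteq> 0" "Factorial_Ring.prime ?p" "[?p] \<cdot> \<one> = \<zero>"
    using inseparable_Irr_coeff(1)[OF F assms(2,3) ins] prime_ring_char add_pow_one_eq_zero_iff by auto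
  obtain m c where c: "\<And>i. c i \<in> F" "c m = \<one>" "m < degree (Irr F x)"
    "psum (Suc m) c (x [^] ?p) = \<zero>"
    using inseparable_psum[OF F assms(2,3) ins] by blast
  have "\<exists>b\<in>F. b [^] ?p = c i" for i
    using assms(1) p(1) c(1) by (auto simp: perfect_subfield_def)
  then obtain b where b: "\<And>i. b i \<in> F" "\<And>i. b i [^] ?p = c i" by metis
  have bc: "b i \<in> carrier L" for i using b(1) sub by auto
  have "(psum (Suc m) b x) [^] ?p = \<zero>"
    using psum_frobenius[OF p(2,3), of "Suc m" b x] bc assms(2) c(4) b(2) by simp
  then have "psum (Suc m) b x = \<zero>"
    using nat_pow_nonzero[of "psum (Suc m) b x"] bc assms(2) by (metis psum_closed)
  moreover have "b m \<noteq> \<zero>" using b(2)[of m] c(2) p(1) by (auto simp: nat_pow_zero)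
  ultimately have "degree (Irr F x) < Suc m"
    using Irr_degree_less(2)[OF F assms(2), of "Suc m" b m] b(1) by simp
  then show False using c(3) by simp
qed

text \<open>
  As long as \<open>x\<close> is inseparable, \<open>x\<^sup>p\<close> has smaller degree. The disjunction excludes zeroth powers: in
  characteristic zero the exponent is \<open>0\<^sup>0 = 1\<close>.
\<close>

lemma (in algebraically_closed) power_char_separable:
  assumes "subfield F L" "x \<in> carrier L" "(algebraic over F) x"
  shows "\<exists>k. (k = 0 \<or> ring_char L \<noteq> 0) \<and> separable_element L F (x [^] (ring_char L ^ k))"
  using assms(2,3)
proof (induction "degree (Irr F x)" arbitrary: x rule: less_induct)
  case less
  show ?case
  proof (cases "separable_element L F x")
    case True
    then show ?thesis using less.prems by (intro exI[of _ 0]) simp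
  next
    case False
    let ?p = "ring_char L"
    obtain m c where c: "\<And>i. c i \<in> F" "c m = \<one>" "m < degree (Irr F x)"
      "psum (Suc m) c (x [^] ?p) = \<zero>"
      using inseparable_psum[OF assms(1) less.prems False] by blast
    have x: "x [^] ?p \<in> carrier L" using less.prems by simp
    note * = Irr_degree_less[OF assms(1) x c(4) c(1), of m]
    have "degree (Irr F (x [^] ?p)) < degree (Irr F x)" "(algebraic over F) (x [^] ?p)"
      using * c(2,3) by force+
    then obtain k where "separable_element L F ((x [^] ?p) [^] (?p ^ k))"
      using less.hyps x by blast
    then have "separable_element L F (x [^] (?p ^ Suc k))"
      using less.prems by (simp add: nat_pow_pow)
    then show ?thesis
      using inseparable_Irr_coeff(1)[OF assms(1) less.prems False] by blast
  qed
qed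


section \<open>Automorphisms of an algebraic closure\<close>

lemma (in algebraically_closed) exists_zero:
  assumes "p \<in> carrier (poly_ring L)" "degree p \<ge> 1"
  shows "\<exists>x\<in>carrier L. eval p x = \<zero>"
proof -
  have "size (roots p) \<ge> 1"
    using roots_over_carrier[OF assms(1)] assms(2) by (simp add: splitted_def)
  then have "roots p \<noteq> {#}" by auto
  then obtain x where "x \<in># roots p" by auto
  then show ?thesis using roots_mem_iff_is_root[OF assms(1)] by (auto simp: is_root_def)
qed

lemma (in ring) eval_const: "\<lbrakk> a \<in> carrier R; x \<in> carrier R \<rbrakk> \<Longrightarrow> eval [a] x = a"
  by simp

text \<open>
  Apply \<open>h\<close> to the coefficients of a polynomial and evaluate at \<open>y\<close>. This annihilates the minimal
  polynomial of \<open>x\<close>, so the result depends only on the value of the given polynomial at \<open>x\<close>.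
\<close>

lemma (in field) extend_hom_simple:
  assumes "subfield E R" "x \<in> carrier R" "(algebraic over E) x"
    and "h \<in> ring_hom (R\<lparr>carrier := E\<rparr>) R" "y \<in> carrier R" "eval (map h (Irr E x)) y = \<zero>"
  obtains h' where "h' \<in> ring_hom (R\<lparr>carrier := simple_extension E x\<rparr>) R"
    and "\<And>e. e \<in> E \<Longrightarrow> h' e = h e" "h' x = y"
proof -
  have E: "subring E R" "E \<subseteq> carrier R" using assms(1) subfieldE by auto
  interpret E: field "R\<lparr>carrier := E\<rparr>" using subfield_iff(2)[OF assms(1)] .
  interpret H: ring_hom_ring "R\<lparr>carrier := E\<rparr>" R h
    using ring_hom_ringI2[OF E.ring_axioms ring_axioms assms(4)] .
  interpret EX: domain "E[X]" by (rule univ_poly_is_domain[OF E(1)])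
  have hE: "h e \<in> carrier R" if "e \<in> E" for e using H.hom_closed[of e] that by simp
  have sE: "set p \<subseteq> E" if "p \<in> carrier (E[X])" for p
    using that polynomial_incl univ_poly_carrier by blast
  have sh: "set (map h p) \<subseteq> carrier R" if "set p \<subseteq> E" for p
    using that hE by auto
  define ev where "ev p = eval (map h p) y" for p
  have ev_closed: "ev p \<in> carrier R" if "p \<in> carrier (E[X])" for p
    unfolding ev_def using sh[OF sE[OF that]] assms(5) by (rule eval_in_carrier)
  have ev_norm: "ev p = eval (normalize (map h p)) y" if "set p \<subseteq> E" for p
    unfolding ev_def using eval_normalize[OF sh[OF that] assms(5)] by simp
  have ev_add: "ev (p \<oplus>\<^bsub>E[X]\<^esub> q) = ev p \<oplus> ev q" if pq: "p \<in> carrier (E[X])" "q \<in> carrier (E[X])" for p q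
  proof -
    have "p \<oplus>\<^bsub>E[X]\<^esub> q = poly_add p q" by (simp add: univ_poly_add)
    moreover have "normalize (map h (poly_add p q)) = poly_add (map h p) (map h q)"
      using H.poly_add_hom'[of p q] sE pq unfolding poly_add_consistent[OF E(1)] by simp
    ultimately have "ev (p \<oplus>\<^bsub>E[X]\<^esub> q) = eval (poly_add (map h p) (map h q)) y"
      using ev_norm[OF sE[OF EX.a_closed[OF pq]]] by simp
    then show ?thesis
      unfolding ev_def using eval_poly_add[OF sh[OF sE[OF pq(1)]] sh[OF sE[OF pq(2)]] assms(5)] by simp
  qed
  have ev_mult: "ev (p \<otimes>\<^bsub>E[X]\<^esub> q) = ev p \<otimes> ev q" if pq: "p \<in> carrier (E[X])" "q \<in> carrier (E[X])" for p q
  proof -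
    have "p \<otimes>\<^bsub>E[X]\<^esub> q = poly_mult p q" by (simp add: univ_poly_mult)
    moreover have "normalize (map h (poly_mult p q)) = poly_mult (map h p) (map h q)"
      using H.poly_mult_hom'[of p q] sE pq unfolding poly_mult_consistent[OF E(1)] by simp
    ultimately have "ev (p \<otimes>\<^bsub>E[X]\<^esub> q) = eval (poly_mult (map h p) (map h q)) y"
      using ev_norm[OF sE[OF EX.m_closed[OF pq]]] by simp
    then show ?thesis
      unfolding ev_def using eval_poly_mult[OF sh[OF sE[OF pq(1)]] sh[OF sE[OF pq(2)]] assms(5)] by simp
  qed
  note irr = IrrE[OF assms(1-3)]
  have ev0: "ev p = \<zero>" if p: "p \<in> carrier (E[X])" "eval p x = \<zero>" for p
  proof -
    have "Irr E x divides\<^bsub>E[X]\<^esub> p"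
      using Irr_minimal[OF assms(1-3) p] pdivides_iff_shell[OF assms(1) irr(1) p(1)] by simp
    then obtain q where q: "q \<in> carrier (E[X])" "p = Irr E x \<otimes>\<^bsub>E[X]\<^esub> q"
      unfolding factor_def by blast
    have "ev (Irr E x) = \<zero>" using assms(6) by (simp add: ev_def)
    then show ?thesis using ev_mult[OF irr(1) q(1)] ev_closed[OF q(1)] by (simp add: q(2))
  qed
  interpret ex: ring_hom_ring "E[X]" R "\<lambda>p. eval p x" using eval_ring_hom[OF E(1) assms(2)] .
  have ev_eq: "ev p = ev q" if pq: "p \<in> carrier (E[X])" "q \<in> carrier (E[X])" "eval p x = eval q x" for p q
  proof -
    define d where "d = p \<ominus>\<^bsub>E[X]\<^esub> q"
    have d: "d \<in> carrier (E[X])" "p = d \<oplus>\<^bsub>E[X]\<^esub> q"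
      using pq(1,2) by (simp_all add: d_def EX.minus_eq EX.a_assoc EX.l_neg)
    have "eval d x = eval p x \<ominus> eval q x"
      using pq(1,2) unfolding d_def EX.minus_eq minus_eq by simp
    then have "eval d x = \<zero>"
      using pq(3) ex.hom_closed[OF pq(2)] by (simp add: r_neg minus_eq)
    then show ?thesis using ev_add[OF d(1) pq(2)] ev0[OF d(1)] ev_closed[OF pq(2)] d(2) by simp
  qed
  define h' where "h' z = ev (SOME p. p \<in> carrier (E[X]) \<and> eval p x = z)" for z
  have h': "h' (eval p x) = ev p" if p: "p \<in> carrier (E[X])" for p
  proof -
    have "\<exists>q. q \<in> carrier (E[X]) \<and> eval q x = eval p x" using p by blast
    from someI_ex[OF this] show ?thesis unfolding h'_def using p by (intro ev_eq) auto
  qed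
  have img: "simple_extension E x = (\<lambda>p. eval p x) ` carrier (E[X])"
    using simple_extension_as_eval_img[OF E(2) assms(2)] .
  show ?thesis
  proof
    show "h' \<in> ring_hom (R\<lparr>carrier := simple_extension E x\<rparr>) R"
    proof (rule ring_hom_memI)
      fix a assume "a \<in> carrier (R\<lparr>carrier := simple_extension E x\<rparr>)"
      then obtain p where p: "p \<in> carrier (E[X])" "a = eval p x" using img by auto
      then show "h' a \<in> carrier R" using h' ev_closed by simp
      fix b assume "b \<in> carrier (R\<lparr>carrier := simple_extension E x\<rparr>)"
      then obtain q where q: "q \<in> carrier (E[X])" "b = eval q x" using img by auto
      show "h' (a \<otimes>\<^bsub>R\<lparr>carrier := simple_extension E x\<rparr>\<^esub> b) = h' a \<otimes> h' b"
        using h'[OF EX.m_closed[OF p(1) q(1)]] h'[OF p(1)] h'[OF q(1)] ev_mult[OF p(1) q(1)]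
          ex.hom_mult[OF p(1) q(1)] p(2) q(2) by simp
      show "h' (a \<oplus>\<^bsub>R\<lparr>carrier := simple_extension E x\<rparr>\<^esub> b) = h' a \<oplus> h' b"
        using h'[OF EX.a_closed[OF p(1) q(1)]] h'[OF p(1)] h'[OF q(1)] ev_add[OF p(1) q(1)]
          ex.hom_add[OF p(1) q(1)] p(2) q(2) by simp
    next
      have "ev \<one>\<^bsub>E[X]\<^esub> = \<one>"
        using assms(5) H.hom_one eval_const[of \<one> y] by (simp only: ev_def univ_poly_one list.map) simp
      then show "h' \<one>\<^bsub>R\<lparr>carrier := simple_extension E x\<rparr>\<^esub> = \<one>"
        using h'[OF EX.one_closed] ex.hom_one by simp
    qed
    fix e assume e: "e \<in> E"
    show "h' e = h e"
    proof (cases "e = \<zero>")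
      case True
      have "h' (eval [] x) = ev []" by (rule h') (use univ_poly_zero_closed in blast)
      then show ?thesis using True H.hom_zero by (simp add: ev_def)
    next
      case False
      then have "[e] \<in> carrier (E[X])" using e unfolding univ_poly_carrier[symmetric] polynomial_def by simp
      from h'[OF this] show ?thesis
        using eval_const[OF hE[OF e] assms(5)] eval_const[of e x] e E(2) assms(2)
        by (simp only: ev_def list.map subsetD)
    qed
  next
    have "h' (eval X x) = ev X" using h'[OF var_closed(1)[OF E(1)]] .
    moreover have "map h X = X" using H.hom_one H.hom_zero by (simp add: var_def)
    ultimately show "h' x = y"
      using eval_var[OF assms(2)] eval_var[OF assms(5)] by (simp only: ev_def)
  qed
qed

context field
begin

text \<open>
  Graphs of embeddings of subfields, as sets of pairs: in this form they are closed under unions of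
  chains.
\<close>

definition embedding_graph :: "('a \<times> 'a) set \<Rightarrow> bool"
  where "embedding_graph G \<longleftrightarrow>
    G \<subseteq> carrier R \<times> carrier R \<and> (\<one>, \<one>) \<in> G \<and>
    (\<forall>a b b'. (a, b) \<in> G \<longrightarrow> (a, b') \<in> G \<longrightarrow> b = b') \<and>
    (\<forall>a b c d. (a, b) \<in> G \<longrightarrow> (c, d) \<in> G \<longrightarrow> (a \<oplus> c, b \<oplus> d) \<in> G \<and> (a \<otimes> c, b \<otimes> d) \<in> G) \<and>
    (\<forall>a b. (a, b) \<in> G \<longrightarrow> (\<ominus> a, \<ominus> b) \<in> G \<and> (a \<noteq> \<zero> \<longrightarrow> (inv a, inv b) \<in> G))"

lemma embedding_graphD:
  assumes "embedding_graph G"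
  shows "G \<subseteq> carrier R \<times> carrier R" "(\<one>, \<one>) \<in> G"
    "(a, b) \<in> G \<Longrightarrow> (a, b') \<in> G \<Longrightarrow> b = b'"
    "(a, b) \<in> G \<Longrightarrow> (c, d) \<in> G \<Longrightarrow> (a \<oplus> c, b \<oplus> d) \<in> G"
    "(a, b) \<in> G \<Longrightarrow> (c, d) \<in> G \<Longrightarrow> (a \<otimes> c, b \<otimes> d) \<in> G"
    "(a, b) \<in> G \<Longrightarrow> (\<ominus> a, \<ominus> b) \<in> G" "(a, b) \<in> G \<Longrightarrow> a \<noteq> \<zero> \<Longrightarrow> (inv a, inv b) \<in> G"
  using assms unfolding embedding_graph_def by simp_all

lemma embedding_graph_Union:
  assumes "\<And>G. G \<in> C \<Longrightarrow> embedding_graph G" "C \<noteq> {}" "\<And>G H. G \<in> C \<Longrightarrow> H \<in> C \<Longrightarrow> G \<subseteq> H \<or> H \<subseteq> G"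
  shows "embedding_graph (\<Union>C)"
proof -
  have two: "\<exists>G\<in>C. p \<in> G \<and> q \<in> G" if "p \<in> \<Union>C" "q \<in> \<Union>C" for p q
    using that assms(3) by blast
  note g = embedding_graphD[OF assms(1)]
  show ?thesis
    unfolding embedding_graph_def
  proof (intro conjI allI impI)
    show "\<Union>C \<subseteq> carrier R \<times> carrier R" using g(1) by blast
    show "(\<one>, \<one>) \<in> \<Union>C" using g(2) assms(2) by blast
    fix a b c d b'
    { assume "(a, b) \<in> \<Union>C" "(a, b') \<in> \<Union>C"
      from two[OF this] obtain G where "G \<in> C" "(a, b) \<in> G" "(a, b') \<in> G" by blast
      then show "b = b'" by (rule g(3)) }
    { assume "(a, b) \<in> \<Union>C" "(c, d) \<in> \<Union>C"
      from two[OF this] obtain G where "G \<in> C" "(a, b) \<in> G" "(c, d) \<in> G" by blast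
      from g(4)[OF this] g(5)[OF this] \<open>G \<in> C\<close>
      show "(a \<oplus> c, b \<oplus> d) \<in> \<Union>C" "(a \<otimes> c, b \<otimes> d) \<in> \<Union>C" by (simp_all only: Union_iff) blast+ }
    assume "(a, b) \<in> \<Union>C"
    then obtain G where G: "G \<in> C" "(a, b) \<in> G" by blast
    show "(\<ominus> a, \<ominus> b) \<in> \<Union>C" using g(6)[OF G] G(1) by (rule UnionI[rotated])
    show "(inv a, inv b) \<in> \<Union>C" if "a \<noteq> \<zero>" using g(7)[OF G that] G(1) by (rule UnionI[rotated])
  qed
qed

lemma field_hom_inv:
  assumes "subfield E R" "h \<in> ring_hom (R\<lparr>carrier := E\<rparr>) R" "a \<in> E" "a \<noteq> \<zero>"
  shows "h a \<noteq> \<zero>" "h (inv a) = inv (h a)"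
proof -
  interpret E: field "R\<lparr>carrier := E\<rparr>" using subfield_iff(2)[OF assms(1)] .
  interpret H: ring_hom_ring "R\<lparr>carrier := E\<rparr>" R h
    using ring_hom_ringI2[OF E.ring_axioms ring_axioms assms(2)] .
  have i: "inv a \<in> E" "inv a \<otimes> a = \<one>" "a \<otimes> inv a = \<one>"
    using subfield_m_inv[OF assms(1), of a] assms(3,4) by auto
  have ha: "h a \<in> carrier R" "h (inv a) \<in> carrier R" using H.hom_closed assms(3) i(1) by auto
  have *: "h (inv a) \<otimes> h a = \<one>" "h a \<otimes> h (inv a) = \<one>"
    using H.hom_mult[of "inv a" a] H.hom_mult[of a "inv a"] H.hom_one i assms(3) by auto
  then show "h a \<noteq> \<zero>" using ha by auto
  show "h (inv a) = inv (h a)" using comm_inv_char[OF ha *(2)] by simp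
qed

lemma embedding_graph_of_hom:
  assumes "subfield E R" "h \<in> ring_hom (R\<lparr>carrier := E\<rparr>) R"
  shows "embedding_graph ((\<lambda>e. (e, h e)) ` E)"
proof -
  have E: "subring E R" "E \<subseteq> carrier R" using assms(1) subfieldE by auto
  note Ec = subringE[OF E(1)]
  interpret E: field "R\<lparr>carrier := E\<rparr>" using subfield_iff(2)[OF assms(1)] .
  interpret H: ring_hom_ring "R\<lparr>carrier := E\<rparr>" R h
    using ring_hom_ringI2[OF E.ring_axioms ring_axioms assms(2)] .
  have hE: "h e \<in> carrier R" if "e \<in> E" for e using H.hom_closed[of e] that by simp
  have m: "h (a \<otimes> b) = h a \<otimes> h b" "h (a \<oplus> b) = h a \<oplus> h b" if "a \<in> E" "b \<in> E" for a b
    using H.hom_mult[of a b] H.hom_add[of a b] that by simp_all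
  have z: "h \<zero> = \<zero>" "h \<one> = \<one>" using H.hom_zero H.hom_one by simp_all
  have n: "h (\<ominus> a) = \<ominus> (h a)" if "a \<in> E" for a
  proof -
    have "h (\<ominus> a) \<oplus> h a = h (\<ominus> a \<oplus> a)" using m(2)[OF Ec(5)[OF that] that] by (rule sym)
    also have "\<ominus> a \<oplus> a = \<zero>" using that E(2) l_neg by blast
    finally show ?thesis using minus_equality[OF _ hE[OF that] hE[OF Ec(5)[OF that]]] z(1) by simp
  qed
  have i: "inv a \<in> E" if "a \<in> E" "a \<noteq> \<zero>" for a
    using subfield_m_inv(1)[OF assms(1), of a] that by blast
  show ?thesis
    unfolding embedding_graph_def
  proof (intro conjI allI impI)
    let ?G = "(\<lambda>e. (e, h e)) ` E"
    show "?G \<subseteq> carrier R \<times> carrier R" using E(2) hE by blast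
    have GI: "(a, b) \<in> ?G" if "a \<in> E" "b = h a" for a b using that by blast
    show "(\<one>, \<one>) \<in> ?G" using GI Ec(3) z(2) by metis
    fix a b c d b'
    { assume "(a, b) \<in> ?G" "(a, b') \<in> ?G" then show "b = b'" by blast }
    { assume "(a, b) \<in> ?G" "(c, d) \<in> ?G"
      then have ac: "a \<in> E" "b = h a" "c \<in> E" "d = h c" by blast+
      show "(a \<oplus> c, b \<oplus> d) \<in> ?G" using GI[OF Ec(7)[OF ac(1,3)]] m(2)[OF ac(1,3)] ac by simp
      show "(a \<otimes> c, b \<otimes> d) \<in> ?G" using GI[OF Ec(6)[OF ac(1,3)]] m(1)[OF ac(1,3)] ac by simp }
    assume "(a, b) \<in> ?G"
    then have ab: "a \<in> E" "b = h a" by blast+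
    show "(\<ominus> a, \<ominus> b) \<in> ?G" using GI[OF Ec(5)[OF ab(1)]] n[OF ab(1)] ab by simp
    assume "a \<noteq> \<zero>"
    then show "(inv a, inv b) \<in> ?G"
      using GI[OF i[OF ab(1)]] field_hom_inv(2)[OF assms ab(1)] ab by simp
  qed
qed

lemma hom_of_embedding_graph:
  assumes "embedding_graph G"
  shows "subfield (Domain G) R"
    and "(\<lambda>x. THE y. (x, y) \<in> G) \<in> ring_hom (R\<lparr>carrier := Domain G\<rparr>) R"
    and "\<And>x y. (x, y) \<in> G \<Longrightarrow> (THE y. (x, y) \<in> G) = y"
proof -
  note g = embedding_graphD[OF assms]
  show the: "(THE y. (x, y) \<in> G) = y" if "(x, y) \<in> G" for x y
    using that g(3) by blast
  show "subfield (Domain G) R"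
  proof (rule subfieldI'[OF subringI])
    show "Domain G \<subseteq> carrier R" using g(1) by blast
    show "\<one> \<in> Domain G" using g(2) by (rule DomainI)
    show "\<ominus> a \<in> Domain G" if "a \<in> Domain G" for a
      using that g(6) by (elim DomainE) (rule DomainI)
    show "a \<otimes> c \<in> Domain G" "a \<oplus> c \<in> Domain G" if "a \<in> Domain G" "c \<in> Domain G" for a c
      using that by (auto elim!: DomainE intro: DomainI g(4,5))
    show "inv a \<in> Domain G" if "a \<in> Domain G - {\<zero>}" for a
      using that g(7) by (auto intro: DomainI)
  qed
  show "(\<lambda>x. THE y. (x, y) \<in> G) \<in> ring_hom (R\<lparr>carrier := Domain G\<rparr>) R"
  proof (rule ring_hom_memI)
    fix a assume "a \<in> carrier (R\<lparr>carrier := Domain G\<rparr>)"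
    then obtain b where ab: "(a, b) \<in> G" by auto
    then show "(THE y. (a, y) \<in> G) \<in> carrier R" using the g(1) by auto
    fix c assume "c \<in> carrier (R\<lparr>carrier := Domain G\<rparr>)"
    then obtain d where cd: "(c, d) \<in> G" by auto
    show "(THE y. (a \<otimes>\<^bsub>R\<lparr>carrier := Domain G\<rparr>\<^esub> c, y) \<in> G) = (THE y. (a, y) \<in> G) \<otimes> (THE y. (c, y) \<in> G)"
      using the ab cd g(5)[OF ab cd] by simp
    show "(THE y. (a \<oplus>\<^bsub>R\<lparr>carrier := Domain G\<rparr>\<^esub> c, y) \<in> G) = (THE y. (a, y) \<in> G) \<oplus> (THE y. (c, y) \<in> G)"
      using the ab cd g(4)[OF ab cd] by simp
  qed (use the g(2) in simp)
qed

end

lemma (in field) eval_fixed_hom: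
  assumes "h \<in> ring_hom R R" "set p \<subseteq> F" "F \<subseteq> carrier R" "\<And>c. c \<in> F \<Longrightarrow> h c = c" "a \<in> carrier R"
  shows "eval p (h a) = h (eval p a)"
proof -
  interpret H: ring_hom_ring R R h using ring_hom_ringI2[OF ring_axioms ring_axioms assms(1)] .
  have "map h p = p" using assms(2,4) by (intro map_idI) auto
  then show ?thesis using H.eval_hom'[of a p] assms(2,3,5) by auto
qed

text \<open>
  The embeddings of intermediate fields that extend \<open>h\<close> satisfy Zorn's lemma; a maximal one is
  defined everywhere because it could be extended to a simple extension otherwise. It is onto
  because it permutes the finitely many roots of each polynomial over the base field.
\<close>

theorem (in algebraic_closure) extend_hom_to_automorphism:
  assumes "subfield E L" "K \<subseteq> E" "h \<in> ring_hom (L\<lparr>carrier := E\<rparr>) L" "\<And>c. c \<in> K \<Longrightarrow> h c = c"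
  obtains \<phi> where "\<phi> \<in> ring_iso L L" "\<And>e. e \<in> E \<Longrightarrow> \<phi> e = h e"
proof -
  define G0 where "G0 = (\<lambda>e. (e, h e)) ` E"
  define A where "A = {G. embedding_graph G \<and> G0 \<subseteq> G}"
  have ne: "A \<noteq> {}"
  proof -
    have "G0 \<in> A" using embedding_graph_of_hom[OF assms(1,3)] unfolding A_def G0_def by blast
    then show ?thesis by blast
  qed
  have "\<Union>C \<in> A" if C: "C \<noteq> {}" "subset.chain A C" for C
  proof -
    from C(2) have sub: "C \<subseteq> A" and ch: "\<And>G H. G \<in> C \<Longrightarrow> H \<in> C \<Longrightarrow> G \<subseteq> H \<or> H \<subseteq> G"
      unfolding subset_chain_def by blast+
    have "embedding_graph (\<Union>C)"
      by (rule embedding_graph_Union[OF _ C(1) ch]) (use sub A_def in blast)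
    moreover have "G0 \<subseteq> \<Union>C" using C(1) sub unfolding A_def by blast
    ultimately show ?thesis by (simp add: A_def)
  qed
  from subset_Zorn_nonempty[OF ne this] have "\<exists>M\<in>A. \<forall>N\<in>A. M \<subseteq> N \<longrightarrow> N = M" .
  then obtain M where MA: "M \<in> A" and maxA: "\<And>N. N \<in> A \<Longrightarrow> M \<subseteq> N \<Longrightarrow> N = M"
    by blast
  have M: "embedding_graph M" "G0 \<subseteq> M" using MA by (simp_all add: A_def)
  have max: "N = M" if "embedding_graph N" "M \<subseteq> N" for N
    using maxA[of N] that M(2) by (auto simp: A_def)
  define \<phi> where "\<phi> = (\<lambda>x. THE y. (x, y) \<in> M)"
  note D = hom_of_embedding_graph[OF M(1), folded \<phi>_def]
  have sh: "\<phi> e = h e" if "e \<in> E" for e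
    using D(3)[of e "h e"] M(2) that unfolding \<phi>_def G0_def by blast
  have "K \<subseteq> Domain M" using assms(2) M(2) by (auto simp: G0_def)
  have dom: "Domain M = carrier L"
  proof (rule ccontr)
    assume "Domain M \<noteq> carrier L"
    then obtain x where x: "x \<in> carrier L" "x \<notin> Domain M"
      using subfieldE(3)[OF D(1)] by blast
    have alg: "(algebraic over Domain M) x"
      using algebraic_mono[OF \<open>K \<subseteq> Domain M\<close> algebraic_extension[OF x(1)]] .
    note irr = IrrE[OF D(1) x(1) alg] Irr_not_Nil[OF D(1) x(1) alg]
    interpret H: ring_hom_ring "L\<lparr>carrier := Domain M\<rparr>" L \<phi>
      using ring_hom_ringI2[OF subring_is_ring[OF subfieldE(1)[OF D(1)]] ring_axioms D(2)] .
    have "\<phi> \<one> = \<one>" using H.hom_one by simp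
    have "\<phi> a \<in> carrier L" if "a \<in> Domain M" for a
      using ring_hom_closed[OF D(2), of a] that by simp
    then have img: "\<phi> ` set (Irr (Domain M) x) \<subseteq> carrier L" using irr(8) by blast
    have "map \<phi> (Irr (Domain M) x) \<in> carrier (poly_ring L)"
      unfolding univ_poly_carrier[symmetric] polynomial_def
      using irr(3,5) img \<open>\<phi> \<one> = \<one>\<close> by (simp add: hd_map)
    moreover have "degree (map \<phi> (Irr (Domain M) x)) \<ge> 1" using irr(6) by simp
    ultimately obtain y where y: "y \<in> carrier L" "eval (map \<phi> (Irr (Domain M) x)) y = \<zero>"
      using exists_zero by blast
    from extend_hom_simple[OF D(1) x(1) alg D(2) y] obtain h'
      where h': "h' \<in> ring_hom (L\<lparr>carrier := simple_extension (Domain M) x\<rparr>) L"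
        "\<And>e. e \<in> Domain M \<Longrightarrow> h' e = \<phi> e" by blast
    let ?S = "simple_extension (Domain M) x"
    have S: "subfield ?S L" "Domain M \<subseteq> ?S" "x \<in> ?S"
      using simple_extension_props[OF D(1) x(1) alg] by blast+
    have "embedding_graph ((\<lambda>e. (e, h' e)) ` ?S)"
      using embedding_graph_of_hom[OF S(1) h'(1)] .
    moreover have "M \<subseteq> (\<lambda>e. (e, h' e)) ` ?S"
    proof
      fix p assume "p \<in> M"
      then obtain a b where "p = (a, b)" "(a, b) \<in> M" by (cases p) auto
      moreover from this have "a \<in> Domain M" "h' a = b" using h'(2)[of a] D(3)[of a b] \<phi>_def by auto
      ultimately show "p \<in> (\<lambda>e. (e, h' e)) ` ?S" using S(2) by auto
    qed
    ultimately have "M = (\<lambda>e. (e, h' e)) ` ?S" using max by blast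
    then have "x \<in> Domain M" using S(3) by auto
    then show False using x(2) by simp
  qed
  have hom: "\<phi> \<in> ring_hom L L"
    using D(2) unfolding dom by (auto simp: ring_hom_def)
  have fixd: "\<phi> c = c" if "c \<in> K" for c using sh assms(2,4) that by auto
  have inj: "inj_on \<phi> (carrier L)"
  proof (rule inj_onI)
    interpret H: ring_hom_ring L L \<phi> using ring_hom_ringI2[OF ring_axioms ring_axioms hom] .
    fix a b assume ab: "a \<in> carrier L" "b \<in> carrier L" "\<phi> a = \<phi> b"
    then have "\<phi> (a \<ominus> b) = \<zero>" by (simp add: minus_eq r_neg)
    then have "a \<ominus> b = \<zero>"
      using field_hom_inv(1)[OF carrier_is_subfield, of \<phi> "a \<ominus> b"] hom ab by auto
    then show "a = b" using ab by simp
  qed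
  have "z \<in> \<phi> ` carrier L" if z: "z \<in> carrier L" for z
  proof -
    note alg = algebraic_extension[OF z]
    note irr = Irr_not_Nil[OF subfield_axioms z alg]
    let ?Z = "zeros (Irr K z)"
    have "\<phi> a \<in> ?Z" if "a \<in> ?Z" for a
    proof -
      have "\<phi> a \<in> carrier L" using that ring_hom_closed[OF hom] by (auto simp: zeros_def)
      moreover have "\<phi> \<zero> = \<zero>" using ring_hom_zero[OF hom ring_axioms ring_axioms] .
      ultimately show ?thesis
        using eval_fixed_hom[OF hom irr(4) subfieldE(3)[OF subfield_axioms] fixd] that
        by (auto simp: zeros_def)
    qed
    then have "\<phi> ` ?Z = ?Z"
      using card_zeros_le(1)[OF irr(3,1)] inj_on_subset[OF inj, of ?Z]
      by (intro endo_inj_surj) (auto simp: zeros_def)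
    moreover have "z \<in> ?Z" using IrrE(4)[OF subfield_axioms z alg] z by (simp add: zeros_def)
    ultimately show ?thesis by (auto simp: zeros_def)
  qed
  then have "bij_betw \<phi> (carrier L) (carrier L)"
    using inj ring_hom_closed[OF hom] by (auto simp: bij_betw_def)
  then show ?thesis using that[of \<phi>] hom sh by (auto simp: ring_iso_def)
qed

lemma (in algebraic_closure) conjugate_automorphism:
  assumes "x \<in> carrier L" "y \<in> zeros (Irr K x)"
  obtains \<phi> where "\<phi> \<in> ring_iso L L" "\<And>c. c \<in> K \<Longrightarrow> \<phi> c = c" "\<phi> x = y"
proof -
  note alg = algebraic_extension[OF assms(1)]
  have id: "id \<in> ring_hom (L\<lparr>carrier := K\<rparr>) L"
    using subfieldE(3)[OF subfield_axioms] by (auto simp: ring_hom_def)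
  have y: "y \<in> carrier L" "eval (map id (Irr K x)) y = \<zero>" using assms(2) by (simp_all add: zeros_def)
  from extend_hom_simple[OF subfield_axioms assms(1) alg id y] obtain h
    where h: "h \<in> ring_hom (L\<lparr>carrier := simple_extension K x\<rparr>) L" "\<And>c. c \<in> K \<Longrightarrow> h c = c" "h x = y"
    by auto
  have S: "subfield (simple_extension K x) L" "K \<subseteq> simple_extension K x" "x \<in> simple_extension K x"
    using simple_extension_props[OF subfield_axioms assms(1) alg] by blast+
  from extend_hom_to_automorphism[OF S(1,2) h(1,2)] obtain \<phi>
    where \<phi>: "\<phi> \<in> ring_iso L L" "\<And>e. e \<in> simple_extension K x \<Longrightarrow> \<phi> e = h e" by blast
  show ?thesis
  proof (rule that[OF \<phi>(1)])
    show "\<phi> c = c" if "c \<in> K" for c using \<phi>(2)[of c] h(2)[OF that] S(2) that by auto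
    show "\<phi> x = y" using \<phi>(2)[OF S(3)] h(3) by simp
  qed
qed

text \<open>
  Automorphisms act transitively on conjugates, so a fixed element has no conjugate but itself; being
  separable, it has degree one.
\<close>

lemma (in algebraic_closure) fixed_separable_mem:
  assumes "separable_element L K x" "x \<in> carrier L"
    and "\<And>\<phi>. \<phi> \<in> ring_iso L L \<Longrightarrow> (\<And>c. c \<in> K \<Longrightarrow> \<phi> c = c) \<Longrightarrow> \<phi> x = x"
  shows "x \<in> K"
proof -
  note alg = algebraic_extension[OF assms(2)]
  have "zeros (Irr K x) \<subseteq> {x}"
    using conjugate_automorphism[OF assms(2)] assms(3) by blast
  moreover have "x \<in> zeros (Irr K x)"
    using IrrE(4)[OF subfield_axioms assms(2) alg] assms(2) by (simp add: zeros_def)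
  ultimately have "zeros (Irr K x) = {x}" by blast
  then have "degree (Irr K x) = 1" using assms(1) unfolding separable_iff_zeros by simp
  then show ?thesis using mem_if_Irr_degree_1[OF subfield_axioms assms(2) alg] by simp
qed

lemma (in algebraic_closure) algebraic_closure_intermediate:
  assumes "subfield E L" "K \<subseteq> E"
  shows "algebraic_closure L E"
proof -
  interpret E: subfield E L by (rule assms(1))
  show ?thesis
  proof
    show "(algebraic over E) x" if "x \<in> carrier L" for x
      using algebraic_mono[OF assms(2) algebraic_extension[OF that]] .
    show "splitted P" if "P \<in> carrier (E[X])" for P
      using roots_over_carrier carrier_polynomial_shell[OF subfieldE(1)[OF assms(1)] that] .
  qed
qed


section \<open>Subgroups of finite index of an ordered abelian group\<close>

definition nmult :: "nat \<Rightarrow> 'g::ab_group_add \<Rightarrow> 'g"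
  where "nmult n g = (\<Sum>i<n. g)"

lemma nmult_simps [simp]: "nmult 0 g = 0" "nmult (Suc n) g = nmult n g + g" "nmult n 0 = 0"
  by (simp_all add: nmult_def)

lemma nmult_add_left: "nmult (m + n) g = nmult m g + nmult n g"
  by (induction n) (auto simp: ac_simps)

lemma nmult_mult: "nmult (m * n) g = nmult m (nmult n g)"
  by (induction m) (auto simp: nmult_add_left ac_simps)

lemma sum_const_nmult: "finite S \<Longrightarrow> (\<Sum>x\<in>S. g) = nmult (card S) g"
  by (induction rule: finite_induct) (auto simp: ac_simps)

text \<open>
  All value groups are subsets of one ordered group, so subgroups, cosets and indices are expressed
  by its own operations rather than by a separate group structure for each field.
\<close>

definition is_subgrp :: "'g::ab_group_add set \<Rightarrow> bool"
  where "is_subgrp A \<longleftrightarrow> 0 \<in> A \<and> (\<forall>x\<in>A. \<forall>y\<in>A. x - y \<in> A)"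

lemma is_subgrpD:
  assumes "is_subgrp A"
  shows "0 \<in> A" "x \<in> A \<Longrightarrow> y \<in> A \<Longrightarrow> x - y \<in> A" "x \<in> A \<Longrightarrow> - x \<in> A"
    "x \<in> A \<Longrightarrow> y \<in> A \<Longrightarrow> x + y \<in> A" "x \<in> A \<Longrightarrow> nmult n x \<in> A"
proof -
  have z: "0 \<in> A" and d: "\<And>x y. x \<in> A \<Longrightarrow> y \<in> A \<Longrightarrow> x - y \<in> A"
    using assms unfolding is_subgrp_def by auto
  have m: "- x \<in> A" if "x \<in> A" for x using d[OF z that] by simp
  have p: "x + y \<in> A" if "x \<in> A" "y \<in> A" for x y using d[OF that(1) m[OF that(2)]] by simp
  have "nmult n x \<in> A" if "x \<in> A" for x using that by (induction n) (auto intro: p z)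
  then show "0 \<in> A" "x \<in> A \<Longrightarrow> y \<in> A \<Longrightarrow> x - y \<in> A" "x \<in> A \<Longrightarrow> - x \<in> A"
    "x \<in> A \<Longrightarrow> y \<in> A \<Longrightarrow> x + y \<in> A" "x \<in> A \<Longrightarrow> nmult n x \<in> A"
    using z d m p by blast+
qed

definition gcoset :: "'g::ab_group_add set \<Rightarrow> 'g \<Rightarrow> 'g set"
  where "gcoset A c = (\<lambda>a. a + c) ` A"

text \<open>
  An infinite index is counted as zero, so that positivity of the index expresses finiteness.
\<close>

definition gindex :: "'g::ab_group_add set \<Rightarrow> 'g set \<Rightarrow> nat"
  where "gindex A C = card (gcoset A ` C)"

lemma mem_gcoset_iff: "is_subgrp A \<Longrightarrow> d \<in> gcoset A c \<longleftrightarrow> d - c \<in> A"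
  unfolding gcoset_def image_iff by (metis add_diff_cancel diff_add_cancel)

lemma gcoset_eq_iff: "is_subgrp A \<Longrightarrow> gcoset A c = gcoset A d \<longleftrightarrow> c - d \<in> A"
proof
  assume A: "is_subgrp A"
  { assume "gcoset A c = gcoset A d"
    then show "c - d \<in> A" using mem_gcoset_iff[OF A, of c d] mem_gcoset_iff[OF A, of c c] is_subgrpD(1)[OF A] by simp }
  assume cd: "c - d \<in> A"
  have "x - c \<in> A \<longleftrightarrow> x - d \<in> A" for x
    using is_subgrpD(2)[OF A, of "x - d" "c - d"] is_subgrpD(4)[OF A, of "x - c" "c - d"] cd by auto
  then show "gcoset A c = gcoset A d" using mem_gcoset_iff[OF A] by blast
qed

text \<open>
  Sums of representatives of \<open>B / A\<close> and of \<open>C / B\<close> represent each coset of \<open>C / A\<close> once.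
\<close>

lemma gindex_tower:
  assumes "is_subgrp A" "is_subgrp B" "is_subgrp C" "A \<subseteq> B" "B \<subseteq> C"
  shows "gindex A C = gindex A B * gindex B C"
proof -
  define s where "s U = (SOME c. c \<in> C \<and> gcoset B c = U)" for U
  define t where "t Y = (SOME b. b \<in> B \<and> gcoset A b = Y)" for Y
  have s: "s (gcoset B c) \<in> C" "gcoset B (s (gcoset B c)) = gcoset B c" if "c \<in> C" for c
    using someI_ex[of "\<lambda>c'. c' \<in> C \<and> gcoset B c' = gcoset B c"] that unfolding s_def by blast+
  have t: "t (gcoset A b) \<in> B" "gcoset A (t (gcoset A b)) = gcoset A b" if "b \<in> B" for b
    using someI_ex[of "\<lambda>b'. b' \<in> B \<and> gcoset A b' = gcoset A b"] that unfolding t_def by blast+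
  have "bij_betw (\<lambda>(Y, U). gcoset A (t Y + s U)) (gcoset A ` B \<times> gcoset B ` C) (gcoset A ` C)"
    unfolding bij_betw_def
  proof
    show "inj_on (\<lambda>(Y, U). gcoset A (t Y + s U)) (gcoset A ` B \<times> gcoset B ` C)"
    proof (rule inj_onI, clarsimp)
      fix b b' c c' assume *: "b \<in> B" "b' \<in> B" "c \<in> C" "c' \<in> C"
        and "gcoset A (t (gcoset A b) + s (gcoset B c)) = gcoset A (t (gcoset A b') + s (gcoset B c'))"
      then have e: "(t (gcoset A b) + s (gcoset B c)) - (t (gcoset A b') + s (gcoset B c')) \<in> A"
        using gcoset_eq_iff[OF assms(1)] by blast
      have "s (gcoset B c) - s (gcoset B c') =
          ((t (gcoset A b) + s (gcoset B c)) - (t (gcoset A b') + s (gcoset B c'))) - (t (gcoset A b) - t (gcoset A b'))"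
        by simp
      also have "\<dots> \<in> B"
        by (intro is_subgrpD(2)[OF assms(2)] subsetD[OF assms(4) e] t(1) *)
      finally have U: "gcoset B c = gcoset B c'"
        using gcoset_eq_iff[OF assms(2), of "s (gcoset B c)" "s (gcoset B c')"] s(2)[OF *(3)] s(2)[OF *(4)]
        by simp
      with e have "t (gcoset A b) - t (gcoset A b') \<in> A" by simp
      then have "gcoset A b = gcoset A b'"
        using gcoset_eq_iff[OF assms(1), of "t (gcoset A b)" "t (gcoset A b')"] t(2)[OF *(1)] t(2)[OF *(2)]
        by simp
      with U show "gcoset A b = gcoset A b' \<and> gcoset B c = gcoset B c'" by simp
    qed
    show "(\<lambda>(Y, U). gcoset A (t Y + s U)) ` (gcoset A ` B \<times> gcoset B ` C) = gcoset A ` C"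
    proof (intro equalityI subsetI)
      fix Z assume "Z \<in> (\<lambda>(Y, U). gcoset A (t Y + s U)) ` (gcoset A ` B \<times> gcoset B ` C)"
      then obtain b c where "b \<in> B" "c \<in> C" "Z = gcoset A (t (gcoset A b) + s (gcoset B c))" by auto
      then show "Z \<in> gcoset A ` C"
        using is_subgrpD(4)[OF assms(3) subsetD[OF assms(5) t(1)] s(1)] by blast
    next
      fix Z assume "Z \<in> gcoset A ` C"
      then obtain c where c: "c \<in> C" "Z = gcoset A c" by auto
      define b where "b = c - s (gcoset B c)"
      have b: "b \<in> B" unfolding b_def using gcoset_eq_iff[OF assms(2), of c "s (gcoset B c)"] s(2)[OF c(1)] by simp
      have "c - (t (gcoset A b) + s (gcoset B c)) = b - t (gcoset A b)" by (simp add: b_def)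
      also have "\<dots> \<in> A" using gcoset_eq_iff[OF assms(1), of b "t (gcoset A b)"] t(2)[OF b] by simp
      finally have "Z = gcoset A (t (gcoset A b) + s (gcoset B c))"
        using gcoset_eq_iff[OF assms(1)] c(2) by simp
      then show "Z \<in> (\<lambda>(Y, U). gcoset A (t Y + s U)) ` (gcoset A ` B \<times> gcoset B ` C)"
        using b c(1) by (intro image_eqI[of _ _ "(gcoset A b, gcoset B c)"]) auto
    qed
  qed
  from bij_betw_same_card[OF this] show ?thesis
    by (simp add: gindex_def card_cartesian_product)
qed

text \<open>
  Translation by \<open>c\<close> permutes the cosets, so summing a system of representatives before and after
  the translation gives \<open>nmult n c\<close> up to an element of the subgroup.
\<close>

lemma nmult_gindex_mem:
  assumes "is_subgrp A" "is_subgrp C" "gindex A C > 0" "c \<in> C"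
  shows "nmult (gindex A C) c \<in> A"
proof -
  define Q where "Q = gcoset A ` C"
  have fin: "finite Q" using assms(3) card_gt_0_iff unfolding Q_def gindex_def by blast
  define s where "s U = (SOME d. d \<in> C \<and> gcoset A d = U)" for U
  have s: "s U \<in> C" "gcoset A (s U) = U" if "U \<in> Q" for U
    using someI_ex[of "\<lambda>d. d \<in> C \<and> gcoset A d = U"] that unfolding s_def Q_def by blast+
  define f where "f U = gcoset A (c + s U)" for U
  have fQ: "f U \<in> Q" if "U \<in> Q" for U
    unfolding f_def Q_def using is_subgrpD(4)[OF assms(2) assms(4) s(1)[OF that]] by blast
  have "inj_on f Q"
  proof (rule inj_onI)
    fix U Y assume XY: "U \<in> Q" "Y \<in> Q" "f U = f Y"
    then have "s U - s Y \<in> A" unfolding f_def gcoset_eq_iff[OF assms(1)] by simp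
    then show "U = Y" 
      using gcoset_eq_iff[OF assms(1), of "s U" "s Y"] s(2)[OF XY(1)] s(2)[OF XY(2)] by simp
  qed
  then have f: "f ` Q = Q" using endo_inj_surj[OF fin] fQ by blast
  \<comment> \<open>\<open>s (f U)\<close> and \<open>c + s U\<close> represent the same coset\<close>
  have "(\<Sum>U\<in>Q. s (f U) - (c + s U)) \<in> A"
  proof -
    have "s (f U) - (c + s U) \<in> A" if "U \<in> Q" for U
      using s(2)[OF fQ[OF that]] gcoset_eq_iff[OF assms(1), of "s (f U)" "c + s U"] unfolding f_def by simp
    then show ?thesis using fin
      by (induction Q rule: infinite_finite_induct) (auto intro: is_subgrpD[OF assms(1)])
  qed
  moreover have "(\<Sum>U\<in>Q. s (f U) - (c + s U)) = (\<Sum>U\<in>Q. s (f U)) - (nmult (card Q) c + (\<Sum>U\<in>Q. s U))"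
    using fin by (simp add: sum_subtractf sum.distrib sum_const_nmult)
  moreover have "(\<Sum>U\<in>Q. s (f U)) = (\<Sum>U\<in>Q. s U)"
    using sum.reindex[OF \<open>inj_on f Q\<close>, of s] f by simp
  ultimately have "- nmult (card Q) c \<in> A" by simp
  then show ?thesis using is_subgrpD(3)[OF assms(1)] unfolding gindex_def Q_def by force
qed

lemma coprime_nmult_mem:
  assumes "is_subgrp A" "nmult m c \<in> A" "nmult n c \<in> A" "coprime m n"
  shows "c \<in> A"
proof (cases "m = 0")
  case True
  then show ?thesis using assms by simp
next
  case False
  then obtain x y where "m * x = n * y + 1"
    using bezout_nat[of m n] assms(4) by (auto simp: coprime_iff_gcd_eq_1)
  then have "nmult x (nmult m c) = nmult y (nmult n c) + c"
    by (simp add: nmult_mult[symmetric] mult.commute[of x] mult.commute[of y])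
  then have "c = nmult x (nmult m c) - nmult y (nmult n c)" by simp
  then show ?thesis using is_subgrpD[OF assms(1)] assms(2,3) by metis
qed

lemma gindex_eq_1: "is_subgrp A \<Longrightarrow> gindex A A = 1"
proof -
  assume A: "is_subgrp A"
  have "gcoset A ` A = {gcoset A 0}"
    using gcoset_eq_iff[OF A, of _ 0] is_subgrpD(1)[OF A] by auto
  then show ?thesis by (simp add: gindex_def)
qed


section \<open>Valuations and residues\<close>

locale valued_field = field R for R (structure) +
  fixes v :: "'a \<Rightarrow> 'g::linordered_ab_group_add"
  assumes valuation: "valuation R v"
begin

abbreviation vals :: "'a set \<Rightarrow> 'g set" where "vals F \<equiv> v ` (F - {\<zero>})"
abbreviation \<O> where "\<O> \<equiv> valuation_ring R v (carrier R)"
abbreviation \<kappa> where "\<kappa> \<equiv> residue_field R v"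
abbreviation res where "res \<equiv> residue R v"
abbreviation resf where "resf \<equiv> residue_subfield R v"

text \<open>
  The inequality \<open>g < v x\<close> with the value of zero read as infinity. Its negation bounds the value of
  \<open>x\<close> from above and includes that \<open>x\<close> is nonzero.
\<close>

definition above :: "'g \<Rightarrow> 'a \<Rightarrow> bool"
  where "above g x \<longleftrightarrow> x = \<zero> \<or> g < v x"

lemma v_mult [simp]:
  "\<lbrakk> x \<in> carrier R; y \<in> carrier R; x \<noteq> \<zero>; y \<noteq> \<zero> \<rbrakk> \<Longrightarrow> v (x \<otimes> y) = v x + v y"
  using valuation by (auto simp: valuation_def)

lemma v_add_ge:
  "\<lbrakk> x \<in> carrier R; y \<in> carrier R; x \<noteq> \<zero>; y \<noteq> \<zero>; x \<oplus> y \<noteq> \<zero> \<rbrakk> \<Longrightarrow> min (v x) (v y) \<le> v (x \<oplus> y)"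
  using valuation by (auto simp: valuation_def)

lemma v_one [simp]: "v \<one> = 0"
  using v_mult[of \<one> \<one>] by (simp del: v_mult)

lemma double_eq_zero: "(a::'g) + a = 0 \<longleftrightarrow> a = 0"
  by (metis add_neg_neg add_pos_pos add_0 less_irrefl linorder_neqE)

lemma v_minus [simp]:
  assumes "x \<in> carrier R" shows "v (\<ominus> x) = v x"
proof (cases "x = \<zero>")
  case False
  have "\<ominus> \<one> \<noteq> \<zero>" by (metis add.inv_eq_1_iff one_closed one_not_zero)
  moreover have "(\<ominus> \<one>) \<otimes> (\<ominus> \<one>) = \<one>" by (simp add: l_minus)
  ultimately have "v (\<ominus> \<one>) + v (\<ominus> \<one>) = 0"
    using v_mult[of "\<ominus> \<one>" "\<ominus> \<one>"] by simp
  then have "v (\<ominus> \<one>) = 0" by (simp add: double_eq_zero)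
  moreover have "\<ominus> x = (\<ominus> \<one>) \<otimes> x" using assms by (simp add: l_minus)
  ultimately show ?thesis using v_mult[of "\<ominus> \<one>" x] assms False \<open>\<ominus> \<one> \<noteq> \<zero>\<close> by simp
qed simp

lemma inv_nonzero [simp]: "\<lbrakk> x \<in> carrier R; x \<noteq> \<zero> \<rbrakk> \<Longrightarrow> inv x \<in> carrier R \<and> inv x \<noteq> \<zero> \<and> x \<otimes> inv x = \<one> \<and> inv x \<otimes> x = \<one>"
  using field_Units[symmetric] by (metis DiffI Units_inv_closed Units_r_inv Units_l_inv r_null one_not_zero singletonD)

lemma v_inv [simp]:
  assumes "x \<in> carrier R" "x \<noteq> \<zero>" shows "v (inv x) = - v x"
proof -
  have "v x + v (inv x) = 0" using v_mult[of x "inv x"] inv_nonzero[OF assms] assms by simp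
  then show ?thesis by (simp add: eq_neg_iff_add_eq_0 add.commute)
qed

lemma v_pow [simp]: "\<lbrakk> x \<in> carrier R; x \<noteq> \<zero> \<rbrakk> \<Longrightarrow> v (x [^] (n::nat)) = nmult n (v x)"
  by (induction n) auto

lemma above_add: "\<lbrakk> x \<in> carrier R; y \<in> carrier R; above g x; above g y \<rbrakk> \<Longrightarrow> above g (x \<oplus> y)"
  using v_add_ge[of x y] less_le_trans[of g "min (v x) (v y)" "v (x \<oplus> y)"] unfolding above_def
  by (cases "x = \<zero>"; cases "y = \<zero>") auto

lemma above_minus [simp]: "x \<in> carrier R \<Longrightarrow> above g (\<ominus> x) \<longleftrightarrow> above g x"
  by (auto simp: above_def)

lemma above_diff: "\<lbrakk> x \<in> carrier R; y \<in> carrier R; above g x; above g y \<rbrakk> \<Longrightarrow> above g (x \<ominus> y)"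
  unfolding minus_eq by (rule above_add) auto

lemma v_add_eq:
  assumes "x \<in> carrier R" "y \<in> carrier R" "x \<noteq> \<zero>" "above (v x) y"
  shows "x \<oplus> y \<noteq> \<zero>" "v (x \<oplus> y) = v x"
proof -
  show nz: "x \<oplus> y \<noteq> \<zero>"
  proof
    assume "x \<oplus> y = \<zero>"
    then have "y = \<ominus> x" using assms by (metis a_comm minus_equality)
    then show False using assms by (auto simp: above_def)
  qed
  show "v (x \<oplus> y) = v x"
  proof (cases "y = \<zero>")
    case False
    then have y: "v x < v y" using assms by (simp add: above_def)
    have "x = (x \<oplus> y) \<oplus> (\<ominus> y)" using assms by (simp add: a_assoc r_neg)
    then have "min (v (x \<oplus> y)) (v y) \<le> v x"
      using v_add_ge[of "x \<oplus> y" "\<ominus> y"] assms nz False by auto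
    moreover have "v x \<le> v (x \<oplus> y)"
      using v_add_ge[of x y] assms nz False y by (auto simp: min_def split: if_splits)
    ultimately show ?thesis using y by (auto simp: min_def split: if_splits)
  qed (use assms in simp)
qed

lemma v_eq_of_diff:
  assumes "x \<in> carrier R" "y \<in> carrier R" "x \<noteq> \<zero>" "above (v x) (y \<ominus> x)"
  shows "y \<noteq> \<zero>" "v y = v x"
proof -
  have "y = x \<oplus> (y \<ominus> x)" using assms
    by (simp add: minus_eq a_comm[of y "\<ominus> x"] a_assoc[symmetric] r_neg)
  then show "y \<noteq> \<zero>" "v y = v x"
    using v_add_eq[of x "y \<ominus> x"] assms by auto
qed

lemma above_mult:
  assumes "x \<in> carrier R" "y \<in> carrier R" "y \<noteq> \<zero>"
  shows "above (g + v y) (x \<otimes> y) \<longleftrightarrow> above g x"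
  using assms by (cases "x = \<zero>") (auto simp: above_def integral_iff)

lemma mem_\<O>: "x \<in> \<O> \<longleftrightarrow> x \<in> carrier R \<and> (x = \<zero> \<or> 0 \<le> v x)"
  by (simp add: valuation_ring_def)

lemma \<O>_subring: "subring \<O> R"
proof (rule subringI)
  fix x y assume xy: "x \<in> \<O>" "y \<in> \<O>"
  show "x \<otimes> y \<in> \<O>"
    using xy unfolding mem_\<O> by (cases "x = \<zero> \<or> y = \<zero>") auto
  show "x \<oplus> y \<in> \<O>"
    using xy v_add_ge[of x y] unfolding mem_\<O>
    by (cases "x = \<zero> \<or> y = \<zero> \<or> x \<oplus> y = \<zero>") (auto simp: min_def split: if_splits)
qed (auto simp: mem_\<O>)

lemma mem_valuation_ideal: "x \<in> valuation_ideal R v (carrier R) \<longleftrightarrow> x \<in> carrier R \<and> above 0 x"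
  by (auto simp: valuation_ideal_def above_def)

lemma valuation_ideal_ideal: "ideal (valuation_ideal R v (carrier R)) (R\<lparr>carrier := \<O>\<rparr>)"
proof -
  interpret O: ring "R\<lparr>carrier := \<O>\<rparr>" using subring_is_ring[OF \<O>_subring] .
  let ?m = "valuation_ideal R v (carrier R)"
  have sub: "?m \<subseteq> \<O>" by (auto simp: mem_valuation_ideal above_def mem_\<O>)
  show ?thesis
  proof (rule idealI[OF O.ring_axioms])
    have "subgroup ?m (add_monoid R)"
    proof (rule add.subgroupI)
      have "\<zero> \<in> ?m" by (simp add: mem_valuation_ideal above_def)
      then show "?m \<noteq> {}" by blast
    qed (auto simp: mem_valuation_ideal above_add)
    then show "subgroup ?m (add_monoid (R\<lparr>carrier := \<O>\<rparr>))"
      using add.subgroup_incl[OF _ subring.axioms(1)[OF \<O>_subring] sub] by simp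
    fix a x assume ax: "a \<in> ?m" "x \<in> carrier (R\<lparr>carrier := \<O>\<rparr>)"
    then have "x \<otimes> a \<in> ?m"
      unfolding mem_valuation_ideal by (cases "x = \<zero> \<or> a = \<zero>") (auto simp: mem_\<O> above_def add_nonneg_pos)
    then show "x \<otimes>\<^bsub>R\<lparr>carrier := \<O>\<rparr>\<^esub> a \<in> ?m" "a \<otimes>\<^bsub>R\<lparr>carrier := \<O>\<rparr>\<^esub> x \<in> ?m"
      using ax by (auto simp: m_comm mem_\<O> mem_valuation_ideal)
  qed
qed

lemma valuation_ideal_subgroup: "abelian_subgroup (valuation_ideal R v (carrier R)) R"
proof (rule abelian_subgroupI3)
  have "\<zero> \<in> valuation_ideal R v (carrier R)" by (simp add: mem_valuation_ideal above_def)
  then have "valuation_ideal R v (carrier R) \<noteq> {}" by blast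
  then have "subgroup (valuation_ideal R v (carrier R)) (add_monoid R)"
    by (intro add.subgroupI) (auto simp: mem_valuation_ideal above_add)
  then show "additive_subgroup (valuation_ideal R v (carrier R)) R"
    by (rule additive_subgroup.intro)
qed (rule abelian_group_axioms)

lemma res_eq_iff:
  assumes "x \<in> carrier R" "y \<in> carrier R"
  shows "res x = res y \<longleftrightarrow> above 0 (x \<ominus> y)"
proof -
  interpret m: abelian_subgroup "valuation_ideal R v (carrier R)" R by (rule valuation_ideal_subgroup)
  have "above 0 (x \<ominus> y) \<longleftrightarrow> x \<in> res y"
    unfolding residue_def using m.a_rcos_module[OF assms(2,1)] assms by (simp add: mem_valuation_ideal minus_eq)
  also have "\<dots> \<longleftrightarrow> res x = res y"
    using a_repr_independence[OF _ assms(2) m.a_subgroup, of x] m.a_rcos_self[OF assms(1)]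
    unfolding residue_def by blast
  finally show ?thesis ..
qed

lemma res_ring_hom_ring: "ring_hom_ring (R\<lparr>carrier := \<O>\<rparr>) \<kappa> res"
proof -
  have "((+>\<^bsub>R\<lparr>carrier := \<O>\<rparr>\<^esub>) (valuation_ideal R v (carrier R))) = res"
    by (intro ext) (simp add: residue_def a_r_coset_def r_coset_def)
  then show ?thesis
    using ideal.rcos_ring_hom_ring[OF valuation_ideal_ideal] unfolding residue_field_def by simp
qed

lemma \<kappa>_cring: "cring \<kappa>"
  unfolding residue_field_def
  using ideal.quotient_is_cring[OF valuation_ideal_ideal] subring_is_domain[OF \<O>_subring]
  by (simp add: domain_def)

lemma carrier_\<kappa>: "carrier \<kappa> = res ` \<O>"
  by (auto simp: residue_field_def FactRing_def A_RCOSETS_def' residue_def a_r_coset_def r_coset_def)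

lemma \<O>_carrier: "x \<in> \<O> \<Longrightarrow> x \<in> carrier R"
  by (simp add: mem_\<O>)

lemma res_closed [simp]: "x \<in> \<O> \<Longrightarrow> res x \<in> carrier \<kappa>"
  by (simp add: carrier_\<kappa>)

lemma res_mult: "x \<in> \<O> \<Longrightarrow> y \<in> \<O> \<Longrightarrow> res (x \<otimes> y) = res x \<otimes>\<^bsub>\<kappa>\<^esub> res y"
  using ring_hom_mult[OF ring_hom_ring.homh[OF res_ring_hom_ring], of x y] by simp

lemma res_add: "x \<in> \<O> \<Longrightarrow> y \<in> \<O> \<Longrightarrow> res (x \<oplus> y) = res x \<oplus>\<^bsub>\<kappa>\<^esub> res y"
  using ring_hom_add[OF ring_hom_ring.homh[OF res_ring_hom_ring], of x y] by simp

lemma res_one: "res \<one> = \<one>\<^bsub>\<kappa>\<^esub>"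
  using ring_hom_one[OF ring_hom_ring.homh[OF res_ring_hom_ring]] by simp

lemma res_zero: "res \<zero> = \<zero>\<^bsub>\<kappa>\<^esub>"
  using ring_hom_zero[OF ring_hom_ring.homh[OF res_ring_hom_ring]]
    ring_hom_ring.axioms(1,2)[OF res_ring_hom_ring] by simp

lemma \<O>_closed [simp]:
  "\<zero> \<in> \<O>" "\<one> \<in> \<O>" "x \<in> \<O> \<Longrightarrow> \<ominus> x \<in> \<O>" "x \<in> \<O> \<Longrightarrow> y \<in> \<O> \<Longrightarrow> x \<otimes> y \<in> \<O>"
  "x \<in> \<O> \<Longrightarrow> y \<in> \<O> \<Longrightarrow> x \<oplus> y \<in> \<O>" "x \<in> \<O> \<Longrightarrow> y \<in> \<O> \<Longrightarrow> x \<ominus> y \<in> \<O>"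
  using subringE[OF \<O>_subring] by (simp_all add: minus_eq)

lemma \<O>_pow [simp]: "x \<in> \<O> \<Longrightarrow> x [^] (n::nat) \<in> \<O>"
  by (induction n) auto

lemma res_pow: "x \<in> \<O> \<Longrightarrow> res (x [^] (n::nat)) = res x [^]\<^bsub>\<kappa>\<^esub> n"
proof (induction n)
  case 0
  then show ?case by (simp add: res_one)
next
  case (Suc n)
  then show ?case by (simp add: res_mult)
qed

lemma res_eq_zero_iff: "x \<in> carrier R \<Longrightarrow> res x = \<zero>\<^bsub>\<kappa>\<^esub> \<longleftrightarrow> above 0 x"
  using res_eq_iff[of x \<zero>] by (simp add: res_zero minus_eq)

lemma res_minus: "x \<in> \<O> \<Longrightarrow> res (\<ominus> x) = \<ominus>\<^bsub>\<kappa>\<^esub> (res x)"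
proof -
  interpret k: cring \<kappa> by (rule \<kappa>_cring)
  assume x: "x \<in> \<O>"
  have "res (\<ominus> x) \<oplus>\<^bsub>\<kappa>\<^esub> res x = \<zero>\<^bsub>\<kappa>\<^esub>"
    using res_add[of "\<ominus> x" x] x \<O>_carrier[OF x] by (simp add: l_neg res_zero)
  then show ?thesis using k.minus_equality[of "res (\<ominus> x)" "res x"] x by simp
qed

lemma unit_of_res_nonzero:
  assumes "x \<in> \<O>" "res x \<noteq> \<zero>\<^bsub>\<kappa>\<^esub>"
  shows "x \<in> carrier R" "x \<noteq> \<zero>" "v x = 0"
  using assms res_eq_zero_iff[of x] unfolding mem_\<O> above_def by auto

lemma res_inv:
  assumes "x \<in> carrier R" "x \<noteq> \<zero>" "v x = 0"
  shows "inv x \<in> \<O>" "res x \<otimes>\<^bsub>\<kappa>\<^esub> res (inv x) = \<one>\<^bsub>\<kappa>\<^esub>"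
proof -
  show i: "inv x \<in> \<O>" using assms inv_nonzero[OF assms(1,2)] by (simp add: mem_\<O>)
  then show "res x \<otimes>\<^bsub>\<kappa>\<^esub> res (inv x) = \<one>\<^bsub>\<kappa>\<^esub>"
    using res_mult[of x "inv x"] assms inv_nonzero[OF assms(1,2)] by (simp add: mem_\<O> res_one)
qed

lemma \<kappa>_field: "field \<kappa>"
proof (rule cring.cring_fieldI2[OF \<kappa>_cring])
  show "\<zero>\<^bsub>\<kappa>\<^esub> \<noteq> \<one>\<^bsub>\<kappa>\<^esub>"
    using res_eq_zero_iff[of \<one>] by (auto simp: res_one above_def)
  fix a assume "a \<in> carrier \<kappa>" "a \<noteq> \<zero>\<^bsub>\<kappa>\<^esub>"
  then obtain x where x: "x \<in> \<O>" "a = res x" "res x \<noteq> \<zero>\<^bsub>\<kappa>\<^esub>" using carrier_\<kappa> by auto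
  from res_inv[OF unit_of_res_nonzero[OF x(1,3)]] x(2)
  show "\<exists>b\<in>carrier \<kappa>. a \<otimes>\<^bsub>\<kappa>\<^esub> b = \<one>\<^bsub>\<kappa>\<^esub>" by (intro bexI[of _ "res (inv x)"]) auto
qed

sublocale k: field \<kappa> by (rule \<kappa>_field)

lemma res_inv':
  assumes "x \<in> carrier R" "x \<noteq> \<zero>" "v x = 0"
  shows "res (inv x) = inv\<^bsub>\<kappa>\<^esub> (res x)" "res x \<noteq> \<zero>\<^bsub>\<kappa>\<^esub>"
proof -
  have x: "x \<in> \<O>" using assms by (simp add: mem_\<O>)
  note i = res_inv[OF assms]
  show "res (inv x) = inv\<^bsub>\<kappa>\<^esub> (res x)"
    using k.comm_inv_char[OF res_closed[OF x] res_closed[OF i(1)] i(2)] by simp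
  show "res x \<noteq> \<zero>\<^bsub>\<kappa>\<^esub>" using assms by (simp add: res_eq_zero_iff above_def)
qed

lemma mem_valuation_ring: "x \<in> valuation_ring R v F \<longleftrightarrow> x \<in> F \<and> (x = \<zero> \<or> 0 \<le> v x)"
  by (simp add: valuation_ring_def)

lemma resf_mem: "a \<in> resf F \<longleftrightarrow> (\<exists>x. x \<in> F \<and> (x = \<zero> \<or> 0 \<le> v x) \<and> a = res x)"
  by (auto simp: residue_subfield_def mem_valuation_ring)

lemma resf_mono: "F \<subseteq> E \<Longrightarrow> resf F \<subseteq> resf E"
  by (auto simp: residue_subfield_def mem_valuation_ring)

lemma resf_memI: "x \<in> F \<Longrightarrow> x \<in> \<O> \<Longrightarrow> res x \<in> resf F"
  unfolding resf_mem mem_\<O> by blast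

lemma resf_memE:
  assumes "a \<in> resf F" "F \<subseteq> carrier R"
  obtains x where "x \<in> F" "x \<in> \<O>" "a = res x"
  using assms unfolding resf_mem mem_\<O> by blast

lemma resf_carrier: "resf (carrier R) = carrier \<kappa>"
  by (simp add: residue_subfield_def carrier_\<kappa>)

lemma resf_subfield:
  assumes "subfield F R"
  shows "subfield (resf F) \<kappa>"
proof (rule k.subfieldI'[OF k.subringI])
  note F = subfield_closed[OF assms]
  note E = resf_memE[OF _ F(1)]
  show "resf F \<subseteq> carrier \<kappa>" using resf_mono[OF F(1)] by (simp add: resf_carrier)
  show "\<one>\<^bsub>\<kappa>\<^esub> \<in> resf F" using resf_memI[OF F(3)] by (simp add: res_one)
  fix a assume a: "a \<in> resf F"
  then obtain x where x: "x \<in> F" "x \<in> \<O>" "a = res x" by (rule E)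
  show "\<ominus>\<^bsub>\<kappa>\<^esub> a \<in> resf F" using resf_memI[OF F(4)[OF x(1)]] x by (simp add: res_minus)
  fix b assume b: "b \<in> resf F"
  then obtain y where y: "y \<in> F" "y \<in> \<O>" "b = res y" by (rule E)
  show "a \<otimes>\<^bsub>\<kappa>\<^esub> b \<in> resf F" using resf_memI[OF F(6)[OF x(1) y(1)]] x y by (simp add: res_mult)
  show "a \<oplus>\<^bsub>\<kappa>\<^esub> b \<in> resf F" using resf_memI[OF F(5)[OF x(1) y(1)]] x y by (simp add: res_add)
next
  note F = subfield_closed[OF assms]
  fix a assume a: "a \<in> resf F - {\<zero>\<^bsub>\<kappa>\<^esub>}"
  then obtain x where x: "x \<in> F" "x \<in> \<O>" "a = res x" by (auto elim: resf_memE[OF _ F(1)])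
  have "res x \<noteq> \<zero>\<^bsub>\<kappa>\<^esub>" using a x(3) by simp
  note u = unit_of_res_nonzero[OF x(2) this]
  show "inv\<^bsub>\<kappa>\<^esub> a \<in> resf F"
    using resf_memI[OF F(7)[OF x(1) u(2)] res_inv(1)[OF u]]
    by (simp add: x(3) res_inv'(1)[OF u])
qed

lemma vals_is_subgrp:
  assumes "subfield F R"
  shows "is_subgrp (vals F)"
  unfolding is_subgrp_def
proof (intro conjI ballI)
  note F = subfield_closed[OF assms]
  show "0 \<in> vals F" using F(3) by (intro image_eqI[of _ _ \<one>]) auto
  fix g h assume "g \<in> vals F" "h \<in> vals F"
  then obtain x y where xy: "x \<in> F" "x \<noteq> \<zero>" "g = v x" "y \<in> F" "y \<noteq> \<zero>" "h = v y" by blast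
  have c: "x \<in> carrier R" "y \<in> carrier R" using xy F(1) by auto
  have "v (x \<otimes> inv y) = g - h" using c xy inv_nonzero[OF c(2) xy(5)] by simp
  moreover have "x \<otimes> inv y \<in> F - {\<zero>}"
    using F(6)[OF xy(1) F(7)[OF xy(4,5)]] c xy inv_nonzero[OF c(2) xy(5)] by (simp add: integral_iff)
  ultimately show "g - h \<in> vals F" by (metis imageI)
qed

lemma ramification_index_eq: "ramification_index R v F E = gindex (vals F) (vals E)"
proof -
  have "rcosets\<^bsub>value_group R v E\<^esub> (carrier (value_group R v F)) = gcoset (vals F) ` vals E"
    by (auto simp: RCOSETS_def r_coset_def value_group_def gcoset_def)
  then show ?thesis by (simp add: ramification_index_def gindex_def)
qed

lemma value_group_eq_iff: "value_group R v E = value_group R v F \<longleftrightarrow> vals E = vals F"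
  by (simp add: value_group_def)

lemma vals_mono: "F \<subseteq> E \<Longrightarrow> vals F \<subseteq> vals E" by blast


section \<open>The fundamental inequality\<close>

text \<open>
  A residually independent family spans a space on which the valuation takes values in the base
  field only. The spaces are built together with the residue spaces, one dimension at a time.
\<close>

lemma residue_space_lift:
  assumes "subfield F R" "subfield E R" "F \<subseteq> E" "k.dimension n (resf F) B" "B \<subseteq> resf E"
  shows "\<exists>W. dimension n F W \<and> W \<subseteq> E \<and> vals W \<subseteq> vals F \<and> res ` (W \<inter> \<O>) \<subseteq> B"
  using assms(4,5)
proof (induction n "resf F" B rule: k.dimension.induct)
  case zero_dim
  show ?case
    using subfield_closed(2)[OF assms(2)] by (intro exI[of _ "{\<zero>}"]) (auto simp: res_zero)
next
  case (Suc_dim b B n)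
  note F = subfield_closed[OF assms(1)] and E = subfield_closed[OF assms(2)]
  note kF = resf_subfield[OF assms(1)]
  note Bs = k.space_subgroup_props[OF kF Suc_dim(3)]
  have sub: "B \<subseteq> k.line_extension (resf F) b B"
  proof
    fix a assume "a \<in> B"
    moreover have "\<zero>\<^bsub>\<kappa>\<^esub> \<in> resf F" using resf_memI[OF F(2)] by (simp add: res_zero)
    ultimately show "a \<in> k.line_extension (resf F) b B"
      using Bs(1) Suc_dim(1) unfolding k.line_extension_mem_iff
      by (intro bexI[of _ "\<zero>\<^bsub>\<kappa>\<^esub>"] bexI[of _ a]) auto
  qed
  then obtain W where W: "dimension n F W" "W \<subseteq> E" "vals W \<subseteq> vals F" "res ` (W \<inter> \<O>) \<subseteq> B"
    using Suc_dim by blast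
  note Ws = space_subgroup_props[OF assms(1) W(1)]
  have "b \<in> k.line_extension (resf F) b B"
  proof -
    have "\<one>\<^bsub>\<kappa>\<^esub> \<in> resf F" using resf_memI[OF F(3)] by (simp add: res_one)
    then show ?thesis
      using Bs(1,2) Suc_dim(1) unfolding k.line_extension_mem_iff
      by (intro bexI[of _ "\<one>\<^bsub>\<kappa>\<^esub>"] bexI[of _ "\<zero>\<^bsub>\<kappa>\<^esub>"]) auto
  qed
  then have "b \<in> resf E" using Suc_dim.prems by blast
  then obtain z where z: "z \<in> E" "z \<in> \<O>" "b = res z" using E(1) by (rule resf_memE)
  have zc: "z \<in> carrier R" using z \<O>_carrier by blast
  \<comment> \<open>the new direction does not cancel against the old space: both values and residues survive\<close>
  have key: "w \<oplus> z \<noteq> \<zero> \<and> v (w \<oplus> z) \<in> vals F \<and> (w \<oplus> z \<in> \<O> \<longrightarrow> w \<in> \<O>) \<and> \<not> above 0 (w \<oplus> z)" if w: "w \<in> W" for w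
  proof -
    have wc: "w \<in> carrier R" using w Ws(1) by blast
    show ?thesis
    proof (cases "w \<in> \<O>")
      case True
      have "res (w \<oplus> z) \<noteq> \<zero>\<^bsub>\<kappa>\<^esub>"
      proof
        assume "res (w \<oplus> z) = \<zero>\<^bsub>\<kappa>\<^esub>"
        then have "\<ominus>\<^bsub>\<kappa>\<^esub> res w = b"
          using z True k.minus_equality[of b "res w"] res_add[OF True z(2)] k.a_comm[of b "res w"] by simp
        moreover have "res w \<in> B" using W(4) w True by blast
        ultimately show False using Suc_dim(2) Bs(4) by blast
      qed
      moreover have m: "w \<oplus> z \<in> \<O>" using True z by simp
      ultimately have u: "w \<oplus> z \<in> carrier R" "w \<oplus> z \<noteq> \<zero>" "v (w \<oplus> z) = 0"
        using unit_of_res_nonzero by blast+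
      have "0 \<in> vals F" using is_subgrpD(1)[OF vals_is_subgrp[OF assms(1)]] .
      then show ?thesis using u True by (simp add: above_def)
    next
      case False
      then have w0: "w \<noteq> \<zero>" "v w < 0" using wc by (auto simp: mem_\<O>)
      then have "above (v w) z" using z by (auto simp: above_def mem_\<O>)
      from v_add_eq[OF wc zc w0(1) this] show ?thesis
        using w0 w W(3) False by (auto simp: above_def mem_\<O> wc zc)
    qed
  qed
  define W' where "W' = line_extension F z W"
  have "z \<notin> W"
  proof
    assume "z \<in> W"
    then have "res z \<in> B" using W(4) z by blast
    then show False using Suc_dim(2) z by simp
  qed
  then have "dimension (Suc n) F W'" unfolding W'_def using zc W(1) by (intro dimension.Suc_dim)
  moreover have "W' \<subseteq> E"
    unfolding W'_def using E z W(2) assms(3) by (auto simp: line_extension_mem_iff subset_iff)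
  moreover have main: "vals W' \<subseteq> vals F \<and> res ` (W' \<inter> \<O>) \<subseteq> k.line_extension (resf F) b B"
  proof -
    have "(u \<noteq> \<zero> \<longrightarrow> v u \<in> vals F) \<and> (u \<in> \<O> \<longrightarrow> res u \<in> k.line_extension (resf F) b B)" if "u \<in> W'" for u
    proof -
      from that obtain c w where cw: "c \<in> F" "w \<in> W" "u = c \<otimes> z \<oplus> w"
        unfolding W'_def line_extension_mem_iff by blast
      have cc: "c \<in> carrier R" and wc: "w \<in> carrier R" using cw F(1) Ws(1) by auto
      show ?thesis
      proof (cases "c = \<zero>")
        case True
        then have "u = w" using cw zc wc by simp
        then show ?thesis using W(3,4) cw(2) sub by blast
      next
        case False
        define w' where "w' = inv c \<otimes> w"
        have ic: "inv c \<in> carrier R" "inv c \<noteq> \<zero>" "c \<otimes> inv c = \<one>" using inv_nonzero[OF cc False] by auto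
        have w': "w' \<in> W" unfolding w'_def by (rule Ws(5)[OF F(7)[OF cw(1) False] cw(2)])
        have wc': "w' \<in> carrier R" using w' Ws(1) by blast
        have cw': "c \<otimes> w' = w" unfolding w'_def using ic cc wc by (simp add: m_assoc[symmetric])
        have u: "u = c \<otimes> (w' \<oplus> z)" unfolding cw(3) using cc wc' zc cw' wc by (simp add: r_distr a_comm)
        note k = key[OF w']
        have s: "w' \<oplus> z \<in> carrier R" "w' \<oplus> z \<noteq> \<zero>" using wc' zc k by auto
        have vu: "v u = v c + v (w' \<oplus> z)" unfolding u using cc False s by simp
        have "v u \<in> vals F"
          unfolding vu using k cw(1) False is_subgrpD(4)[OF vals_is_subgrp[OF assms(1)]] by blast
        moreover have "res u \<in> k.line_extension (resf F) b B" if uO: "u \<in> \<O>"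
        proof -
          have "v (w' \<oplus> z) \<le> 0" using k s by (auto simp: above_def)
          moreover have "u \<noteq> \<zero>" unfolding u using cc s False by (simp add: integral_iff)
          then have "0 \<le> v u" using uO by (simp add: mem_\<O>)
          ultimately have "0 \<le> v c" unfolding vu
            using add_mono[of "v c + v (w' \<oplus> z)" 0 0 0] by (metis add_increasing2 add_le_same_cancel1 order_trans)
          then have cO: "c \<in> \<O>" using cc by (simp add: mem_\<O>)
          have "w = u \<ominus> c \<otimes> z" unfolding cw(3) using cc zc wc by (simp add: minus_eq a_ac r_neg2 l_neg r_neg)
          then have wO: "w \<in> \<O>" using uO cO z(2) by simp
          have "res u = res c \<otimes>\<^bsub>\<kappa>\<^esub> b \<oplus>\<^bsub>\<kappa>\<^esub> res w"
            unfolding cw(3) using cO z wO by (simp add: res_add res_mult)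
          moreover have "res c \<in> resf F" "res w \<in> B" using resf_memI[OF cw(1) cO] W(4) cw(2) wO by auto
          ultimately show ?thesis unfolding k.line_extension_mem_iff by blast
        qed
        ultimately show ?thesis by blast
      qed
    qed
    then show ?thesis by blast
  qed
  ultimately show ?case by blast
qed

text \<open>
  Multiples of such a space by elements of pairwise incongruent values are independent, since the
  values of their elements lie in different cosets and no cancellation is possible.
\<close>

lemma incongruent_multiples_space:
  assumes "subfield F R" "subfield E R" "F \<subseteq> E" "dimension f F W" "W \<subseteq> E" "vals W \<subseteq> vals F"
    and "finite J" "J \<subseteq> vals E" "\<And>g h. g \<in> J \<Longrightarrow> h \<in> J \<Longrightarrow> g - h \<in> vals F \<Longrightarrow> g = h"
  shows "\<exists>U. dimension (card J * f) F U \<and> U \<subseteq> E \<and> (\<forall>x\<in>U. x \<noteq> \<zero> \<longrightarrow> (\<exists>j\<in>J. v x - j \<in> vals F))"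
  using assms(7-9)
proof (induction J rule: finite_induct)
  case empty
  show ?case using subfield_closed(2)[OF assms(2)] by (intro exI[of _ "{\<zero>}"]) auto
next
  case (insert j J)
  note F = subfield_closed[OF assms(1)] and E = subfield_closed[OF assms(2)]
  note A = vals_is_subgrp[OF assms(1)]
  obtain U where U: "dimension (card J * f) F U" "U \<subseteq> E" "\<And>x. x \<in> U \<Longrightarrow> x \<noteq> \<zero> \<Longrightarrow> \<exists>j\<in>J. v x - j \<in> vals F"
  proof -
    have "\<exists>U. dimension (card J * f) F U \<and> U \<subseteq> E \<and> (\<forall>x\<in>U. x \<noteq> \<zero> \<longrightarrow> (\<exists>j\<in>J. v x - j \<in> vals F))"
      by (rule insert.IH) (use insert.prems in blast)+
    then show ?thesis using that by blast
  qed
  obtain y where y: "y \<in> E" "y \<noteq> \<zero>" "v y = j" using insert.prems(1) by auto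
  have yc: "y \<in> carrier R" using y E(1) by blast
  let ?Y = "(\<otimes>) y ` W"
  note Y = dimension_scale[OF assms(1) yc y(2) assms(4)]
  have Yv: "v x - j \<in> vals F" if "x \<in> ?Y" "x \<noteq> \<zero>" for x
  proof -
    from that(1) obtain w where w: "w \<in> W" "x = y \<otimes> w" by blast
    have wc: "w \<in> carrier R" using w assms(5) E(1) by blast
    have "w \<noteq> \<zero>" using that(2) w yc by auto
    then have "v x - j = v w" using w wc yc y by simp
    then show ?thesis using w(1) \<open>w \<noteq> \<zero>\<close> assms(6) by auto
  qed
  have diff: "v x \<noteq> v u" if "x \<in> ?Y" "x \<noteq> \<zero>" "u \<in> U" "u \<noteq> \<zero>" for x u
  proof
    assume e: "v x = v u"
    obtain j' where j': "j' \<in> J" "v u - j' \<in> vals F" using U(3) \<open>u \<in> U\<close> \<open>u \<noteq> \<zero>\<close> by blast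
    have "v u - j \<in> vals F" using Yv[OF that(1,2)] unfolding e .
    from is_subgrpD(2)[OF A j'(2) this] have "j - j' \<in> vals F" by simp
    then have "j = j'" using insert.prems(2)[of j j'] j'(1) by simp
    then show False using j'(1) insert.hyps(2) by simp
  qed
  have YE: "?Y \<subseteq> E" using E(6)[OF y(1)] assms(5) by blast
  have "?Y \<inter> U = {\<zero>}"
    using diff space_subgroup_props(2)[OF assms(1) Y] space_subgroup_props(2)[OF assms(1) U(1)] by blast
  then have "dimension (f + card J * f) F (?Y <+>\<^bsub>R\<^esub> U)"
    using dimension_direct_sum_space[OF assms(1) Y U(1)] by simp
  moreover have "?Y <+>\<^bsub>R\<^esub> U \<subseteq> E"
    using YE U(2) E(5) by (auto simp: set_add_def' subset_iff)
  moreover have "\<exists>j'\<in>insert j J. v x - j' \<in> vals F" if "x \<in> ?Y <+>\<^bsub>R\<^esub> U" "x \<noteq> \<zero>" for x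
  proof -
    from that(1) obtain a u where au: "a \<in> ?Y" "u \<in> U" "x = a \<oplus> u" by (auto simp: set_add_def')
    have c: "a \<in> carrier R" "u \<in> carrier R" using au YE U(2) E(1) by blast+
    have "(a \<noteq> \<zero> \<and> v x = v a) \<or> (u \<noteq> \<zero> \<and> v x = v u)"
    proof (cases "a = \<zero> \<or> u = \<zero>")
      case True
      then show ?thesis using that(2) au(3) c by auto
    next
      case False
      then have nz: "a \<noteq> \<zero>" "u \<noteq> \<zero>" by auto
      from diff[OF au(1) nz(1) au(2) nz(2)] have "v a < v u \<or> v u < v a" by (meson linorder_neqE)
      then show ?thesis
      proof
        assume "v a < v u"
        then show ?thesis using v_add_eq(2)[OF c(1,2) nz(1)] au(3) nz by (simp add: above_def)
      next
        assume "v u < v a"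
        then show ?thesis using v_add_eq(2)[OF c(2,1) nz(2)] au(3) nz c by (simp add: above_def a_comm)
      qed
    qed
    then show ?thesis using Yv[OF au(1)] U(3)[OF au(2)] by auto
  qed
  moreover have "card (insert j J) * f = f + card J * f" using insert.hyps by simp
  ultimately show ?case by metis
qed

text \<open>
  Multiplying a space that lifts the residue extension by representatives of the value cosets gives
  independent families of size \<open>e f\<close>. Finiteness of \<open>f\<close> and of \<open>e\<close> follows as well, since otherwise
  there would be arbitrarily large independent families of this kind.
\<close>

theorem fundamental_inequality:
  assumes "subfield F R" "subfield E R" "F \<subseteq> E" "finite_dimension F E"
  shows "k.finite_dimension (resf F) (resf E)"
    and "ramification_index R v F E > 0" and "inertia_degree R v F E > 0"
    and "ramification_index R v F E * inertia_degree R v F E \<le> dim F E"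
proof -
  note kF = resf_subfield[OF assms(1)] and kE = resf_subfield[OF assms(2)]
  have N: "dimension (dim F E) F E" using finite_dimensionE[OF assms(1,4)] by (simp add: over_def)
  have bd: "n \<le> dim F E" if "k.dimension n (resf F) B" "B \<subseteq> resf E" for n B
    using residue_space_lift[OF assms(1-3) that] dimension_le[OF assms(1) _ N] by blast
  define P where "P n \<longleftrightarrow> (\<exists>B. k.dimension n (resf F) B \<and> B \<subseteq> resf E)" for n
  have P_le: "n \<le> dim F E" if "P n" for n using bd that unfolding P_def by blast
  have "P 0"
    unfolding P_def using k.zero_dim subringE(2)[OF subfieldE(1)[OF kE]] by (intro exI[of _ "{\<zero>\<^bsub>\<kappa>\<^esub>}"]) auto
  define n where "n = Greatest P"
  have "P n" unfolding n_def using GreatestI_nat[of P 0 "dim F E"] \<open>P 0\<close> P_le by blast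
  then obtain B where B: "k.dimension n (resf F) B" "B \<subseteq> resf E" unfolding P_def by blast
  have "B = resf E"
  proof (rule ccontr)
    assume "B \<noteq> resf E"
    then obtain b where b: "b \<in> resf E" "b \<notin> B" using B(2) by blast
    note cl = subringE[OF subfieldE(1)[OF kE]]
    have "k.dimension (Suc n) (resf F) (k.line_extension (resf F) b B)"
      using k.Suc_dim[OF _ b(2) B(1)] b(1) cl(1) by blast
    moreover have "k.line_extension (resf F) b B \<subseteq> resf E"
      using B(2) b(1) resf_mono[OF assms(3)] cl(6,7) by (auto simp: k.line_extension_mem_iff subset_iff)
    ultimately have "P (Suc n)" unfolding P_def by blast
    then have "Suc n \<le> n"
      unfolding n_def using Greatest_le_nat[of P "Suc (Greatest P)" "dim F E"] P_le by blast
    then show False by simp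
  qed
  then have dn: "k.dimension n (resf F) (resf E)" using B(1) by simp
  then show "k.finite_dimension (resf F) (resf E)" by (rule k.finite_dimensionI)
  have f: "inertia_degree R v F E = n"
    using k.dimI[OF kF dn] by (simp add: inertia_degree_def over_def)
  have "n \<noteq> 0"
    using dn k.dimension_zero[OF kF] subringE(3)[OF subfieldE(1)[OF kE]] k.one_not_zero by (metis singletonD)
  then show "inertia_degree R v F E > 0" using f by simp
  obtain W where W: "dimension n F W" "W \<subseteq> E" "vals W \<subseteq> vals F"
    using residue_space_lift[OF assms(1-3) dn] by blast
  note A = vals_is_subgrp[OF assms(1)]
  define s where "s Q = (SOME c. c \<in> vals E \<and> gcoset (vals F) c = Q)" for Q
  have s: "s Q \<in> vals E" "gcoset (vals F) (s Q) = Q" if "Q \<in> gcoset (vals F) ` vals E" for Q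
    using someI_ex[of "\<lambda>c. c \<in> vals E \<and> gcoset (vals F) c = Q"] that unfolding s_def by blast+
  have le: "card C * n \<le> dim F E" if C: "C \<subseteq> gcoset (vals F) ` vals E" "finite C" for C
  proof -
    have inj: "inj_on s C" 
      by (rule inj_on_inverseI[where g = "gcoset (vals F)"]) (rule s(2)[OF subsetD[OF C(1)]])
    have "\<exists>U. dimension (card (s ` C) * n) F U \<and> U \<subseteq> E \<and> (\<forall>x\<in>U. x \<noteq> \<zero> \<longrightarrow> (\<exists>j\<in>s ` C. v x - j \<in> vals F))"
    proof (rule incongruent_multiples_space[OF assms(1-3) W])
      show "s ` C \<subseteq> vals E" using s(1)[OF subsetD[OF C(1)]] by (rule image_subsetI)
      fix g h assume "g \<in> s ` C" "h \<in> s ` C" and gh: "g - h \<in> vals F"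
      then obtain P Q where PQ: "P \<in> C" "g = s P" "Q \<in> C" "h = s Q" by blast
      then have "P = Q"
        using s(2)[OF subsetD[OF C(1) PQ(1)]] s(2)[OF subsetD[OF C(1) PQ(3)]] gcoset_eq_iff[OF A, of g h] gh
        by simp
      then show "g = h" using PQ by simp
    qed (use C in simp)
    then show ?thesis using dimension_le[OF assms(1) _ N] card_image[OF inj] by auto
  qed
  have fin: "finite (gcoset (vals F) ` vals E)"
  proof (rule ccontr)
    assume "infinite (gcoset (vals F) ` vals E)"
    then obtain C where C: "C \<subseteq> gcoset (vals F) ` vals E" "finite C" "card C = Suc (dim F E)"
      using infinite_arbitrarily_large by blast
    from le[OF C(1,2)] \<open>n \<noteq> 0\<close> have "Suc (dim F E) \<le> dim F E"
      unfolding C(3) using mult_le_mono2[of 1 n "Suc (dim F E)"] by simp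
    then show False by simp
  qed
  have "vals E \<noteq> {}" using is_subgrpD(1)[OF vals_is_subgrp[OF assms(2)]] by blast
  then show "ramification_index R v F E > 0"
    using fin by (simp add: ramification_index_eq gindex_def card_gt_0_iff)
  show "ramification_index R v F E * inertia_degree R v F E \<le> dim F E"
    using le[OF order_refl fin] by (simp add: ramification_index_eq gindex_def f)
qed

text \<open>
  As \<open>e f \<le> n\<close> holds at both stages and all three numbers are multiplicative, equality for the whole
  extension forces equality at each stage.
\<close>

lemma degree_tower:
  assumes "subfield F R" "subfield M R" "subfield E R" "F \<subseteq> M" "M \<subseteq> E" "finite_dimension F E"
  shows "ramification_index R v F E = ramification_index R v F M * ramification_index R v M E"
    and "inertia_degree R v F E = inertia_degree R v F M * inertia_degree R v M E"
    and "defectless R v F E \<longleftrightarrow> defectless R v F M \<and> defectless R v M E"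
proof -
  note fd = finite_dimension_intermediate[OF assms]
  note FM = fundamental_inequality[OF assms(1,2,4) fd(1)]
  note ME = fundamental_inequality[OF assms(2,3,5) fd(2)]
  show e: "ramification_index R v F E = ramification_index R v F M * ramification_index R v M E"
    unfolding ramification_index_eq
    using gindex_tower[OF vals_is_subgrp[OF assms(1)] vals_is_subgrp[OF assms(2)] vals_is_subgrp[OF assms(3)]
      vals_mono[OF assms(4)] vals_mono[OF assms(5)]] .
  show f: "inertia_degree R v F E = inertia_degree R v F M * inertia_degree R v M E"
    using k.telescopic_base_dim(2)[OF resf_subfield[OF assms(1)] resf_subfield[OF assms(2)] FM(1) ME(1)]
    by (simp add: inertia_degree_def over_def)
  define a b where "a = ramification_index R v F M * inertia_degree R v F M"
    and "b = ramification_index R v M E * inertia_degree R v M E"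
  have ab: "a \<le> dim F M" "b \<le> dim M E" "0 < a" "0 < b"
    using FM ME by (simp_all add: a_def b_def)
  have "dim F M * dim M E = a * b \<longleftrightarrow> dim F M = a \<and> dim M E = b"
  proof
    assume eq: "dim F M * dim M E = a * b"
    have "\<not> a < dim F M"
      using mult_less_le_imp_less[of a "dim F M" b "dim M E"] ab eq by linarith
    moreover have "\<not> b < dim M E"
      using mult_le_less_imp_less[of a "dim F M" b "dim M E"] ab eq by linarith
    ultimately show "dim F M = a \<and> dim M E = b" using ab by linarith
  qed simp
  then have "dim F E = a * b \<longleftrightarrow> dim F M = a \<and> dim M E = b" unfolding fd(3) .
  moreover have "ramification_index R v F E * inertia_degree R v F E = a * b"
    by (simp add: e f a_def b_def)
  ultimately show "defectless R v F E \<longleftrightarrow> defectless R v F M \<and> defectless R v M E"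
    by (simp add: defectless_def a_def b_def)
qed

end


section \<open>Lifting roots from the residue field\<close>

lemma (in ring) coeff_map_rev_upt:
  assumes "i < n"
  shows "coeff (map c (rev [0..<n])) i = c i"
  using assms coeff_nth[of i "map c (rev [0..<n])"] by (simp add: rev_nth)

lemma (in ring) psum_singleton:
  assumes "d \<in> carrier R" "x \<in> carrier R"
  shows "psum n (\<lambda>i. if i = k then d else \<zero>) x = (if k < n then d \<otimes> x [^] k else \<zero>)"
  using assms by (induction n) (auto simp: less_Suc_eq)

context field
begin

text \<open>The polynomial \<open>X\<^sup>n - c\<close>.\<close>

definition radical_poly :: "nat \<Rightarrow> 'a \<Rightarrow> 'a list"
  where "radical_poly n c = map (\<lambda>i. if i = n then \<one> else if i = 0 then \<ominus> c else \<zero>) (rev [0..<Suc n])"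

lemma radical_poly_basic:
  assumes "subfield F R" "c \<in> F" "n > 0"
  shows "radical_poly n c \<in> carrier (F[X])" "lead_coeff (radical_poly n c) = \<one>"
    "length (radical_poly n c) = Suc n"
proof -
  note s = subringE[OF subfieldE(1)[OF assms(1)]]
  show l: "lead_coeff (radical_poly n c) = \<one>" by (simp add: radical_poly_def)
  show "length (radical_poly n c) = Suc n" by (simp add: radical_poly_def)
  have "set (radical_poly n c) \<subseteq> F"
    using s assms(2) by (auto simp: radical_poly_def)
  then show "radical_poly n c \<in> carrier (F[X])"
    unfolding univ_poly_carrier[symmetric] polynomial_def using l by simp
qed

lemma eval_radical_poly:
  assumes "c \<in> carrier R" "n > 0" "x \<in> carrier R"
  shows "eval (radical_poly n c) x = x [^] n \<ominus> c"
proof -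
  let ?c = "\<lambda>i. if i = n then \<one> else if i = 0 then \<ominus> c else \<zero>"
  have "eval (radical_poly n c) x = psum (Suc n) ?c x"
    unfolding radical_poly_def using assms by (intro psum_eq_eval[symmetric]) auto
  also have "psum n ?c x = psum n (\<lambda>i. if i = 0 then \<ominus> c else \<zero>) x"
    by (rule psum_cong) simp
  then have "psum (Suc n) ?c x = \<ominus> c \<oplus> x [^] n"
    using assms psum_singleton[of "\<ominus> c" x n 0] by simp
  finally show ?thesis using assms by (simp add: minus_eq a_comm)
qed

end

text \<open>
  The derivative \<open>n X\<^bsup>n - 1\<^esup>\<close> has no root but zero, so all roots of \<open>X\<^sup>n - c\<close> are simple.
\<close>

lemma (in algebraically_closed) card_radical_zeros:
  assumes "c \<in> carrier L" "c \<noteq> \<zero>" "n > 0" "[n] \<cdot> \<one> \<noteq> \<zero>"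
  shows "card (zeros (radical_poly n c)) = n"
proof -
  let ?f = "radical_poly n c"
  note f = radical_poly_basic[OF carrier_is_subfield assms(1,3)]
  have ne: "?f \<noteq> []" using f(3) by auto
  have "count (roots ?f) b \<le> 1" for b
  proof (rule ccontr)
    assume "\<not> count (roots ?f) b \<le> 1"
    then have 2: "2 \<le> alg_mult ?f b" using alg_mult_eq_count_roots[OF f(1)] by simp
    then have "is_root ?f b" using alg_mult_gt_zero_iff_is_root[OF f(1), of b] by simp
    then have b: "b \<in> carrier L" "eval ?f b = \<zero>" by (auto simp: is_root_def)
    have b0: "b \<noteq> \<zero>"
    proof
      assume "b = \<zero>"
      then have "\<zero> \<ominus> c = \<zero>" using b eval_radical_poly[OF assms(1,3), of b] assms(3) by (simp add: nat_pow_zero)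
      then show False using assms(1,2) by (simp add: minus_eq)
    qed
    have "psum n (\<lambda>i. [Suc i] \<cdot> (coeff ?f (Suc i))) b = \<zero>"
      using derivative_at_double_root[OF f(1) b(1) le_alg_mult_imp_pdivides[OF b(1) f(1) 2]]
      unfolding f(3) diff_Suc_1 .
    moreover have "psum n (\<lambda>i. [Suc i] \<cdot> (coeff ?f (Suc i))) b =
        psum n (\<lambda>i. if i = n - 1 then [n] \<cdot> \<one> else \<zero>) b"
    proof (rule psum_cong)
      fix i assume "i < n"
      then have "coeff ?f (Suc i) = (if Suc i = n then \<one> else \<zero>)"
        unfolding radical_poly_def by (subst coeff_map_rev_upt) auto
      then show "[Suc i] \<cdot> (coeff ?f (Suc i)) = (if i = n - 1 then [n] \<cdot> \<one> else \<zero>)"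
        using \<open>i < n\<close> by auto
    qed
    moreover have "\<dots> = ([n] \<cdot> \<one>) \<otimes> b [^] (n - 1)"
      using psum_singleton[of "[n] \<cdot> \<one>" b n "n - 1"] b(1) assms(3) by simp
    ultimately show False using assms(4) b(1) b0 integral_iff by simp
  qed
  then have "card (set_mset (roots ?f)) = size (roots ?f)" using card_set_mset_eq_size_iff by blast
  also have "\<dots> = n" using roots_over_carrier[OF f(1)] f(3) by (simp add: splitted_def)
  finally show ?thesis using zeros_eq_set_roots[OF f(1) ne] by simp
qed

text \<open>
  The factorisation into linear factors, stated for the values of the polynomial, to which the
  valuation applies.
\<close>

lemma (in algebraically_closed) split_product:
  assumes "p \<in> carrier (poly_ring L)" "lead_coeff p = \<one>" "p \<noteq> []"
  shows "\<exists>as. set as \<subseteq> zeros p \<and> (\<forall>x\<in>carrier L. eval p x = foldr (\<lambda>a y. (x \<ominus> a) \<otimes> y) as \<one>)"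
  using assms
proof (induction "length p" arbitrary: p rule: less_induct)
  case less
  show ?case
  proof (cases "degree p \<ge> 1")
    case False
    then have "length p = 1" using less.prems(3) by (cases p) (auto simp: not_le)
    then have "p = [\<one>]" using less.prems(2) by (cases p) auto
    then have "eval p x = \<one>" if "x \<in> carrier L" for x using eval_const[of \<one> x] that by simp
    then show ?thesis by (intro exI[of _ "[]"]) simp
  next
    case True
    interpret P: domain "poly_ring L" by (rule univ_poly_is_domain[OF carrier_is_subring])
    obtain a where a: "a \<in> carrier L" "eval p a = \<zero>" using exists_zero[OF less.prems(1) True] by blast
    define l where "l = [\<one>, \<ominus> a]"
    have l: "l \<in> carrier (poly_ring L)" "l \<noteq> []" "lead_coeff l = \<one>" "degree l = 1"
      using a by (simp_all add: l_def univ_poly_carrier[symmetric] polynomial_def)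
    have le: "eval l x = x \<ominus> a" if "x \<in> carrier L" for x
      using that a by (simp add: l_def minus_eq)
    have "l pdivides p"
      unfolding l_def using is_root_imp_pdivides[OF less.prems(1), of a] a less.prems(3) by (simp add: is_root_def)
    then obtain q where q: "q \<in> carrier (poly_ring L)" "p = l \<otimes>\<^bsub>poly_ring L\<^esub> q"
      unfolding pdivides_def factor_def by blast
    then have pq: "p = poly_mult l q" by (simp add: univ_poly_mult)
    have qn: "q \<noteq> []" using q(2) less.prems(3) P.r_null[OF l(1)] by (auto simp: univ_poly_zero)
    have pl: "polynomial (carrier L) l" "polynomial (carrier L) q" using l(1) q(1) univ_poly_carrier by blast+
    have "lead_coeff p = lead_coeff l \<otimes> lead_coeff q"
      unfolding pq using poly_mult_lead_coeff[OF carrier_is_subring pl l(2) qn] .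
    moreover have sq: "set q \<subseteq> carrier L" "set l \<subseteq> carrier L" using pl polynomial_incl by blast+
    moreover have "lead_coeff q \<in> carrier L" using sq(1) qn by (meson hd_in_set subsetD)
    ultimately have lq: "lead_coeff q = \<one>" using l(3) less.prems(2) by simp
    have "degree p = degree l + degree q"
      unfolding pq using poly_mult_degree_eq[OF carrier_is_subring pl] l(2) qn by simp
    then have "length q < length p" using l(4) qn less.prems(3) by (cases q; cases p) auto
    from less.hyps[OF this q(1) lq qn] obtain as where as: "set as \<subseteq> zeros q"
      "\<And>x. x \<in> carrier L \<Longrightarrow> eval q x = foldr (\<lambda>a y. (x \<ominus> a) \<otimes> y) as \<one>" by blast
    have ev: "eval p x = (x \<ominus> a) \<otimes> eval q x" if "x \<in> carrier L" for x
      unfolding pq using eval_poly_mult[OF sq(2,1) that] le[OF that] by simp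
    have "zeros q \<subseteq> zeros p" using ev a(1) by (auto simp: zeros_def)
    then have "set (a # as) \<subseteq> zeros p" using as(1) a by (auto simp: zeros_def)
    moreover have "eval p x = foldr (\<lambda>a y. (x \<ominus> a) \<otimes> y) (a # as) \<one>" if "x \<in> carrier L" for x
      using ev[OF that] as(2)[OF that] by simp
    ultimately show ?thesis by blast
  qed
qed

locale valued_closed_field = valued_field R v + algebraically_closed R
  for R (structure) and v :: "'a \<Rightarrow> 'g::linordered_ab_group_add"
begin

lemma eval_res:
  assumes "set p \<subseteq> \<O>" "a \<in> \<O>"
  shows "eval p a \<in> \<O>" "res (eval p a) = k.eval (map res p) (res a)"
proof -
  interpret O: ring "R\<lparr>carrier := \<O>\<rparr>" using subring_is_ring[OF \<O>_subring] .
  have e: "ring.eval (R\<lparr>carrier := \<O>\<rparr>) = eval" using eval_consistent[OF \<O>_subring] .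
  show "eval p a \<in> \<O>" using O.eval_in_carrier[of p a] assms unfolding e by simp
  show "res (eval p a) = k.eval (map res p) (res a)"
    using ring_hom_ring.eval_hom'[OF res_ring_hom_ring, of a p] assms unfolding e by simp
qed

lemma above_eval:
  assumes "set p \<subseteq> \<O>" "a \<in> carrier R" "a \<noteq> \<zero>" "v a < 0"
  shows "above (nmult (length p) (v a)) (eval p a)"
  using assms(1)
proof (induction p)
  case Nil
  then show ?case by (simp add: above_def)
next
  case (Cons c p)
  have c: "c \<in> carrier R" "c = \<zero> \<or> 0 \<le> v c" using Cons.prems by (auto simp: mem_\<O>)
  have lt: "nmult (Suc (length p)) (v a) < nmult (length p) (v a)" using assms(4) by simp
  have "above (nmult (length (c # p)) (v a)) (c \<otimes> a [^] length p)"
  proof (cases "c = \<zero>")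
    case False
    then have "nmult (length p) (v a) \<le> v (c \<otimes> a [^] length p)"
      using c assms(2,3) False by simp
    with lt have "nmult (Suc (length p)) (v a) < v (c \<otimes> a [^] length p)" by (rule less_le_trans)
    then show ?thesis by (simp add: above_def)
  qed (use assms(2) in \<open>simp add: above_def\<close>)
  moreover have "above (nmult (length (c # p)) (v a)) (eval p a)"
    using Cons less_trans[OF lt, of "v (eval p a)"] by (simp add: above_def) blast
  moreover have "eval p a \<in> carrier R"
    using Cons.prems assms(2) \<O>_carrier by (intro eval_in_carrier) auto
  ultimately show ?case using c(1) assms(2) by (simp add: above_add)
qed

text \<open>
  At an argument of negative value the leading term has smaller value than all the others together.
\<close>

lemma root_integral:
  assumes "set p \<subseteq> \<O>" "p \<noteq> []" "lead_coeff p \<noteq> \<zero>" "v (lead_coeff p) = 0" "a \<in> carrier R" "eval p a = \<zero>"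
  shows "a \<in> \<O>"
proof (rule ccontr)
  assume "a \<notin> \<O>"
  then have a: "a \<noteq> \<zero>" "v a < 0" using assms(5) by (auto simp: mem_\<O>)
  obtain c q where p: "p = c # q" using assms(2) by (cases p) auto
  have c: "c \<in> carrier R" "c \<noteq> \<zero>" "v c = 0" "set q \<subseteq> \<O>" using assms(1,3,4) \<O>_carrier by (auto simp: p)
  have x: "c \<otimes> a [^] length q \<in> carrier R" "c \<otimes> a [^] length q \<noteq> \<zero>" "v (c \<otimes> a [^] length q) = nmult (length q) (v a)"
    using c a assms(5) by (simp_all add: integral_iff)
  have "eval q a \<in> carrier R" using c(4) assms(5) \<O>_carrier by (intro eval_in_carrier) auto
  from v_add_eq(1)[OF x(1) this x(2)] above_eval[OF c(4) assms(5) a] x(3)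
  have "c \<otimes> a [^] length q \<oplus> eval q a \<noteq> \<zero>" by simp
  then show False using assms(6) by (simp add: p)
qed

text \<open>
  The value of a product of differences \<open>u - a\<close> is positive only if one factor is: hence
  approximate roots of monic integral polynomials are close to roots.
\<close>

lemma root_lift:
  assumes "set p \<subseteq> \<O>" "p \<noteq> []" "lead_coeff p = \<one>" "u \<in> \<O>" "above 0 (eval p u)"
  obtains a where "a \<in> zeros p" "a \<in> \<O>" "above 0 (u \<ominus> a)"
proof -
  have pc: "p \<in> carrier (poly_ring R)"
    unfolding univ_poly_carrier[symmetric] polynomial_def using assms(1,3) \<O>_carrier by auto
  have zO: "a \<in> \<O>" if "a \<in> zeros p" for a
    using root_integral[OF assms(1,2)] that assms(3) by (simp add: zeros_def)
  have u: "u \<in> carrier R" using assms(4) \<O>_carrier by blast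
  obtain as where as: "set as \<subseteq> zeros p" "\<And>x. x \<in> carrier R \<Longrightarrow> eval p x = foldr (\<lambda>a y. (x \<ominus> a) \<otimes> y) as \<one>"
    using split_product[OF pc assms(3,2)] by blast
  have "\<exists>a\<in>set as. above 0 (u \<ominus> a)"
  proof (rule ccontr)
    assume no: "\<not> (\<exists>a\<in>set as. above 0 (u \<ominus> a))"
    have "foldr (\<lambda>a y. (u \<ominus> a) \<otimes> y) as \<one> \<in> carrier R \<and> foldr (\<lambda>a y. (u \<ominus> a) \<otimes> y) as \<one> \<noteq> \<zero> \<and>
        v (foldr (\<lambda>a y. (u \<ominus> a) \<otimes> y) as \<one>) = 0"
      using as(1) no
    proof (induction as)
      case (Cons a as)
      have aO: "u \<ominus> a \<in> \<O>" using zO[of a] Cons.prems(1) assms(4) by simp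
      moreover have "\<not> above 0 (u \<ominus> a)" using Cons.prems(2) by simp
      ultimately have "u \<ominus> a \<in> carrier R" "u \<ominus> a \<noteq> \<zero>" "v (u \<ominus> a) = 0"
        unfolding mem_\<O> above_def by auto
      then show ?case using Cons by (simp add: integral_iff)
    qed simp
    then show False using assms(5) as(2)[OF u] by (simp add: above_def)
  qed
  then show ?thesis using that as(1) zO by blast
qed

lemma lift_poly:
  assumes "p \<in> carrier (univ_poly \<kappa> (resf F))" "p \<noteq> []" "subfield F R" "lead_coeff p = \<one>\<^bsub>\<kappa>\<^esub>"
  obtains q where "q \<in> carrier (F[X])" "set q \<subseteq> \<O>" "map res q = p" "lead_coeff q = \<one>" "q \<noteq> []" "length q = length p"
proof -
  note F = subfield_closed[OF assms(3)]
  have sp: "set p \<subseteq> resf F" using assms(1) k.polynomial_incl univ_poly_carrier by blast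
  define g where "g a = (if a = \<one>\<^bsub>\<kappa>\<^esub> then \<one> else (SOME x. x \<in> F \<and> x \<in> \<O> \<and> res x = a))" for a
  have g: "g a \<in> F \<and> g a \<in> \<O> \<and> res (g a) = a" if "a \<in> resf F" for a
  proof (cases "a = \<one>\<^bsub>\<kappa>\<^esub>")
    case True
    then show ?thesis using F(3) by (simp add: g_def res_one)
  next
    case False
    have "\<exists>x. x \<in> F \<and> x \<in> \<O> \<and> res x = a" using resf_memE[OF that F(1)] by blast
    from someI_ex[OF this] show ?thesis using False by (simp add: g_def)
  qed
  let ?q = "map g p"
  have s: "set ?q \<subseteq> F" "set ?q \<subseteq> \<O>" using g sp by auto
  have l: "lead_coeff ?q = \<one>" using assms(2,4) by (simp add: hd_map g_def)
  have "map res ?q = p" using g sp by (auto simp: map_idI subset_iff)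
  moreover have "?q \<in> carrier (F[X])"
    unfolding univ_poly_carrier[symmetric] polynomial_def using s(1) l by simp
  ultimately show ?thesis using that[of ?q] s(2) l assms(2) by simp
qed

text \<open>
  A polynomial over the residue field lifts to one with a unit as leading coefficient, whose roots are
  integral.
\<close>

lemma \<kappa>_algebraically_closed: "algebraically_closed \<kappa>"
proof (rule k.algebraically_closedI)
  fix p assume p: "p \<in> carrier (poly_ring \<kappa>)" "1 < degree p"
  have "set p \<subseteq> carrier \<kappa>" using p(1) k.polynomial_incl univ_poly_carrier by blast
  moreover have "p \<noteq> []" using p(2) by auto
  ultimately have sp: "set p \<subseteq> carrier \<kappa>" "p \<noteq> []" by auto
  have "lead_coeff p \<noteq> \<zero>\<^bsub>\<kappa>\<^esub>" using p(1) sp(2) unfolding univ_poly_carrier[symmetric] polynomial_def by simp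
  define g where "g a = (SOME x. x \<in> \<O> \<and> res x = a)" for a
  have g: "g a \<in> \<O>" "res (g a) = a" if "a \<in> carrier \<kappa>" for a
  proof -
    have "\<exists>x. x \<in> \<O> \<and> res x = a" using that carrier_\<kappa> by auto
    from someI_ex[OF this] show "g a \<in> \<O>" "res (g a) = a" by (simp_all add: g_def)
  qed
  let ?q = "map g p"
  have s: "set ?q \<subseteq> \<O>" using g sp by auto
  have hc: "hd p \<in> carrier \<kappa>" using sp by (meson hd_in_set subsetD)
  have l: "lead_coeff ?q \<in> \<O>" "res (lead_coeff ?q) \<noteq> \<zero>\<^bsub>\<kappa>\<^esub>"
    using g[OF hc] sp(2) \<open>lead_coeff p \<noteq> \<zero>\<^bsub>\<kappa>\<^esub>\<close> by (simp_all add: hd_map)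
  note lu = unit_of_res_nonzero[OF l]
  have "?q \<in> carrier (poly_ring R)"
    unfolding univ_poly_carrier[symmetric] polynomial_def using s lu(2) \<O>_carrier by auto
  moreover have "degree ?q \<ge> 1" using p(2) by simp
  ultimately obtain a where a: "a \<in> carrier R" "eval ?q a = \<zero>" using exists_zero by blast
  have aO: "a \<in> \<O>" using root_integral[OF s _ lu(2,3) a] sp(2) by simp
  have "map res ?q = p" using g(2) sp(1) by (auto simp: map_idI subset_iff)
  then have "k.eval p (res a) = \<zero>\<^bsub>\<kappa>\<^esub>" using eval_res(2)[OF s aO] a(2) res_zero by simp
  then show "\<exists>x\<in>carrier \<kappa>. k.eval p x = \<zero>\<^bsub>\<kappa>\<^esub>" using res_closed[OF aO] by blast
qed

sublocale k: algebraically_closed \<kappa> by (rule \<kappa>_algebraically_closed)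

lemma residue_algebraic:
  assumes "subfield F R" "x \<in> \<O>" "(algebraic over F) x"
  shows "(k.algebraic over (resf F)) (res x)"
proof -
  have xc: "x \<in> carrier R" using assms(2) \<O>_carrier by blast
  let ?E = "simple_extension F x"
  have E: "subfield ?E R" "F \<subseteq> ?E" "x \<in> ?E" "finite_dimension F ?E"
    using simple_extension_props[OF assms(1) xc assms(3)] by blast+
  show ?thesis
    using k.finite_dimension_imp_algebraic[OF resf_subfield[OF assms(1)] subfieldE(1)[OF resf_subfield[OF E(1)]]
      fundamental_inequality(1)[OF assms(1) E(1,2,4)] resf_memI[OF E(3) assms(2)]] .
qed

text \<open>
  An element is well separated over \<open>F\<close> if it is separable and its distance to each of its other
  conjugates is no smaller than its own size. Generators of tame extensions can be chosen so:
  both lifts of separable residues and radicals of exponent prime to the residue characteristic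
  have this property, and it is preserved by enlarging \<open>F\<close>.
\<close>

definition well_separated :: "'a set \<Rightarrow> 'a \<Rightarrow> bool"
  where "well_separated F a \<longleftrightarrow> a \<in> carrier R \<and> a \<noteq> \<zero> \<and> separable_element R F a \<and>
    (\<forall>b\<in>zeros (Irr F a). b \<noteq> a \<longrightarrow> \<not> above (v a) (b \<ominus> a))"

lemma well_separated_mono:
  assumes "subfield F R" "subfield E R" "F \<subseteq> E" "well_separated F a"
  shows "well_separated E a"
proof -
  have a: "a \<in> carrier R" "separable_element R F a" using assms(4) by (auto simp: well_separated_def)
  then have "(algebraic over F) a" by (simp add: separable_iff_zeros)
  then have "zeros (Irr E a) \<subseteq> zeros (Irr F a)" using Irr_zeros_antimono(1)[OF assms(1-3) a(1)] by blast
  then show ?thesis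
    using assms(4) separable_mono[OF assms(1-3) a] unfolding well_separated_def by blast
qed

lemma well_separatedI:
  assumes "subfield F R" "p \<in> carrier (F[X])" "p \<noteq> []" "a \<in> zeros p" "a \<noteq> \<zero>" "degree p \<le> card (zeros p)"
    and "\<And>b. b \<in> zeros p \<Longrightarrow> b \<noteq> a \<Longrightarrow> \<not> above (v a) (b \<ominus> a)"
  shows "well_separated F a"
proof -
  have a: "a \<in> carrier R" "eval p a = \<zero>" using assms(4) by (auto simp: zeros_def)
  have alg: "(algebraic over F) a" using algebraicI[OF assms(2,3) a(2)] .
  have "zeros (Irr F a) \<subseteq> zeros p"
    using pdivides_imp_root_sharing[OF Irr_not_Nil(3)[OF assms(1) a(1) alg]
      Irr_minimal[OF assms(1) a(1) alg assms(2) a(2)]] by (auto simp: zeros_def)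
  then show ?thesis
    using separable_if_many_zeros[OF assms(1) a(1) assms(2,3) a(2) assms(6)] assms(5,7) a(1)
    unfolding well_separated_def by blast
qed

text \<open>
  Every root of the minimal polynomial of \<open>\<alpha>\<close> is the residue of a root of a monic lift. By separability
  there are as many of them as the degree, so taking residues is a bijection between the two sets
  of roots: distinct roots of the lift do not come close to each other.
\<close>

theorem separable_residue_lift:
  assumes "subfield F R" "\<alpha> \<in> carrier \<kappa>" "separable_element \<kappa> (resf F) \<alpha>" "\<alpha> \<noteq> \<zero>\<^bsub>\<kappa>\<^esub>"
  obtains a where "well_separated F a" "a \<in> \<O>" "v a = 0" "res a = \<alpha>"
proof -
  note kF = resf_subfield[OF assms(1)]
  have alg: "(k.algebraic over (resf F)) \<alpha>" and
    cp: "card (k.zeros (k.Irr (resf F) \<alpha>)) = degree (k.Irr (resf F) \<alpha>)"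
    using assms(3) by (simp_all add: k.separable_iff_zeros)
  let ?p = "k.Irr (resf F) \<alpha>"
  note irr = k.IrrE[OF kF assms(2) alg] k.Irr_not_Nil[OF kF assms(2) alg]
  obtain q where q: "q \<in> carrier (F[X])" "set q \<subseteq> \<O>" "map res q = ?p" "lead_coeff q = \<one>" "q \<noteq> []"
    "length q = length ?p"
    using lift_poly[OF irr(1,5) assms(1) irr(3)] by blast
  have qc: "q \<in> carrier (poly_ring R)" using carrier_polynomial_shell[OF subfieldE(1)[OF assms(1)] q(1)] .
  have zO: "a \<in> \<O>" if "a \<in> zeros q" for a
    using root_integral[OF q(2,5)] that q(4) by (simp add: zeros_def)
  have sur: "\<exists>a\<in>zeros q. res a = \<rho>" if \<rho>: "\<rho> \<in> k.zeros ?p" for \<rho>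
  proof -
    obtain u where u: "u \<in> \<O>" "\<rho> = res u" using \<rho> carrier_\<kappa> by (auto simp: k.zeros_def)
    have "res (eval q u) = \<zero>\<^bsub>\<kappa>\<^esub>" using eval_res(2)[OF q(2) u(1)] q(3) \<rho> u(2) by (simp add: k.zeros_def)
    then have "above 0 (eval q u)" using res_eq_zero_iff[of "eval q u"] eval_res(1)[OF q(2) u(1)] \<O>_carrier by blast
    from root_lift[OF q(2,5,4) u(1) this] obtain a where a: "a \<in> zeros q" "a \<in> \<O>" "above 0 (u \<ominus> a)" .
    then have "res a = \<rho>" using res_eq_iff[of u a] u \<O>_carrier by simp
    then show ?thesis using a(1) by blast
  qed
  note fin = card_zeros_le[OF qc q(5)]
  have img: "k.zeros ?p \<subseteq> res ` zeros q" using sur by blast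
  have "degree ?p \<le> card (res ` zeros q)" unfolding cp[symmetric] using fin(1) img by (intro card_mono) auto
  then have c: "card (res ` zeros q) = card (zeros q)" "degree q \<le> card (zeros q)"
    using card_image_le[OF fin(1), of res] fin(2) q(6) by simp_all
  then have inj: "inj_on res (zeros q)" using fin(1) by (simp add: eq_card_imp_inj_on)
  have "\<alpha> \<in> k.zeros ?p" using irr(4) assms(2) by (simp add: k.zeros_def)
  then obtain a where a: "a \<in> zeros q" "res a = \<alpha>" using sur by blast
  note u = unit_of_res_nonzero[OF zO[OF a(1)]]
  have ra: "res a \<noteq> \<zero>\<^bsub>\<kappa>\<^esub>" using a(2) assms(4) by simp
  have "well_separated F a"
  proof (rule well_separatedI[OF assms(1) q(1,5) a(1) u(2)[OF ra] c(2)])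
    fix b assume b: "b \<in> zeros q" "b \<noteq> a"
    then have "res b \<noteq> res a" using inj_onD[OF inj _ b(1) a(1)] by blast
    then show "\<not> above (v a) (b \<ominus> a)"
      using res_eq_iff[of b a] u(3)[OF ra] b(1) a(1) by (simp add: zeros_def)
  qed
  then show ?thesis using that zO[OF a(1)] u(3)[OF ra] a(2) by blast
qed

lemma add_pow_one_residue:
  assumes "\<not> ring_char \<kappa> dvd n"
  shows "[n] \<cdot> \<one> \<in> carrier R" "[n] \<cdot> \<one> \<noteq> \<zero>" "n > 0" "[n] \<cdot>\<^bsub>\<kappa>\<^esub> \<one>\<^bsub>\<kappa>\<^esub> \<noteq> \<zero>\<^bsub>\<kappa>\<^esub>"
proof -
  have r: "[m] \<cdot> \<one> \<in> \<O> \<and> res ([m] \<cdot> \<one>) = [m] \<cdot>\<^bsub>\<kappa>\<^esub> \<one>\<^bsub>\<kappa>\<^esub>" for m :: nat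
    by (induction m) (simp_all add: res_zero res_add res_one)
  show k: "[n] \<cdot>\<^bsub>\<kappa>\<^esub> \<one>\<^bsub>\<kappa>\<^esub> \<noteq> \<zero>\<^bsub>\<kappa>\<^esub>" using assms k.add_pow_one_eq_zero_iff by simp
  show "[n] \<cdot> \<one> \<in> carrier R" by simp
  show "[n] \<cdot> \<one> \<noteq> \<zero>" using r[of n] k res_zero by metis
  show "n > 0" using assms by (cases n) auto
qed

text \<open>
  In \<open>\<zeta>\<^sup>n - 1 = (\<zeta> - 1) (1 + \<zeta> + \<dots> + \<zeta>\<^bsup>n - 1\<^esup>)\<close> the second factor has the residue \<open>n\<close>, which is nonzero.
\<close>

lemma root_of_unity_residue:
  assumes "\<not> ring_char \<kappa> dvd n" "\<zeta> \<in> carrier R" "\<zeta> [^] n = \<one>" "above 0 (\<zeta> \<ominus> \<one>)"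
  shows "\<zeta> = \<one>"
proof -
  have "\<one> \<oplus> (\<zeta> \<ominus> \<one>) = \<zeta>" using assms(2) by (simp add: minus_eq a_lcomm r_neg)
  then have "v \<zeta> = 0" "\<zeta> \<noteq> \<zero>" using v_add_eq[of \<one> "\<zeta> \<ominus> \<one>"] assms(2,4) by auto
  then have zO: "\<zeta> \<in> \<O>" using assms(2) by (simp add: mem_\<O>)
  have rz: "res \<zeta> = \<one>\<^bsub>\<kappa>\<^esub>" using res_eq_iff[of \<zeta> \<one>] assms by (simp add: res_one)
  have geo: "psum m (\<lambda>_. \<one>) \<zeta> \<in> \<O> \<and> (\<zeta> \<ominus> \<one>) \<otimes> psum m (\<lambda>_. \<one>) \<zeta> = \<zeta> [^] m \<ominus> \<one> \<and>
      res (psum m (\<lambda>_. \<one>) \<zeta>) = [m] \<cdot>\<^bsub>\<kappa>\<^esub> \<one>\<^bsub>\<kappa>\<^esub>" for m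
  proof (induction m)
    case 0
    then show ?case using assms(2) by (simp add: res_zero minus_eq r_neg)
  next
    case (Suc m)
    have pc: "psum m (\<lambda>_. \<one>) \<zeta> \<in> carrier R" using Suc \<O>_carrier by blast
    have "(\<zeta> \<ominus> \<one>) \<otimes> psum (Suc m) (\<lambda>_. \<one>) \<zeta> = (\<zeta> [^] m \<ominus> \<one>) \<oplus> (\<zeta> \<ominus> \<one>) \<otimes> \<zeta> [^] m"
      using Suc pc assms(2) by (simp add: r_distr)
    also have "(\<zeta> \<ominus> \<one>) \<otimes> \<zeta> [^] m = \<zeta> [^] Suc m \<ominus> \<zeta> [^] m"
      using assms(2) by (simp add: minus_eq l_distr l_minus m_comm[of \<zeta> "\<zeta> [^] m"])
    also have "(\<zeta> [^] m \<ominus> \<one>) \<oplus> (\<zeta> [^] Suc m \<ominus> \<zeta> [^] m) = \<zeta> [^] Suc m \<ominus> \<one>"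
    proof -
      have "(p \<ominus> q) \<oplus> (r \<ominus> p) = r \<ominus> q" if "p \<in> carrier R" "q \<in> carrier R" "r \<in> carrier R" for p q r
        using that unfolding minus_eq by algebra
      then show ?thesis using assms(2) by (simp del: nat_pow_Suc)
    qed
    finally show ?case
      using Suc zO rz assms(2) by (simp add: res_add res_pow res_one k.a_comm k.nat_pow_one)
  qed
  have pc: "psum n (\<lambda>_. \<one>) \<zeta> \<in> carrier R" "psum n (\<lambda>_. \<one>) \<zeta> \<noteq> \<zero>"
    using geo[of n] \<O>_carrier add_pow_one_residue(4)[OF assms(1)] res_zero by (blast, metis)
  have "(\<zeta> \<ominus> \<one>) \<otimes> psum n (\<lambda>_. \<one>) \<zeta> = \<zero>" using geo[of n] assms(3) by (simp add: minus_eq r_neg)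
  then have "\<zeta> \<ominus> \<one> = \<zero>" using integral[OF _ _ pc(1), of "\<zeta> \<ominus> \<one>"] pc(2) assms(2) by simp
  then show ?thesis using assms(2) by simp
qed

text \<open>
  The quotient of two roots of \<open>X\<^sup>n - z\<^sup>n\<close> is an \<open>n\<close>-th root of unity, and only the trivial one has
  residue one.
\<close>

theorem radical_well_separated:
  assumes "subfield F R" "\<not> ring_char \<kappa> dvd n" "z \<in> carrier R" "z \<noteq> \<zero>" "z [^] n \<in> F"
  shows "well_separated F z"
proof -
  note n = add_pow_one_residue[OF assms(2)]
  let ?c = "z [^] n" and ?p = "radical_poly n (z [^] n)"
  have c: "?c \<in> carrier R" "?c \<noteq> \<zero>" using assms(3,4) by simp_all
  note p = radical_poly_basic[OF assms(1,5) n(3)]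
  have ev: "eval ?p x = x [^] n \<ominus> ?c" if "x \<in> carrier R" for x
    using eval_radical_poly[OF c(1) n(3) that] .
  show ?thesis
  proof (rule well_separatedI[OF assms(1) p(1)])
    show "?p \<noteq> []" using p(3) by auto
    show "z \<in> zeros ?p" using ev[OF assms(3)] c assms(3) by (simp add: zeros_def minus_eq r_neg)
    show "degree ?p \<le> card (zeros ?p)" using p(3) card_radical_zeros[OF c n(3,2)] by simp
    fix b assume b: "b \<in> zeros ?p" "b \<noteq> z"
    then have bc: "b \<in> carrier R" "b [^] n \<ominus> ?c = \<zero>" using ev by (auto simp: zeros_def)
    then have bn: "b [^] n = ?c" using c(1) by simp
    note iz = inv_nonzero[OF assms(3,4)]
    have "(b \<otimes> inv z) [^] n = ?c \<otimes> inv z [^] n" using bc iz bn by (simp add: nat_pow_distrib)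
    also have "\<dots> = (z \<otimes> inv z) [^] n"
      by (rule nat_pow_distrib[OF assms(3), symmetric]) (use iz in simp)
    finally have z1: "(b \<otimes> inv z) [^] n = \<one>" using iz by (simp add: nat_pow_one)
    show "\<not> above (v z) (b \<ominus> z)"
    proof
      assume a: "above (v z) (b \<ominus> z)"
      have "b \<otimes> inv z \<ominus> \<one> = (b \<ominus> z) \<otimes> inv z" using bc(1) assms(3) iz by (simp add: minus_eq l_distr l_minus)
      moreover have "above (v z + v (inv z)) ((b \<ominus> z) \<otimes> inv z)"
        using above_mult[of "b \<ominus> z" "inv z" "v z"] a bc(1) assms(3) iz by simp
      ultimately have "above 0 (b \<otimes> inv z \<ominus> \<one>)" using assms(3,4) by simp
      then have "b \<otimes> inv z = \<one>" using root_of_unity_residue[OF assms(2) _ z1] bc(1) iz by simp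
      then have "b \<otimes> inv z \<otimes> z = z" using assms(3) by simp
      then have "b = z" using bc(1) assms(3) iz by (simp add: m_assoc)
      then show False using b(2) by simp
    qed
  qed (rule assms(4))
qed

end

lemma (in valued_field) valsE:
  assumes "g \<in> vals F"
  obtains x where "x \<in> F" "x \<noteq> \<zero>" "v x = g"
  using assms by auto


section \<open>Conjugates over a henselian field\<close>

context field
begin

definition Gal :: "'a set \<Rightarrow> ('a \<Rightarrow> 'a) set"
  where "Gal F = {\<phi> \<in> ring_iso R R. \<forall>c\<in>F. \<phi> c = c}"

lemma Gal_hom:
  assumes "\<phi> \<in> Gal F"
  shows "\<phi> \<in> ring_hom R R" "inj_on \<phi> (carrier R)" "\<phi> ` carrier R = carrier R"
    "x \<in> carrier R \<Longrightarrow> \<phi> x \<in> carrier R" "\<lbrakk> x \<in> carrier R; y \<in> carrier R \<rbrakk> \<Longrightarrow> \<phi> (x \<otimes> y) = \<phi> x \<otimes> \<phi> y"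
    "\<lbrakk> x \<in> carrier R; y \<in> carrier R \<rbrakk> \<Longrightarrow> \<phi> (x \<oplus> y) = \<phi> x \<oplus> \<phi> y" "\<phi> \<one> = \<one>" "\<phi> \<zero> = \<zero>"
    "x \<in> carrier R \<Longrightarrow> \<phi> x = \<zero> \<longleftrightarrow> x = \<zero>" "\<lbrakk> x \<in> carrier R; y \<in> carrier R \<rbrakk> \<Longrightarrow> \<phi> (x \<ominus> y) = \<phi> x \<ominus> \<phi> y"
    "x \<in> carrier R \<Longrightarrow> \<phi> (x [^] (n::nat)) = \<phi> x [^] n" "c \<in> F \<Longrightarrow> \<phi> c = c"
proof -
  show h: "\<phi> \<in> ring_hom R R" and inj: "inj_on \<phi> (carrier R)" and "\<phi> ` carrier R = carrier R"
    and "c \<in> F \<Longrightarrow> \<phi> c = c"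
    using assms by (auto simp: Gal_def ring_iso_def bij_betw_def)
  interpret h: ring_hom_ring R R \<phi> using ring_hom_ringI2[OF ring_axioms ring_axioms h] .
  show "x \<in> carrier R \<Longrightarrow> \<phi> x \<in> carrier R" "\<lbrakk> x \<in> carrier R; y \<in> carrier R \<rbrakk> \<Longrightarrow> \<phi> (x \<otimes> y) = \<phi> x \<otimes> \<phi> y"
    "\<lbrakk> x \<in> carrier R; y \<in> carrier R \<rbrakk> \<Longrightarrow> \<phi> (x \<oplus> y) = \<phi> x \<oplus> \<phi> y" "\<phi> \<one> = \<one>"
    "\<lbrakk> x \<in> carrier R; y \<in> carrier R \<rbrakk> \<Longrightarrow> \<phi> (x \<ominus> y) = \<phi> x \<ominus> \<phi> y" by (simp_all add: minus_eq)
  show z: "\<phi> \<zero> = \<zero>" by simp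
  show "x \<in> carrier R \<Longrightarrow> \<phi> x = \<zero> \<longleftrightarrow> x = \<zero>" using inj_onD[OF inj, of x \<zero>] z by auto
  show "x \<in> carrier R \<Longrightarrow> \<phi> (x [^] (n::nat)) = \<phi> x [^] n" by (induction n) auto
qed

lemma Gal_inv:
  assumes "\<phi> \<in> Gal F" "x \<in> carrier R" "x \<noteq> \<zero>"
  shows "\<phi> (inv x) = inv (\<phi> x)"
  using field_hom_inv(2)[OF carrier_is_subfield, of \<phi> x] Gal_hom(1)[OF assms(1)] assms(2,3) by simp

lemma Gal_zeros:
  assumes "\<phi> \<in> Gal F" "set p \<subseteq> F" "F \<subseteq> carrier R"
  shows "x \<in> zeros p \<Longrightarrow> \<phi> x \<in> zeros p"
  using eval_fixed_hom[OF Gal_hom(1)[OF assms(1)] assms(2,3) Gal_hom(12)[OF assms(1)], of x]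
    Gal_hom(4,8)[OF assms(1)] by (simp add: zeros_def)

lemma Gal_zeros_image:
  assumes "\<phi> \<in> Gal F" "set p \<subseteq> F" "F \<subseteq> carrier R" "finite (zeros p)"
  shows "\<phi> ` zeros p = zeros p"
proof (rule endo_inj_surj[OF assms(4)])
  show "\<phi> ` zeros p \<subseteq> zeros p" using Gal_zeros[OF assms(1-3)] by blast
  have "zeros p \<subseteq> carrier R" by (auto simp: zeros_def)
  then show "inj_on \<phi> (zeros p)" using Gal_hom(2)[OF assms(1)] by (rule inj_on_subset[rotated])
qed

lemma Gal_mono: "F \<subseteq> E \<Longrightarrow> Gal E \<subseteq> Gal F"
  by (auto simp: Gal_def)

end

locale henselian_field = valued_field R v + algebraic_closure R K
  for R (structure) and v :: "'a \<Rightarrow> 'g::linordered_ab_group_add" and K +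
  assumes unique_extension: "\<lbrakk> valuation R (w :: 'a \<Rightarrow> 'g); \<And>y. y \<in> K - {\<zero>} \<Longrightarrow> w y = v y; x \<in> carrier R - {\<zero>} \<rbrakk>
    \<Longrightarrow> w x = v x"
begin

sublocale valued_closed_field R v ..

lemma henselian_intermediate:
  assumes "subfield E R" "K \<subseteq> E"
  shows "henselian_field R v E"
proof -
  interpret E: algebraic_closure R E by (rule algebraic_closure_intermediate[OF assms])
  show ?thesis
  proof
    fix w :: "'a \<Rightarrow> 'g" and x
    assume w: "valuation R w" "\<And>y. y \<in> E - {\<zero>} \<Longrightarrow> w y = v y" "x \<in> carrier R - {\<zero>}"
    show "w x = v x" by (rule unique_extension[OF w(1) _ w(3)]) (use w(2) assms(2) in blast)
  qed
qed

text \<open>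
  The valuation \<open>x \<mapsto> v (\<phi> x)\<close> agrees with \<open>v\<close> on \<open>K\<close>.
\<close>

lemma v_Gal:
  assumes "\<phi> \<in> Gal K" "x \<in> carrier R" "x \<noteq> \<zero>"
  shows "v (\<phi> x) = v x"
proof -
  note \<phi> = Gal_hom[OF assms(1)]
  have "valuation R (\<lambda>x. v (\<phi> x))"
    unfolding valuation_def
  proof (intro conjI ballI impI)
    fix x y assume xy: "x \<in> carrier R - {\<zero>}" "y \<in> carrier R - {\<zero>}"
    then have c: "\<phi> x \<in> carrier R" "\<phi> x \<noteq> \<zero>" "\<phi> y \<in> carrier R" "\<phi> y \<noteq> \<zero>"
      using \<phi>(4,9) by auto
    show "v (\<phi> (x \<otimes> y)) = v (\<phi> x) + v (\<phi> y)" using \<phi>(5) xy c by simp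
    assume "x \<oplus> y \<noteq> \<zero>"
    then have "\<phi> x \<oplus> \<phi> y \<noteq> \<zero>" using \<phi>(9)[of "x \<oplus> y"] \<phi>(6)[of x y] xy by simp
    then show "min (v (\<phi> x)) (v (\<phi> y)) \<le> v (\<phi> (x \<oplus> y))"
      using v_add_ge[OF c(1,3,2,4)] \<phi>(6)[of x y] xy by simp
  qed
  then show ?thesis
    using unique_extension[of "\<lambda>x. v (\<phi> x)" x] \<phi>(12) assms(2,3) by simp
qed

lemma above_Gal:
  assumes "\<phi> \<in> Gal K" "x \<in> carrier R"
  shows "above g (\<phi> x) \<longleftrightarrow> above g x"
  using v_Gal[OF assms] Gal_hom(9)[OF assms] by (auto simp: above_def)

lemma conjugate_Gal:
  assumes "x \<in> carrier R" "y \<in> zeros (Irr K x)"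
  obtains \<phi> where "\<phi> \<in> Gal K" "\<phi> x = y"
proof (rule conjugate_automorphism[OF assms])
  fix \<phi> assume "\<phi> \<in> ring_iso R R" "\<And>c. c \<in> K \<Longrightarrow> \<phi> c = c" "\<phi> x = y"
  then show thesis by (intro that[of \<phi>]) (simp_all add: Gal_def)
qed

lemma Irr_over_base:
  assumes "x \<in> carrier R"
  shows "x \<in> zeros (Irr K x)" "finite (zeros (Irr K x))" "set (Irr K x) \<subseteq> K"
proof -
  note alg = algebraic_extension[OF assms]
  show "x \<in> zeros (Irr K x)" using IrrE(4)[OF subfield_axioms assms alg] assms by (simp add: zeros_def)
  show "finite (zeros (Irr K x))" using card_zeros_le(1) Irr_not_Nil(1,3)[OF subfield_axioms assms alg] by blast
  show "set (Irr K x) \<subseteq> K" using Irr_not_Nil(4)[OF subfield_axioms assms alg] .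
qed

text \<open>
  Krasner's lemma for well separated elements: an automorphism over \<open>K\<close> maps \<open>a\<close> to a conjugate that
  is as close to \<open>y\<close>, hence too close to \<open>a\<close> to be different from it.
\<close>

theorem well_separated_mem:
  assumes "well_separated K a" "y \<in> K" "above (v a) (y \<ominus> a)"
  shows "a \<in> K"
proof (rule fixed_separable_mem)
  show a: "separable_element R K a" "a \<in> carrier R" using assms(1) by (auto simp: well_separated_def)
  fix \<phi> assume "\<phi> \<in> ring_iso R R" "\<And>c. c \<in> K \<Longrightarrow> \<phi> c = c"
  then have \<phi>: "\<phi> \<in> Gal K" by (simp add: Gal_def)
  note h = Gal_hom[OF \<phi>]
  have yc: "y \<in> carrier R" using assms(2) subfieldE(3)[OF subfield_axioms] by blast
  have z: "\<phi> a \<in> zeros (Irr K a)"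
    using Gal_zeros[OF \<phi> Irr_over_base(3)[OF a(2)] subfieldE(3)[OF subfield_axioms] Irr_over_base(1)[OF a(2)]] .
  have "above (v a) (y \<ominus> \<phi> a)"
    using above_Gal[OF \<phi>, of "y \<ominus> a" "v a"] assms(3) yc a(2) h(10)[OF yc a(2)] h(12)[OF assms(2)] by simp
  then have "above (v a) ((y \<ominus> a) \<ominus> (y \<ominus> \<phi> a))"
    using above_diff[of "y \<ominus> a" "y \<ominus> \<phi> a" "v a"] assms(3) yc a(2) h(4)[OF a(2)] by simp
  moreover have "(y \<ominus> a) \<ominus> (y \<ominus> \<phi> a) = \<phi> a \<ominus> a"
    using yc a(2) h(4)[OF a(2)] unfolding minus_eq by algebra
  ultimately show "\<phi> a = a" using assms(1) z unfolding well_separated_def by force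
qed

text \<open>
  The defining condition compares \<open>a\<close> with its conjugates only; automorphisms, which preserve the
  valuation, transport it to any two conjugates.
\<close>

lemma well_separated_conjugates:
  assumes "well_separated K a" "y \<in> zeros (Irr K a)" "z \<in> zeros (Irr K a)"
  shows "z \<in> carrier R" "z \<noteq> \<zero>" "v z = v a" "y \<noteq> z \<Longrightarrow> \<not> above (v a) (y \<ominus> z)"
proof -
  have a: "a \<in> carrier R" "a \<noteq> \<zero>" using assms(1) by (auto simp: well_separated_def)
  show zc: "z \<in> carrier R" using assms(3) by (simp add: zeros_def)
  obtain \<phi> where \<phi>: "\<phi> \<in> Gal K" "\<phi> a = z" using conjugate_Gal[OF a(1) assms(3)] .
  note h = Gal_hom[OF \<phi>(1)]
  show "z \<noteq> \<zero>" "v z = v a" using h(9)[OF a(1)] a v_Gal[OF \<phi>(1) a] \<phi>(2) by auto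
  have "y \<in> \<phi> ` zeros (Irr K a)"
    unfolding Gal_zeros_image[OF \<phi>(1) Irr_over_base(3)[OF a(1)] subfieldE(3)[OF subfield_axioms] Irr_over_base(2)[OF a(1)]]
    by (rule assms(2))
  then obtain y' where y': "y' \<in> zeros (Irr K a)" "\<phi> y' = y" by (elim imageE) simp
  have yc: "y' \<in> carrier R" using y'(1) by (simp add: zeros_def)
  assume "y \<noteq> z"
  then have "y' \<noteq> a" using y'(2) \<phi>(2) by blast
  then have "\<not> above (v a) (y' \<ominus> a)" using assms(1) y'(1) by (simp add: well_separated_def)
  then show "\<not> above (v a) (y \<ominus> z)"
    using above_Gal[OF \<phi>(1), of "y' \<ominus> a" "v a"] h(10)[OF yc a(1)] yc a(1) \<phi>(2) y'(2) by simp
qed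

text \<open>
  Evaluate a lift of the minimal polynomial of the residue at \<open>b\<close>: the automorphism keeps the value
  positive.
\<close>

lemma residue_conjugate:
  assumes "\<phi> \<in> Gal K" "b \<in> \<O>"
  shows "\<phi> b \<in> \<O>" "res (\<phi> b) \<in> k.zeros (k.Irr (resf K) (res b))"
proof -
  note h = Gal_hom[OF assms(1)]
  have bc: "b \<in> carrier R" using assms(2) \<O>_carrier by blast
  show bO: "\<phi> b \<in> \<O>"
    using v_Gal[OF assms(1) bc] h(4)[OF bc] h(8) assms(2) by (cases "b = \<zero>") (auto simp: mem_\<O>)
  note K = subfield_axioms
  have alg: "(k.algebraic over (resf K)) (res b)"
    using residue_algebraic[OF K assms(2) algebraic_extension[OF bc]] .
  note kK = resf_subfield[OF K]
  note irr = k.IrrE[OF kK res_closed[OF assms(2)] alg] k.Irr_not_Nil[OF kK res_closed[OF assms(2)] alg]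
  obtain q where q: "q \<in> carrier (K[X])" "set q \<subseteq> \<O>" "map res q = k.Irr (resf K) (res b)"
    "lead_coeff q = \<one>" "q \<noteq> []" "length q = length (k.Irr (resf K) (res b))"
    by (rule lift_poly[OF irr(1,5) K irr(3)])
  have sq: "set q \<subseteq> K" using q(1) polynomial_incl univ_poly_carrier by blast
  have "res (eval q b) = \<zero>\<^bsub>\<kappa>\<^esub>" using eval_res(2)[OF q(2) assms(2)] q(3) irr(4) by simp
  moreover have ec: "eval q b \<in> carrier R" using eval_res(1)[OF q(2) assms(2)] \<O>_carrier by blast
  ultimately have "above 0 (\<phi> (eval q b))" using res_eq_zero_iff above_Gal[OF assms(1)] by simp
  then have "above 0 (eval q (\<phi> b))"
    using eval_fixed_hom[OF h(1) sq subfieldE(3)[OF K] h(12) bc] by simp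
  then have "res (eval q (\<phi> b)) = \<zero>\<^bsub>\<kappa>\<^esub>"
    using res_eq_zero_iff eval_res(1)[OF q(2) bO] \<O>_carrier by blast
  then show "res (\<phi> b) \<in> k.zeros (k.Irr (resf K) (res b))"
    using eval_res(2)[OF q(2) bO] q(3) res_closed[OF bO] by (simp add: k.zeros_def)
qed

end


section \<open>Extensions generated by one well separated element\<close>

text \<open>
  In characteristic \<open>p\<close>, \<open>x\<^bsup>p n\<^esup> = 1\<close> implies \<open>x\<^sup>n = 1\<close>. So \<open>m\<close> distinct roots of unity
  witness that \<open>m\<close> is prime to the characteristic.
\<close>

lemma (in field) card_roots_of_unity:
  assumes "m > 0"
  shows "finite {x \<in> carrier R. x [^] m = \<one>}" "card {x \<in> carrier R. x [^] m = \<one>} \<le> m"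
    "ring_char R dvd m \<Longrightarrow> card {x \<in> carrier R. x [^] m = \<one>} < m"
proof -
  have le: "finite {x \<in> carrier R. x [^] n = \<one>} \<and> card {x \<in> carrier R. x [^] n = \<one>} \<le> n" if "n > 0" for n
  proof -
    note f = radical_poly_basic[OF carrier_is_subfield one_closed that]
    have "zeros (radical_poly n \<one>) = {x \<in> carrier R. x [^] n = \<one>}"
      using eval_radical_poly[OF one_closed that] by (auto simp: zeros_def)
    moreover have "radical_poly n \<one> \<noteq> []" using f(3) by auto
    ultimately show ?thesis using card_zeros_le[OF f(1)] f(3) by simp
  qed
  show "finite {x \<in> carrier R. x [^] m = \<one>}" "card {x \<in> carrier R. x [^] m = \<one>} \<le> m"
    using le[OF assms] by auto
  assume d: "ring_char R dvd m"
  then have p0: "ring_char R \<noteq> 0" using assms by auto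
  note p = prime_ring_char[OF p0]
  from d obtain n where n: "m = ring_char R * n" by blast
  then have "n > 0" using assms by (cases n) auto
  have "{x \<in> carrier R. x [^] m = \<one>} \<subseteq> {x \<in> carrier R. x [^] n = \<one>}"
  proof clarify
    fix x assume x: "x \<in> carrier R" "x [^] m = \<one>"
    then have "(x [^] n) [^] ring_char R = \<one> [^] ring_char R"
      by (simp add: nat_pow_pow n mult.commute nat_pow_one)
    then show "x [^] n = \<one>"
      using prime_char_pow_inj[OF p, of "x [^] n" \<one>] x(1) add_pow_one_eq_zero_iff by simp
  qed
  then have "card {x \<in> carrier R. x [^] m = \<one>} \<le> n"
    using le[OF \<open>n > 0\<close>] card_mono order_trans by blast
  also have "n < m" using n \<open>n > 0\<close> prime_ge_2_nat[OF p] by simp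
  finally show "card {x \<in> carrier R. x [^] m = \<one>} < m" .
qed

lemma (in valued_closed_field) gindex_ge_order:
  assumes "is_subgrp A" "is_subgrp C" "gindex A C > 0" "g \<in> C" "m > 0" "\<And>j. 0 < j \<Longrightarrow> j < m \<Longrightarrow> nmult j g \<notin> A"
  shows "m \<le> gindex A C"
proof -
  have "inj_on (\<lambda>j. gcoset A (nmult j g)) {..<m}"
  proof (rule linorder_inj_onI)
    fix i j assume ij: "i < j" "i \<in> {..<m}" "j \<in> {..<m}"
    have "nmult j g = nmult (j - i) g + nmult i g" using ij(1) nmult_add_left[of "j - i" i g] by simp
    then have "nmult j g - nmult i g \<notin> A" using assms(6)[of "j - i"] ij by simp
    then show "gcoset A (nmult i g) \<noteq> gcoset A (nmult j g)"
      using gcoset_eq_iff[OF assms(1), of "nmult j g" "nmult i g"] by auto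
  qed auto
  then have "m = card ((\<lambda>j. gcoset A (nmult j g)) ` {..<m})" by (simp add: card_image)
  also have "\<dots> \<le> card (gcoset A ` C)"
    using assms(3) is_subgrpD(5)[OF assms(2,4)] unfolding gindex_def by (intro card_mono) (auto simp: card_gt_0_iff)
  finally show ?thesis by (simp add: gindex_def)
qed

context henselian_field
begin

text \<open>
  Let \<open>m\<close> be the order of \<open>v a\<close> modulo the values of \<open>K\<close>, and \<open>b = a\<^sup>m / c\<close> a unit with \<open>c\<close> in \<open>K\<close>.
  Distinct conjugates \<open>a'\<close> of \<open>a\<close> have distinct residues of \<open>a' / a\<close>, so each value
  of the residue of \<open>a'\<^sup>m / c\<close> is taken at most as often as there are \<open>m\<close>-th roots of unity in the
  residue field. All these residues are conjugate, whence \<open>[K(a) : K] \<le> f m \<le> f e\<close>; by the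
  fundamental inequality equality holds everywhere, and then there are exactly \<open>m\<close> roots of unity.
\<close>

theorem well_separated_extension:
  assumes "well_separated K a"
  shows "defectless R v K (simple_extension K a)"
    and "\<not> ring_char \<kappa> dvd ramification_index R v K (simple_extension K a)"
    and "v a \<in> vals K \<Longrightarrow> ramification_index R v K (simple_extension K a) = 1"
proof -
  define E where "E = simple_extension K a"
  note K = subfield_axioms
  note Kc = subfield_closed[OF K]
  have a: "a \<in> carrier R" "a \<noteq> \<zero>" "separable_element R K a" using assms by (auto simp: well_separated_def)
  note alg = algebraic_extension[OF a(1)]
  have E: "subfield E R" "K \<subseteq> E" "a \<in> E" "finite_dimension K E" "dim K E = degree (Irr K a)"
    unfolding E_def using simple_extension_props[OF K a(1) alg] by blast+
  note Ec = subfield_closed[OF E(1)]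
  note fi = fundamental_inequality[OF K E(1,2,4)]
  let ?e = "ramification_index R v K E" and ?f = "inertia_degree R v K E"
  note gK = vals_is_subgrp[OF K] and gE = vals_is_subgrp[OF E(1)]
  have va: "v a \<in> vals E" using E(3) a(2) by blast
  define Q where "Q j \<longleftrightarrow> 0 < j \<and> nmult j (v a) \<in> vals K" for j
  have "Q ?e" unfolding Q_def using fi(2) nmult_gindex_mem[OF gK gE _ va] by (simp add: ramification_index_eq)
  define m where "m = (LEAST j. Q j)"
  have m: "0 < m" "nmult m (v a) \<in> vals K" 
  proof -
    have "Q m" unfolding m_def by (rule LeastI[of Q, OF \<open>Q ?e\<close>])
    then show "0 < m" "nmult m (v a) \<in> vals K" by (simp_all add: Q_def)
  qed
  have least: "\<not> Q j" if "j < m" for j using not_less_Least[of j Q] that unfolding m_def by blast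
  have me: "m \<le> ?e"
    unfolding ramification_index_eq
  proof (rule gindex_ge_order[OF gK gE _ va m(1)])
    show "gindex (vals K) (vals E) > 0" using fi(2) unfolding ramification_index_eq .
    fix j assume "0 < j" "j < m"
    then show "nmult j (v a) \<notin> vals K" using least[of j] unfolding Q_def by blast
  qed
  obtain c where c: "c \<in> K" "c \<noteq> \<zero>" "v c = nmult m (v a)"
    by (rule valsE[OF m(2)])
  have cc: "c \<in> carrier R" using c(1) Kc(1) by blast
  note ic = inv_nonzero[OF cc c(2)]
  let ?Z = "zeros (Irr K a)"
  define g where "g z = z [^] m \<otimes> inv c" for z
  have gz: "g z \<in> carrier R" "g z \<noteq> \<zero>" "v (g z) = 0" "g z \<in> \<O>" if "z \<in> ?Z" for z
  proof -
    note z = well_separated_conjugates[OF assms that that]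
    show "g z \<in> carrier R" "g z \<noteq> \<zero>" "v (g z) = 0"
      using z ic cc c by (simp_all add: g_def integral_iff)
    then show "g z \<in> \<O>" by (simp add: mem_\<O>)
  qed
  note aZ = Irr_over_base(1)[OF a(1)] and fin = Irr_over_base(2)[OF a(1)]
  let ?b = "g a"
  have bE: "?b \<in> E" 
    unfolding g_def by (rule Ec(6)[OF Ec(9)[OF E(3)] Ec(7)[OF subsetD[OF E(2) c(1)] c(2)]])
  let ?\<beta> = "res ?b"
  have \<beta>c: "?\<beta> \<in> carrier \<kappa>" using gz(4)[OF aZ] by simp
  note kK = resf_subfield[OF K]
  have \<beta>alg: "(k.algebraic over (resf K)) ?\<beta>"
    using residue_algebraic[OF K gz(4)[OF aZ] algebraic_extension[OF gz(1)[OF aZ]]] .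
  have "res (g z) \<in> k.zeros (k.Irr (resf K) ?\<beta>)" if z: "z \<in> ?Z" for z
  proof -
    obtain \<phi> where \<phi>: "\<phi> \<in> Gal K" "\<phi> a = z" using conjugate_Gal[OF a(1) z] .
    note h = Gal_hom[OF \<phi>(1)]
    have "\<phi> ?b = g z"
      unfolding g_def using h(5,11)[of a] a(1) h(5)[of "a [^] m" "inv c"] ic \<phi>(2) h(12)[OF Kc(7)[OF c(1,2)]] by simp
    then show ?thesis using residue_conjugate(2)[OF \<phi>(1) gz(4)[OF aZ]] by simp
  qed
  then have sub: "(\<lambda>z. res (g z)) ` ?Z \<subseteq> k.zeros (k.Irr (resf K) ?\<beta>)" by blast
  let ?r = "card ((\<lambda>z. res (g z)) ` ?Z)"
  note kz = k.card_zeros_le[OF k.Irr_not_Nil(3,1)[OF kK \<beta>c \<beta>alg]]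
  have "?r \<le> degree (k.Irr (resf K) ?\<beta>)"
    using card_mono[OF kz(1) sub] kz(2) by linarith
  also have "\<dots> \<le> ?f"
  proof -
    have "k.dimension (degree (k.Irr (resf K) ?\<beta>)) (resf K) (k.simple_extension (resf K) ?\<beta>)"
      using k.dimension_simple_extension[OF kK \<beta>c \<beta>alg] .
    moreover have "k.simple_extension (resf K) ?\<beta> \<subseteq> resf E"
      using k.simple_extension_subring_incl[OF subfieldE(1)[OF resf_subfield[OF E(1)]] resf_mono[OF E(2)]
        resf_memI[OF bE gz(4)[OF aZ]]] .
    moreover have "k.dimension ?f (resf K) (resf E)"
      using k.finite_dimensionE[OF kK fi(1)] by (simp add: inertia_degree_def over_def)
    ultimately show ?thesis using k.dimension_le[OF kK] by blast
  qed
  finally have rf: "?r \<le> ?f" .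
  let ?M = "{x \<in> carrier \<kappa>. x [^]\<^bsub>\<kappa>\<^esub> m = \<one>\<^bsub>\<kappa>\<^esub>}"
  note mu = k.card_roots_of_unity[OF m(1)]
  \<comment> \<open>two conjugates \<open>y\<close>, \<open>z\<close> with the same residue of \<open>g\<close> differ by a factor whose residue is an \<open>m\<close>-th root of unity\<close>
  have fiber: "card {z \<in> ?Z. res (g z) = \<rho>} \<le> card ?M" if \<rho>: "\<rho> \<in> (\<lambda>z. res (g z)) ` ?Z" for \<rho>
  proof -
    obtain y where y: "y \<in> ?Z" "res (g y) = \<rho>" using \<rho> by blast
    note yy = well_separated_conjugates[OF assms y(1) y(1)]
    note iy = inv_nonzero[OF yy(1,2)]
    have q: "z \<otimes> inv y \<in> \<O>" "z \<otimes> inv y \<in> carrier R" if "z \<in> ?Z" for z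
      using well_separated_conjugates(1-3)[OF assms that that] iy yy(1-3) by (simp_all add: mem_\<O>)
    have "inj_on (\<lambda>z. res (z \<otimes> inv y)) {z \<in> ?Z. res (g z) = \<rho>}"
    proof (rule inj_onI, clarify)
      fix z z' assume z: "z \<in> ?Z" "z' \<in> ?Z" "res (z \<otimes> inv y) = res (z' \<otimes> inv y)"
      note zz = well_separated_conjugates[OF assms z(1) z(1)] well_separated_conjugates[OF assms z(1,2)]
      have "above 0 (z \<otimes> inv y \<ominus> z' \<otimes> inv y)" using res_eq_iff[OF q(2)[OF z(1)] q(2)[OF z(2)]] z(3) by simp
      moreover have "z \<otimes> inv y \<ominus> z' \<otimes> inv y = (z \<ominus> z') \<otimes> inv y"
        using zz iy by (simp add: minus_eq l_distr l_minus)
      ultimately have "above (v a + v (inv y)) ((z \<ominus> z') \<otimes> inv y)" using yy by simp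
      then have "above (v a) (z \<ominus> z')" using above_mult[of "z \<ominus> z'" "inv y" "v a"] zz iy by simp
      then show "z = z'" using zz(8) by blast
    qed
    moreover have "(\<lambda>z. res (z \<otimes> inv y)) ` {z \<in> ?Z. res (g z) = \<rho>} \<subseteq> ?M"
    proof clarify
      fix z assume z: "z \<in> ?Z" "\<rho> = res (g z)"
      note zz = well_separated_conjugates[OF assms z(1) z(1)]
      have "(z \<otimes> inv y) [^] m \<otimes> g y = g z"
      proof -
        have "(z \<otimes> inv y) [^] m \<otimes> y [^] m = (z \<otimes> inv y \<otimes> y) [^] m"
          by (rule nat_pow_distrib[symmetric]) (use q(2)[OF z(1)] yy in auto)
        also have "z \<otimes> inv y \<otimes> y = z" using zz yy iy by (simp add: m_assoc)
        finally show ?thesis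
          unfolding g_def using ic yy(1) q(2)[OF z(1)] by (simp add: m_assoc[symmetric])
      qed
      then have "res (z \<otimes> inv y) [^]\<^bsub>\<kappa>\<^esub> m \<otimes>\<^bsub>\<kappa>\<^esub> res (g y) = res (g y)"
        using res_mult[of "(z \<otimes> inv y) [^] m" "g y"] res_pow[OF q(1)[OF z(1)], of m] q(1)[OF z(1)] gz(4)[OF y(1)] y(2) z(2)
        by simp
      moreover have "res (g y) \<noteq> \<zero>\<^bsub>\<kappa>\<^esub>" using res_inv'(2)[OF gz(1-3)[OF y(1)]] .
      ultimately have "res (z \<otimes> inv y) [^]\<^bsub>\<kappa>\<^esub> m = \<one>\<^bsub>\<kappa>\<^esub>"
        using k.m_rcancel[of "res (g y)" "res (z \<otimes> inv y) [^]\<^bsub>\<kappa>\<^esub> m" "\<one>\<^bsub>\<kappa>\<^esub>"] q(1)[OF z(1)] gz(4)[OF y(1)]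
        by simp
      then show "res (z \<otimes> inv y) \<in> carrier \<kappa> \<and> res (z \<otimes> inv y) [^]\<^bsub>\<kappa>\<^esub> m = \<one>\<^bsub>\<kappa>\<^esub>"
        using q(1)[OF z(1)] by simp
    qed
    ultimately show ?thesis using card_inj_on_le[OF _ _ mu(1)] by blast
  qed
  have "card ?Z \<le> ?r * card ?M"
  proof -
    have "card ?Z = (\<Sum>\<rho>\<in>(\<lambda>z. res (g z)) ` ?Z. card {z \<in> ?Z. res (g z) = \<rho>})"
      using sum.image_gen[OF fin, of "\<lambda>_. 1::nat" "\<lambda>z. res (g z)"] by simp
    also have "\<dots> \<le> ?r * card ?M" using sum_bounded_above[OF fiber] by simp
    finally show ?thesis .
  qed
  then have n1: "dim K E \<le> ?r * card ?M" using a(3) E(5) by (simp add: separable_iff_zeros)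
  have "?Z \<noteq> {}" using aZ by blast
  then have r0: "?r > 0" using fin by (simp add: card_gt_0_iff)
  \<comment> \<open>the chain \<open>n \<le> r |\<mu>\<^sub>m| \<le> r m \<le> f m \<le> f e \<le> n\<close> collapses\<close>
  have c1: "?r * card ?M \<le> ?r * m" and c2: "?r * m \<le> ?f * m" and c3: "?f * m \<le> ?f * ?e" and c4: "?f * ?e \<le> dim K E"
    using mu(2) rf me fi(4) by (simp_all add: mult.commute)
  have "?r * card ?M = ?r * m" "?f * m = ?f * ?e" "dim K E = ?f * ?e" using n1 c1 c2 c3 c4 by linarith+
  then have eq: "card ?M = m" "m = ?e" "dim K E = ?e * ?f" using r0 fi(3) by (simp_all add: mult.commute)
  show "defectless R v K (simple_extension K a)" using eq(3) unfolding defectless_def E_def .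
  show "\<not> ring_char \<kappa> dvd ramification_index R v K (simple_extension K a)"
    using mu(3) eq(1,2) unfolding E_def by auto
  assume "v a \<in> vals K"
  then have "Q 1" by (simp add: Q_def)
  then have "m \<le> 1" unfolding m_def by (rule Least_le)
  then show "ramification_index R v K (simple_extension K a) = 1" using eq(2) m(1) unfolding E_def by simp
qed

end


section \<open>Towers of well separated elements\<close>

lemma gindex_eq_1_iff:
  assumes "is_subgrp A" "is_subgrp C" "A \<subseteq> C"
  shows "gindex A C = 1 \<longleftrightarrow> A = C"
proof
  assume "gindex A C = 1"
  then obtain Q where Q: "gcoset A ` C = {Q}" unfolding gindex_def by (auto simp: card_1_singleton_iff)
  have "c \<in> A" if "c \<in> C" for c
  proof -
    have "gcoset A c = gcoset A 0" using Q that is_subgrpD(1)[OF assms(2)] by blast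
    then show ?thesis using gcoset_eq_iff[OF assms(1), of c 0] by simp
  qed
  then show "A = C" using assms(3) by blast
qed (use gindex_eq_1 assms in blast)

context valued_closed_field
begin

text \<open>
  \<open>G\<close> restricts the values of the generators: \<open>UNIV\<close> yields the tame extensions, \<open>{0}\<close> the
  unramified ones. As the generators are units in the second case, no reference to the value group of
  the base field is needed, which is what makes the notion monotone in the base field.
\<close>

inductive tower :: "'g set \<Rightarrow> 'a set \<Rightarrow> 'a set \<Rightarrow> bool" for G F
  where base: "tower G F F"
  | step: "\<lbrakk> tower G F M; well_separated M a; v a \<in> G \<rbrakk> \<Longrightarrow> tower G F (simple_extension M a)"

definition tame_closure :: "'g set \<Rightarrow> 'a set \<Rightarrow> 'a set"
  where "tame_closure G F = \<Union>{M. tower G F M}"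

lemma residue_char_dvd_mult:
  assumes "\<not> ring_char \<kappa> dvd m" "\<not> ring_char \<kappa> dvd n"
  shows "\<not> ring_char \<kappa> dvd m * n"
proof (cases "ring_char \<kappa> = 0")
  case True
  then show ?thesis using assms by simp
next
  case False
  then show ?thesis using assms k.prime_ring_char[OF False] prime_dvd_mult_iff by blast
qed

lemma residue_char_not_dvd_1: "\<not> ring_char \<kappa> dvd 1"
  using k.add_pow_one_eq_zero_iff[of 1] by simp

lemma trivial_extension:
  assumes "subfield F R"
  shows "ramification_index R v F F = 1" "defectless R v F F" "finite_dimension F F"
proof -
  show e: "ramification_index R v F F = 1"
    using gindex_eq_1[OF vals_is_subgrp[OF assms]] by (simp add: ramification_index_eq)
  have "inertia_degree R v F F = 1"
    using k.dimI[OF resf_subfield[OF assms] k.dimension_one[OF resf_subfield[OF assms]]]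
    by (simp add: inertia_degree_def over_def)
  moreover have "dim F F = 1" using dimI[OF assms dimension_one[OF assms]] by (simp add: over_def)
  ultimately show "defectless R v F F" using e by (simp add: defectless_def)
  show "finite_dimension F F" using finite_dimensionI[OF dimension_one[OF assms]] .
qed

end

context henselian_field
begin

lemma tower_props:
  assumes "tower G K M"
  shows "subfield M R \<and> K \<subseteq> M \<and> finite_dimension K M \<and> defectless R v K M \<and>
    \<not> ring_char \<kappa> dvd ramification_index R v K M \<and> (G \<subseteq> vals K \<longrightarrow> ramification_index R v K M = 1)"
  using assms
proof (induction rule: tower.induct)
  case base
  show ?case using trivial_extension[OF subfield_axioms] subfield_axioms residue_char_not_dvd_1 by simp
next
  case (step M a)
  then have M: "subfield M R" "K \<subseteq> M" "finite_dimension K M" "defectless R v K M"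
    "\<not> ring_char \<kappa> dvd ramification_index R v K M" "G \<subseteq> vals K \<Longrightarrow> ramification_index R v K M = 1" by blast+
  interpret M: henselian_field R v M by (rule henselian_intermediate[OF M(1,2)])
  let ?E = "simple_extension M a"
  have a: "a \<in> carrier R" using step(2) by (simp add: well_separated_def)
  note alg = M.algebraic_extension[OF a]
  have E: "subfield ?E R" "M \<subseteq> ?E" "finite_dimension M ?E"
    using simple_extension_props[OF M(1) a alg] by blast+
  note we = M.well_separated_extension[OF step(2)]
  have fd: "finite_dimension K ?E" using telescopic_base_dim(1)[OF subfield_axioms M(1,3) E(3)] .
  note dt = degree_tower[OF subfield_axioms M(1) E(1) M(2) E(2) fd]
  have "ramification_index R v K ?E = 1" if G: "G \<subseteq> vals K"
  proof -
    have "v a \<in> vals M" using step(3) G vals_mono[OF M(2)] by blast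
    then show ?thesis using dt(1) M(6)[OF G] we(3) by simp
  qed
  moreover have "\<not> ring_char \<kappa> dvd ramification_index R v K ?E"
    unfolding dt(1) using residue_char_dvd_mult[OF M(5) we(2)] .
  ultimately show ?case using E fd M(2) dt(3) M(4) we(1) by blast
qed

text \<open>
  The generators of a tower over \<open>K\<close> can be adjoined one after the other to any tower over \<open>F\<close>, since
  they remain well separated over the larger fields reached there. With \<open>F = K\<close> this shows that the
  towers are directed, with \<open>N = F\<close> that the closure grows with the base field.
\<close>

lemma tower_join:
  assumes "tower G K M" "subfield F R" "K \<subseteq> F" "tower G F N"
  shows "\<exists>N'. tower G F N' \<and> N \<subseteq> N' \<and> M \<subseteq> N'"
  using assms(1)
proof (induction rule: tower.induct)
  interpret F: henselian_field R v F by (rule henselian_intermediate[OF assms(2,3)])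
  { case base
    show ?case using assms(3,4) F.tower_props[OF assms(4)] by blast }
  { case (step M a)
    then obtain N' where N': "tower G F N'" "N \<subseteq> N'" "M \<subseteq> N'" by blast
    have sN: "subfield N' R" "subfield M R" using F.tower_props[OF N'(1)] tower_props[OF step(1)] by blast+
    have a: "a \<in> carrier R" using step(2) by (simp add: well_separated_def)
    have "tower G F (simple_extension N' a)"
      using tower.step[OF N'(1) well_separated_mono[OF sN(2,1) N'(3) step(2)] step(3)] .
    moreover have "N' \<subseteq> simple_extension N' a" using simple_extension_incl[OF subfieldE(3)[OF sN(1)] a] .
    moreover have "simple_extension M a \<subseteq> simple_extension N' a" using mono_simple_extension[OF N'(3)] .
    ultimately show ?case using N'(2) by blast }
qed

lemma tower_directed:
  assumes "tower G K M" "tower G K N"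
  shows "\<exists>N'. tower G K N' \<and> N \<subseteq> N' \<and> M \<subseteq> N'"
  using tower_join[OF assms(1) subfield_axioms order_refl assms(2)] .

lemma tame_closure_base: "K \<subseteq> tame_closure G K"
  unfolding tame_closure_def using tower.base by blast

lemma tame_closure_mono:
  assumes "subfield F R" "K \<subseteq> F"
  shows "tame_closure G K \<subseteq> tame_closure G F"
proof
  fix x assume "x \<in> tame_closure G K"
  then obtain M where M: "tower G K M" "x \<in> M" unfolding tame_closure_def by blast
  from tower_join[OF M(1) assms tower.base] M(2) show "x \<in> tame_closure G F"
    unfolding tame_closure_def by blast
qed

lemma tame_closure_finite_subset:
  assumes "finite S" "S \<subseteq> tame_closure G K"
  shows "\<exists>M. tower G K M \<and> S \<subseteq> M"
  using assms
proof (induction S rule: finite_induct)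
  case empty
  then show ?case using tower.base by blast
next
  case (insert x S)
  then obtain M where M: "tower G K M" "S \<subseteq> M" by blast
  obtain N where N: "tower G K N" "x \<in> N" using insert.prems unfolding tame_closure_def by blast
  from tower_directed[OF M(1) N(1)] M(2) N(2) show ?case by blast
qed

lemma tame_closure_subfield: "subfield (tame_closure G K) R"
proof -
  have two: "\<exists>M. tower G K M \<and> subfield M R \<and> x \<in> M \<and> y \<in> M" if "x \<in> tame_closure G K" "y \<in> tame_closure G K" for x y
    using tame_closure_finite_subset[of "{x, y}" G] tower_props that by blast
  have up: "z \<in> tame_closure G K" if "tower G K M" "z \<in> M" for z M
    using that unfolding tame_closure_def by blast
  show ?thesis
  proof (rule subfieldI'[OF subringI])
    show "tame_closure G K \<subseteq> carrier R"
    proof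
      fix x assume x: "x \<in> tame_closure G K"
      from two[OF x x] show "x \<in> carrier R" using subfield_closed(1) by blast
    qed
    show "\<one> \<in> tame_closure G K" using tame_closure_base subfield_closed(3)[OF subfield_axioms] by blast
    fix x assume x: "x \<in> tame_closure G K"
    from two[OF x x] obtain M where M: "tower G K M" "subfield M R" "x \<in> M" by blast
    show "\<ominus> x \<in> tame_closure G K" using up[OF M(1) subfield_closed(4)[OF M(2,3)]] .
    fix y assume y: "y \<in> tame_closure G K"
    from two[OF x y] obtain N where N: "tower G K N" "subfield N R" "x \<in> N" "y \<in> N" by blast
    show "x \<otimes> y \<in> tame_closure G K" using up[OF N(1) subfield_closed(6)[OF N(2,3,4)]] .
    show "x \<oplus> y \<in> tame_closure G K" using up[OF N(1) subfield_closed(5)[OF N(2,3,4)]] .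
  next
    fix x assume x: "x \<in> tame_closure G K - {\<zero>}"
    then obtain M where M: "tower G K M" "subfield M R" "x \<in> M" using two[of x x] by blast
    show "inv x \<in> tame_closure G K" using up[OF M(1) subfield_closed(7)[OF M(2,3)]] x by blast
  qed
qed

lemma well_separated_in_tame_closure:
  assumes "tower G K M" "well_separated M a" "v a \<in> G"
  shows "a \<in> tame_closure G K"
proof -
  have "a \<in> simple_extension M a"
    using simple_extension_mem[OF subfieldE(1)] tower_props[OF assms(1)] assms(2) by (simp add: well_separated_def)
  then show ?thesis using tower.step[OF assms] unfolding tame_closure_def by blast
qed

lemma radical_in_tame_closure:
  assumes "z \<in> carrier R" "z \<noteq> \<zero>" "\<not> ring_char \<kappa> dvd n" "z [^] n \<in> tame_closure UNIV K"
  shows "z \<in> tame_closure UNIV K"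
proof -
  obtain M where M: "tower UNIV K M" "z [^] n \<in> M" using assms(4) unfolding tame_closure_def by blast
  have "subfield M R" using tower_props[OF M(1)] by blast
  then show ?thesis
    using well_separated_in_tame_closure[OF M(1) radical_well_separated[OF _ assms(3,1,2) M(2)]] by simp
qed

lemma finite_extension_in_tower:
  assumes "subfield E R" "K \<subseteq> E" "finite_dimension K E" "E \<subseteq> tame_closure G K"
  shows "\<exists>M. tower G K M \<and> E \<subseteq> M"
proof -
  obtain n where "dimension n K E" using assms(3) by (rule finite_dimensionE')
  then obtain Us where Us: "set Us \<subseteq> carrier R" "Span K Us = E"
    using exists_base[OF subfield_axioms] by blast
  have "set Us \<subseteq> E" using Span_base_incl[OF subfield_axioms Us(1)] Us(2) by simp
  then obtain M where M: "tower G K M" "set Us \<subseteq> M"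
    using tame_closure_finite_subset[of "set Us" G] assms(4) by blast
  have sM: "subfield M R" "K \<subseteq> M" using tower_props[OF M(1)] by blast+
  have "subalgebra K M R" by (rule subfield_subalgebra[OF subfield_axioms sM])
  from subalgebra_Span_incl[OF subfield_axioms this M(2)] show ?thesis using M(1) Us(2) by blast
qed

text \<open>
  A finite subextension lies in a tower, and defectlessness and the divisibility property of the
  ramification index pass to intermediate fields.
\<close>

theorem tame_closure_extension:
  assumes "subfield E R" "K \<subseteq> E" "finite_dimension K E" "E \<subseteq> tame_closure G K"
  shows "defectless R v K E" "\<not> ring_char \<kappa> dvd ramification_index R v K E"
    "G \<subseteq> vals K \<Longrightarrow> vals E = vals K"
proof -
  obtain M where M: "tower G K M" "E \<subseteq> M" using finite_extension_in_tower[OF assms] by blast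
  have t: "subfield M R" "finite_dimension K M" "defectless R v K M"
    "\<not> ring_char \<kappa> dvd ramification_index R v K M" "G \<subseteq> vals K \<Longrightarrow> ramification_index R v K M = 1"
    using tower_props[OF M(1)] by blast+
  note dt = degree_tower[OF subfield_axioms assms(1) t(1) assms(2) M(2) t(2)]
  show "defectless R v K E" using dt(3) t(3) by simp
  show "\<not> ring_char \<kappa> dvd ramification_index R v K E" using dt(1) t(4) by (metis dvd_mult2)
  assume "G \<subseteq> vals K"
  then have "ramification_index R v K E = 1" using dt(1) t(5) by simp
  then show "vals E = vals K"
    using gindex_eq_1_iff[OF vals_is_subgrp[OF subfield_axioms] vals_is_subgrp[OF assms(1)] vals_mono[OF assms(2)]]
    by (simp add: ramification_index_eq)
qed

end


section \<open>Tame and unramified extensions over a perfect residue field\<close>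

locale perfect_henselian_field = henselian_field R v K
  for R (structure) and v :: "'a \<Rightarrow> 'g::linordered_ab_group_add" and K +
  assumes perfect_residue: "perfect_subfield \<kappa> (resf K)"
begin

lemma residue_separable:
  assumes "subfield F R" "K \<subseteq> F" "\<alpha> \<in> carrier \<kappa>"
  shows "separable_element \<kappa> (resf F) \<alpha>"
proof -
  obtain x where x: "x \<in> \<O>" "\<alpha> = res x" using assms(3) carrier_\<kappa> by auto
  have "(k.algebraic over (resf K)) \<alpha>"
    using residue_algebraic[OF subfield_axioms x(1) algebraic_extension] x \<O>_carrier by blast
  then have "separable_element \<kappa> (resf K) \<alpha>"
    using k.separable_over_perfect[OF perfect_residue assms(3)] by blast
  then show ?thesis
    using k.separable_mono[OF resf_subfield[OF subfield_axioms] resf_subfield[OF assms(1)] resf_mono[OF assms(2)] assms(3)]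
    by blast
qed

text \<open>
  Residues lift to well separated units over \<open>K\<close>, which belong to every intermediate field having
  this residue by Krasner's lemma.
\<close>

lemma residue_lift:
  assumes "subfield E R" "K \<subseteq> E" "\<alpha> \<in> resf E" "\<alpha> \<noteq> \<zero>\<^bsub>\<kappa>\<^esub>" "0 \<in> G"
  obtains a where "a \<in> E" "a \<in> tame_closure G K" "a \<in> \<O>" "v a = 0" "res a = \<alpha>" "a \<noteq> \<zero>"
proof -
  interpret E: henselian_field R v E by (rule henselian_intermediate[OF assms(1,2)])
  obtain u where u: "u \<in> E" "u \<in> \<O>" "\<alpha> = res u"
    using assms(3) subfield_closed(1)[OF assms(1)] by (rule resf_memE)
  have "\<alpha> \<in> carrier \<kappa>" using u by simp
  from separable_residue_lift[OF subfield_axioms this residue_separable[OF subfield_axioms order_refl this] assms(4)]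
  obtain a where a: "well_separated K a" "a \<in> \<O>" "v a = 0" "res a = \<alpha>" .
  have "above (v a) (u \<ominus> a)"
    using res_eq_iff[of u a] u a \<O>_carrier by simp
  then have "a \<in> E"
    using E.well_separated_mem[OF well_separated_mono[OF subfield_axioms assms(1,2) a(1)] u(1)] by blast
  moreover have "a \<in> tame_closure G K"
    using well_separated_in_tame_closure[OF tower.base a(1)] a(3) assms(5) by simp
  moreover have "a \<noteq> \<zero>" using a(1) by (simp add: well_separated_def)
  ultimately show ?thesis using that a by blast
qed

lemma residue_tame_part:
  assumes "subfield E R" "K \<subseteq> E" "0 \<in> G"
  shows "resf (E \<inter> tame_closure G K) = resf E"
proof
  show "resf (E \<inter> tame_closure G K) \<subseteq> resf E" by (rule resf_mono) blast
  show "resf E \<subseteq> resf (E \<inter> tame_closure G K)"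
  proof
    fix \<alpha> assume \<alpha>: "\<alpha> \<in> resf E"
    show "\<alpha> \<in> resf (E \<inter> tame_closure G K)"
    proof (cases "\<alpha> = \<zero>\<^bsub>\<kappa>\<^esub>")
      case True
      have "\<zero> \<in> E \<inter> tame_closure G K"
        using subfield_closed(2)[OF assms(1)] subfield_closed(2)[OF tame_closure_subfield] by blast
      from resf_memI[OF this] show ?thesis using True by (simp add: res_zero)
    next
      case False
      from residue_lift[OF assms(1,2) \<alpha> False assms(3)] obtain a
        where "a \<in> E" "a \<in> tame_closure G K" "a \<in> \<O>" "res a = \<alpha>" by blast
      then show ?thesis using resf_memI[of a] by blast
    qed
  qed
qed

text \<open>
  If \<open>y\<^sup>n\<close> and \<open>c\<close> agree up to a unit, the unit is replaced by a unit of the tame part with the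
  same residue. Then \<open>y\<close> is close to an \<open>n\<close>-th root of an element of the tame part, and by Krasner's
  lemma this root belongs to \<open>E\<close>.
\<close>

lemma values_tame_part:
  assumes "subfield E R" "K \<subseteq> E" "g \<in> vals E" "\<not> ring_char \<kappa> dvd n"
    and "nmult n g \<in> vals (E \<inter> tame_closure UNIV K)"
  shows "g \<in> vals (E \<inter> tame_closure UNIV K)"
proof -
  define M where "M = E \<inter> tame_closure UNIV K"
  interpret E: henselian_field R v E by (rule henselian_intermediate[OF assms(1,2)])
  note Ec = subfield_closed[OF assms(1)] and n = add_pow_one_residue[OF assms(4)]
  have M: "subfield M R" unfolding M_def using inter_subfield[OF assms(1) tame_closure_subfield] .
  note Mc = subfield_closed[OF M]
  obtain y where y: "y \<in> E" "y \<noteq> \<zero>" "v y = g" by (rule valsE[OF assms(3)])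
  obtain c where c: "c \<in> M" "c \<noteq> \<zero>" "v c = nmult n g" unfolding M_def by (rule valsE[OF assms(5)])
  have yc: "y \<in> carrier R" and cc: "c \<in> carrier R" and cE: "c \<in> E" using y(1) Ec(1) c(1) Mc(1) M_def by auto
  note ic = inv_nonzero[OF cc c(2)]
  define u where "u = y [^] n \<otimes> inv c"
  have u: "u \<in> E" unfolding u_def by (rule Ec(6)[OF Ec(9)[OF y(1)] Ec(7)[OF cE c(2)]])
  have u': "u \<in> carrier R" "u \<noteq> \<zero>" "v u = 0" unfolding u_def using ic yc y cc c by (simp_all add: integral_iff)
  then have uO: "u \<in> \<O>" by (simp add: mem_\<O>)
  from residue_lift[OF assms(1,2) resf_memI[OF u uO] res_inv'(2)[OF u'] UNIV_I]
  obtain a where a: "a \<in> E" "a \<in> tame_closure UNIV K" "a \<in> \<O>" "v a = 0" "res a = res u" "a \<noteq> \<zero>" .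
  have aM: "a \<in> M" and ac: "a \<in> carrier R" using a(1,2) M_def a(3) \<O>_carrier by auto
  note ia = inv_nonzero[OF ac a(6)]
  define d where "d = u \<otimes> inv a"
  have d: "d \<in> carrier R" "d \<noteq> \<zero>" "v d = 0" unfolding d_def using u' ia ac a by (simp_all add: integral_iff)
  then have dO: "d \<in> \<O>" by (simp add: mem_\<O>)
  have "res d = res u \<otimes>\<^bsub>\<kappa>\<^esub> res (inv a)" unfolding d_def using res_mult[OF uO res_inv(1)[OF ac a(6,4)]] .
  then have rd: "res d = res \<one>" using res_inv(2)[OF ac a(6,4)] a(5) by (simp add: res_one)
  let ?p = "radical_poly n d"
  note p = radical_poly_basic[OF carrier_is_subfield d(1) n(3)]
  have pe: "eval ?p x = x [^] n \<ominus> d" if "x \<in> carrier R" for x using eval_radical_poly[OF d(1) n(3) that] .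
  have pO: "set ?p \<subseteq> \<O>" using dO by (auto simp: radical_poly_def)
  have "above 0 (eval ?p \<one>)" using res_eq_iff[of \<one> d] rd d(1) pe[of \<one>] by (simp add: nat_pow_one)
  moreover have "?p \<noteq> []" using p(3) by auto
  ultimately obtain s where s: "s \<in> zeros ?p" "s \<in> \<O>" "above 0 (\<one> \<ominus> s)"
    using root_lift[OF pO _ p(2) \<O>_closed(2)] by blast
  have sc: "s \<in> carrier R" using s(1) by (simp add: zeros_def)
  have sn: "s [^] n = d" using s(1) pe[OF sc] d(1) sc by (simp add: zeros_def)
  have s0: "s \<noteq> \<zero>" using sn d(2) n(3) by (auto simp: nat_pow_zero)
  have vs: "v s = 0"
    using v_eq_of_diff(2)[of \<one> s] s(3) sc above_minus[of "\<one> \<ominus> s" 0] 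
    by (simp add: minus_eq minus_add a_comm)
  note invs = inv_nonzero[OF sc s0]
  \<comment> \<open>\<open>z\<^sup>n = c a\<close> lies in the tame part, and \<open>z\<close> differs from \<open>y\<close> by a factor of residue one\<close>
  define z where "z = y \<otimes> inv s"
  have z: "z \<in> carrier R" "z \<noteq> \<zero>" "v z = g" unfolding z_def using yc y invs sc s0 vs by (simp_all add: integral_iff)
  have "z \<otimes> s = y" unfolding z_def using yc sc invs by (simp add: m_assoc)
  then have "z [^] n \<otimes> d = y [^] n" using nat_pow_distrib[OF z(1) sc, of n] sn by simp
  also have "\<dots> = c \<otimes> a \<otimes> d"
  proof -
    have "p \<otimes> q \<otimes> (r \<otimes> s \<otimes> t) = r \<otimes> (p \<otimes> s) \<otimes> (q \<otimes> t)"
      if "p \<in> carrier R" "q \<in> carrier R" "r \<in> carrier R" "s \<in> carrier R" "t \<in> carrier R" for p q r s t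
      using that by (simp add: m_ac)
    from this[of c a "y [^] n" "inv c" "inv a"] show ?thesis
      unfolding d_def u_def using cc ac yc ic ia by simp
  qed
  finally have zn: "z [^] n = c \<otimes> a" using m_rcancel[OF d(2,1)] z(1) cc ac by simp
  have caM: "z [^] n \<in> M" unfolding zn using Mc(6)[OF c(1) aM] .
  have "above (v z) (y \<ominus> z)"
  proof -
    have "(s \<ominus> \<one>) \<otimes> z = s \<otimes> z \<ominus> z" using z(1) sc by (simp add: minus_eq l_distr l_minus)
    then have "y \<ominus> z = (s \<ominus> \<one>) \<otimes> z" using \<open>z \<otimes> s = y\<close> m_comm[OF z(1) sc] by simp
    moreover have "above 0 (s \<ominus> \<one>)" 
      using above_minus[of "\<one> \<ominus> s" 0] s(3) sc by (simp add: minus_eq minus_add a_comm)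
    ultimately show ?thesis using above_mult[of "s \<ominus> \<one>" z 0] z sc by simp
  qed
  moreover have "z [^] n \<in> E" using caM by (simp add: M_def)
  ultimately have "z \<in> E"
    using E.well_separated_mem[OF radical_well_separated[OF assms(1,4) z(1,2)] y(1)] by blast
  moreover have "z \<in> tame_closure UNIV K"
    using radical_in_tame_closure[OF z(1,2) assms(4)] caM by (simp add: M_def)
  ultimately show ?thesis using z(2,3) by blast
qed

text \<open>
  Let \<open>M\<close> be the part of \<open>E\<close> in the closure. The residue fields of \<open>M\<close> and \<open>E\<close> coincide, and so do their
  values because \<open>e(E / M)\<close> is prime to the residue characteristic. Since \<open>E / M\<close> is defectless, it is
  trivial.
\<close>

theorem tame_extension_subset_closure:
  assumes "tame_extension R v K E" "finite_dimension K E"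
  shows "E \<subseteq> tame_closure UNIV K"
proof -
  have E: "subfield E R" "K \<subseteq> E" using assms(1) by (auto simp: tame_extension_def)
  have t: "ring_char \<kappa> = 0 \<or> \<not> ring_char \<kappa> dvd ramification_index R v K E" "defectless R v K E"
    using assms E unfolding tame_extension_def by blast+
  define M where "M = E \<inter> tame_closure UNIV K"
  have M: "subfield M R" "K \<subseteq> M" "M \<subseteq> E"
    unfolding M_def using inter_subfield[OF E(1) tame_closure_subfield] tame_closure_base E(2) by auto
  note fd = finite_dimension_intermediate[OF subfield_axioms M(1) E(1) M(2,3) assms(2)]
  note dt = degree_tower[OF subfield_axioms M(1) E(1) M(2,3) assms(2)]
  note fi = fundamental_inequality[OF M(1) E(1) M(3) fd(2)]
  have f: "resf M = resf E" unfolding M_def using residue_tame_part[OF E] by simp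
  have "ramification_index R v K E > 0" using fundamental_inequality(2)[OF subfield_axioms E assms(2)] .
  then have "\<not> ring_char \<kappa> dvd ramification_index R v K E" using t(1) by auto
  then have e: "\<not> ring_char \<kappa> dvd ramification_index R v M E" unfolding dt(1) by (metis dvd_mult)
  have "vals E \<subseteq> vals M"
  proof
    fix g assume g: "g \<in> vals E"
    have "nmult (ramification_index R v M E) g \<in> vals M"
      using nmult_gindex_mem[OF vals_is_subgrp[OF M(1)] vals_is_subgrp[OF E(1)] _ g] fi(2)
      by (simp add: ramification_index_eq)
    from values_tame_part[OF E g e, folded M_def, OF this] show "g \<in> vals M" .
  qed
  then have "vals M = vals E" using vals_mono[OF M(3)] by blast
  then have "ramification_index R v M E = 1" "inertia_degree R v M E = 1"
    using trivial_extension(1)[OF E(1)] trivial_extension(2)[OF E(1)] f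
      k.dimI[OF resf_subfield[OF E(1)] k.dimension_one[OF resf_subfield[OF E(1)]]]
    by (simp_all add: ramification_index_eq inertia_degree_def over_def)
  moreover have "defectless R v M E" using dt(3) t(2) by simp
  ultimately have "dim M E = 1" by (simp add: defectless_def)
  then have "M = E" using dim_1_imp_eq[OF M(1,3) fd(2)] by blast
  then show ?thesis unfolding M_def by blast
qed

end


section \<open>The ramification field\<close>

context perfect_henselian_field
begin

lemma residue_algebraic_closure:
  assumes "subfield E R" "K \<subseteq> E"
  shows "algebraic_closure \<kappa> (resf E)"
proof -
  interpret kE: subfield "resf E" \<kappa> by (rule resf_subfield[OF assms(1)])
  show ?thesis
  proof
    show "(k.algebraic over (resf E)) \<alpha>" if "\<alpha> \<in> carrier \<kappa>" for \<alpha>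
      using residue_separable[OF assms that] by (simp add: k.separable_iff_zeros)
    show "k.splitted P" if "P \<in> carrier (univ_poly \<kappa> (resf E))" for P
      using k.roots_over_carrier k.carrier_polynomial_shell[OF subfieldE(1)[OF resf_subfield[OF assms(1)]] that] .
  qed
qed

lemma ring_char_residue:
  assumes "ring_char R \<noteq> 0"
  shows "ring_char \<kappa> = ring_char R"
proof -
  have r: "[m] \<cdot> \<one> \<in> \<O> \<and> res ([m] \<cdot> \<one>) = [m] \<cdot>\<^bsub>\<kappa>\<^esub> \<one>\<^bsub>\<kappa>\<^esub>" for m :: nat
    by (induction m) (simp_all add: res_zero res_add res_one)
  have "[ring_char R] \<cdot> \<one> = \<zero>" by (simp add: add_pow_one_eq_zero_iff)
  then have "[ring_char R] \<cdot>\<^bsub>\<kappa>\<^esub> \<one>\<^bsub>\<kappa>\<^esub> = \<zero>\<^bsub>\<kappa>\<^esub>" using r[of "ring_char R"] by (simp add: res_zero)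
  then have "ring_char \<kappa> dvd ring_char R" by (simp add: k.add_pow_one_eq_zero_iff)
  then show ?thesis
    using prime_ring_char[OF assms] residue_char_not_dvd_1 by (metis dvd_refl prime_nat_iff)
qed

lemma residue_power_inj:
  assumes "s \<in> carrier \<kappa>" "t \<in> carrier \<kappa>" "s [^]\<^bsub>\<kappa>\<^esub> (ring_char \<kappa> ^ k) = t [^]\<^bsub>\<kappa>\<^esub> (ring_char \<kappa> ^ k)" "ring_char \<kappa> \<noteq> 0"
  shows "s = t"
  using assms(3)
proof (induction k)
  case 0
  then show ?case using assms(1,2) by simp
next
  case (Suc k)
  have "(s [^]\<^bsub>\<kappa>\<^esub> (ring_char \<kappa> ^ k)) [^]\<^bsub>\<kappa>\<^esub> ring_char \<kappa> = (t [^]\<^bsub>\<kappa>\<^esub> (ring_char \<kappa> ^ k)) [^]\<^bsub>\<kappa>\<^esub> ring_char \<kappa>"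
    using Suc.prems assms(1,2) by (simp add: k.nat_pow_pow mult.commute)
  then have "s [^]\<^bsub>\<kappa>\<^esub> (ring_char \<kappa> ^ k) = t [^]\<^bsub>\<kappa>\<^esub> (ring_char \<kappa> ^ k)"
    using k.prime_char_pow_inj[OF k.prime_ring_char[OF assms(4)]] assms(1,2) k.add_pow_one_eq_zero_iff by simp
  then show ?case by (rule Suc.IH)
qed

lemma power_char_add:
  assumes "ring_char R \<noteq> 0" "x \<in> carrier R" "y \<in> carrier R"
  shows "(x \<oplus> y) [^] (ring_char R ^ k) = x [^] (ring_char R ^ k) \<oplus> y [^] (ring_char R ^ k)"
proof (induction k)
  case (Suc k)
  have "(x \<oplus> y) [^] (ring_char R ^ Suc k) = ((x \<oplus> y) [^] (ring_char R ^ k)) [^] ring_char R"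
    using assms by (simp add: nat_pow_pow mult.commute)
  also have "\<dots> = (x [^] (ring_char R ^ k)) [^] ring_char R \<oplus> (y [^] (ring_char R ^ k)) [^] ring_char R"
    unfolding Suc using prime_char_add_pow[OF prime_ring_char[OF assms(1)]] assms add_pow_one_eq_zero_iff by simp
  finally show ?case using assms by (simp add: nat_pow_pow mult.commute)
qed (use assms in simp)

text \<open>
  Let \<open>q\<close> be a power of the characteristic with \<open>x\<^sup>q\<close> separable. Over \<open>K(x\<^sup>q)\<close>, the
  extension \<open>K(x)\<close> has trivial residue extension by perfectness and ramification index a power of
  the characteristic; being also tame, it is trivial. Hence \<open>x\<close> has the same degree as \<open>x\<^sup>q\<close>
  and at least as many conjugates.
\<close>

theorem tame_closure_separable:
  assumes "x \<in> tame_closure UNIV K"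
  shows "separable_element R K x"
proof -
  note K = subfield_axioms
  have x: "x \<in> carrier R" using assms subfield_closed(1)[OF tame_closure_subfield] by blast
  obtain k where k: "k = 0 \<or> ring_char R \<noteq> 0" "separable_element R K (x [^] (ring_char R ^ k))"
    using power_char_separable[OF K x algebraic_extension[OF x]] by blast
  define q where "q = ring_char R ^ k"
  show ?thesis
  proof (cases "k = 0")
    case True
    then show ?thesis using k(2) x by simp
  next
    case False
    then have p0: "ring_char R \<noteq> 0" using k(1) by simp
    note p = prime_ring_char[OF p0] and pk = ring_char_residue[OF p0]
    let ?s = "x [^] q"
    have s: "?s \<in> carrier R" using x by simp
    define E where "E = simple_extension K x"
    define F where "F = simple_extension K ?s"
    have E: "subfield E R" "K \<subseteq> E" "x \<in> E" "finite_dimension K E" "dim K E = degree (Irr K x)"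
      unfolding E_def using simple_extension_props[OF K x algebraic_extension[OF x]] by blast+
    have F: "subfield F R" "K \<subseteq> F" "?s \<in> F" "dim K F = degree (Irr K ?s)"
      unfolding F_def using simple_extension_props[OF K s algebraic_extension[OF s]] by blast+
    note Fc = subfield_closed[OF F(1)] and Ec = subfield_closed[OF E(1)]
    have FE: "F \<subseteq> E"
      unfolding F_def by (rule simple_extension_subring_incl[OF subfieldE(1)[OF E(1)] E(2) Ec(9)[OF E(3)]])
    have ET: "E \<subseteq> tame_closure UNIV K"
      unfolding E_def by (rule simple_extension_subring_incl[OF subfieldE(1)[OF tame_closure_subfield] tame_closure_base assms])
    \<comment> \<open>\<open>K(x)\<^sup>q \<subseteq> K(x\<^sup>q)\<close>\<close>
    have pow: "u [^] q \<in> F" if "u \<in> E" for u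
      using that unfolding E_def
    proof (induction rule: simple_extension.induct)
      case zero
      have "q \<noteq> 0" using p0 by (simp add: q_def)
      then show ?case using Fc(2) by (simp add: nat_pow_zero)
    next
      case (lin k1 k2)
      have c: "k1 \<in> carrier R" "k2 \<in> carrier R"
        using lin(1,2) simple_extension_in_carrier[OF subfieldE(3)[OF K] x] subfieldE(3)[OF K] by blast+
      have "(k1 \<otimes> x \<oplus> k2) [^] q = k1 [^] q \<otimes> x [^] q \<oplus> k2 [^] q"
        unfolding q_def using power_char_add[OF p0, of "k1 \<otimes> x" k2 k] c x by (simp add: nat_pow_distrib)
      moreover have "k2 [^] q \<in> F" using Fc(9) lin(2) F(2) by blast
      ultimately show ?case using Fc(5)[OF Fc(6)[OF lin(3) F(3)]] by simp
    qed
    note fd = finite_dimension_intermediate[OF K F(1) E(1) F(2) FE E(4)]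
    note dt = degree_tower[OF K F(1) E(1) F(2) FE E(4)]
    note te = tame_closure_extension[OF E(1,2,4) ET]
    note fi = fundamental_inequality[OF F(1) E(1) FE fd(2)]
    have "resf E \<subseteq> resf F"
    proof
      fix \<alpha> assume "\<alpha> \<in> resf E"
      then obtain u where u: "u \<in> E" "u \<in> \<O>" "\<alpha> = res u" using Ec(1) by (rule resf_memE)
      then have \<alpha>: "\<alpha> \<in> carrier \<kappa>" by simp
      have \<alpha>q: "\<alpha> [^]\<^bsub>\<kappa>\<^esub> q \<in> resf F"
        using resf_memI[OF pow[OF u(1)] \<O>_pow[OF u(2)]] res_pow[OF u(2)] u(3) by simp
      interpret kF: algebraic_closure \<kappa> "resf F" by (rule residue_algebraic_closure[OF F(1,2)])
      show "\<alpha> \<in> resf F"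
      proof (rule kF.fixed_separable_mem[OF residue_separable[OF F(1,2) \<alpha>] \<alpha>])
        fix \<phi> assume \<phi>: "\<phi> \<in> ring_iso \<kappa> \<kappa>" "\<And>c. c \<in> resf F \<Longrightarrow> \<phi> c = c"
        then have "\<phi> \<in> k.Gal (resf F)" by (simp add: k.Gal_def)
        note h = k.Gal_hom[OF this]
        have "(\<phi> \<alpha>) [^]\<^bsub>\<kappa>\<^esub> q = \<alpha> [^]\<^bsub>\<kappa>\<^esub> q" using h(11)[OF \<alpha>, of q] \<phi>(2)[OF \<alpha>q] by simp
        then show "\<phi> \<alpha> = \<alpha>"
          using residue_power_inj[OF h(4)[OF \<alpha>] \<alpha>, of k] p0 unfolding q_def pk by simp
      qed
    qed
    then have rEF: "resf F = resf E" using resf_mono[OF FE] by blast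
    have "vals E \<subseteq> vals F"
    proof
      fix g assume g: "g \<in> vals E"
      then obtain u where u: "u \<in> E" "u \<noteq> \<zero>" "v u = g" by (rule valsE)
      have uc: "u \<in> carrier R" using u(1) Ec(1) by blast
      have 1: "nmult q g \<in> vals F"
        using pow[OF u(1)] v_pow[OF uc u(2), of q] u(3) nat_pow_nonzero[OF uc u(2), of q]
        by (metis DiffI imageI singletonD)
      have 2: "nmult (ramification_index R v F E) g \<in> vals F"
        using nmult_gindex_mem[OF vals_is_subgrp[OF F(1)] vals_is_subgrp[OF E(1)] _ g] fi(2)
        by (simp add: ramification_index_eq)
      have "\<not> ring_char R dvd ramification_index R v F E" using te(2) unfolding dt(1) pk by (metis dvd_mult)
      then have "coprime q (ramification_index R v F E)"
        unfolding q_def using p by (simp add: prime_imp_coprime coprime_power_left_iff)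
      then show "g \<in> vals F" using coprime_nmult_mem[OF vals_is_subgrp[OF F(1)] 1 2] by blast
    qed
    then have vEF: "vals F = vals E" using vals_mono[OF FE] by blast
    have "ramification_index R v F E = 1" "inertia_degree R v F E = 1"
      using vEF rEF trivial_extension(1)[OF E(1)]
        k.dimI[OF resf_subfield[OF E(1)] k.dimension_one[OF resf_subfield[OF E(1)]]]
      by (simp_all add: ramification_index_eq inertia_degree_def over_def)
    moreover have "defectless R v F E" using dt(3) te(1) by simp
    ultimately have "dim F E = 1" by (simp add: defectless_def)
    then have deg: "degree (Irr K x) = degree (Irr K ?s)" using fd(3) E(5) F(4) by simp
    have "zeros (Irr K ?s) \<subseteq> (\<lambda>y. y [^] q) ` zeros (Irr K x)"
    proof
      fix y assume "y \<in> zeros (Irr K ?s)"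
      then obtain \<phi> where \<phi>: "\<phi> \<in> Gal K" "\<phi> ?s = y" using conjugate_Gal[OF s] by blast
      have "\<phi> x \<in> zeros (Irr K x)"
        using Gal_zeros[OF \<phi>(1) Irr_over_base(3)[OF x] subfieldE(3)[OF K] Irr_over_base(1)[OF x]] .
      moreover have "y = (\<phi> x) [^] q" using Gal_hom(11)[OF \<phi>(1) x] \<phi>(2) by simp
      ultimately show "y \<in> (\<lambda>y. y [^] q) ` zeros (Irr K x)" by blast
    qed
    then have "card (zeros (Irr K ?s)) \<le> card (zeros (Irr K x))"
      using surj_card_le[OF Irr_over_base(2)[OF x]] by blast
    moreover have "card (zeros (Irr K ?s)) = degree (Irr K ?s)" using k(2) by (simp add: q_def separable_iff_zeros)
    moreover note card_zeros_le(2)[OF Irr_not_Nil(3,1)[OF K x algebraic_extension[OF x]]]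
    ultimately have "card (zeros (Irr K x)) = degree (Irr K x)" using deg by linarith
    then show ?thesis using algebraic_extension[OF x] by (simp add: separable_iff_zeros)
  qed
qed

text \<open>
  Up to a power \<open>q\<close> of the residue characteristic, every element agrees with an element of the tame
  closure in value and in leading residue; and \<open>q\<close>-th powers are injective on residues.
\<close>

lemma Gal_tame_closure_above:
  assumes "\<phi> \<in> Gal (tame_closure UNIV K)" "y \<in> carrier R" "y \<noteq> \<zero>"
  shows "above (v y) (\<phi> y \<ominus> y)"
proof -
  let ?T = "tame_closure UNIV K"
  note K = subfield_axioms and Ts = tame_closure_subfield[of UNIV]
  note Tc = subfield_closed[OF Ts] and h = Gal_hom[OF assms(1)]
  have \<phi>K: "\<phi> \<in> Gal K" using assms(1) Gal_mono[OF tame_closure_base] by blast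
  define E where "E = simple_extension K y"
  have E: "subfield E R" "K \<subseteq> E" "y \<in> E" "finite_dimension K E"
    unfolding E_def using simple_extension_props[OF K assms(2) algebraic_extension[OF assms(2)]] by blast+
  define N where "N = ramification_index R v K E"
  have N: "N > 0" "nmult N (v y) \<in> vals K"
  proof -
    show "N > 0" unfolding N_def using fundamental_inequality(2)[OF K E(1,2,4)] .
    have "v y \<in> vals E" using E(3) assms(3) by blast
    then show "nmult N (v y) \<in> vals K"
      using nmult_gindex_mem[OF vals_is_subgrp[OF K] vals_is_subgrp[OF E(1)]] \<open>N > 0\<close>
      unfolding N_def ramification_index_eq by blast
  qed
  \<comment> \<open>split off from \<open>N\<close> the largest power \<open>q\<close> of the residue characteristic\<close>
  obtain q n where qn: "N = n * q" "\<not> ring_char \<kappa> dvd n"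
    and q: "\<And>s. s \<in> carrier \<kappa> \<Longrightarrow> s [^]\<^bsub>\<kappa>\<^esub> q = \<one>\<^bsub>\<kappa>\<^esub> \<Longrightarrow> s = \<one>\<^bsub>\<kappa>\<^esub>"
  proof (cases "ring_char \<kappa> = 0")
    case True
    show ?thesis by (rule that[of N 1]) (use N(1) True in auto)
  next
    case False
    note p = k.prime_ring_char[OF False]
    have "\<not> is_unit (ring_char \<kappa>)" using p by (metis not_prime_unit)
    then obtain n where n: "N = ring_char \<kappa> ^ multiplicity (ring_char \<kappa>) N * n" "\<not> ring_char \<kappa> dvd n"
      using multiplicity_decompose'[of N "ring_char \<kappa>"] N(1) by blast
    show ?thesis
    proof (rule that[of n "ring_char \<kappa> ^ multiplicity (ring_char \<kappa>) N"])
      show "N = n * ring_char \<kappa> ^ multiplicity (ring_char \<kappa>) N" using n(1) by (simp add: mult.commute)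
      fix s assume "s \<in> carrier \<kappa>" "s [^]\<^bsub>\<kappa>\<^esub> (ring_char \<kappa> ^ multiplicity (ring_char \<kappa>) N) = \<one>\<^bsub>\<kappa>\<^esub>"
      then show "s = \<one>\<^bsub>\<kappa>\<^esub>"
        using residue_power_inj[of s "\<one>\<^bsub>\<kappa>\<^esub>" "multiplicity (ring_char \<kappa>) N"] False by (simp add: k.nat_pow_one)
    qed (rule n(2))
  qed
  define Y where "Y = y [^] q"
  have Y: "Y \<in> carrier R" "Y \<noteq> \<zero>" "v Y = nmult q (v y)" using assms(2,3) by (simp_all add: Y_def)
  have KR: "K \<subseteq> carrier R" using subfieldE(3)[OF K] .
  have inT: "carrier R \<inter> ?T = ?T" using Tc(1) by blast
  have "nmult n (v Y) \<in> vals ?T"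
    unfolding Y(3) nmult_mult[symmetric] qn(1)[symmetric] using N(2) vals_mono[OF tame_closure_base] by blast
  moreover have "v Y \<in> vals (carrier R)" using Y(1,2) by blast
  ultimately have "v Y \<in> vals ?T"
    using values_tame_part[OF carrier_is_subfield KR _ qn(2), of "v Y"] unfolding inT by blast
  then obtain w where w: "w \<in> ?T" "w \<noteq> \<zero>" "v w = v Y" by (rule valsE)
  have wc: "w \<in> carrier R" using w(1) Tc(1) by blast
  note iw = inv_nonzero[OF wc w(2)]
  define u where "u = Y \<otimes> inv w"
  have u: "u \<in> carrier R" "u \<noteq> \<zero>" "v u = 0" unfolding u_def using Y iw wc w by (simp_all add: integral_iff)
  then have uO: "u \<in> \<O>" by (simp add: mem_\<O>)
  from residue_lift[OF carrier_is_subfield KR _ res_inv'(2)[OF u] UNIV_I] uO resf_carrier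
  obtain a where a: "a \<in> ?T" "a \<in> \<O>" "v a = 0" "res a = res u" "a \<noteq> \<zero>" by (metis res_closed)
  have ac: "a \<in> carrier R" using a(2) \<O>_carrier by blast
  note ia = inv_nonzero[OF ac a(5)]
  define t where "t = u \<otimes> inv a"
  have t: "t \<in> carrier R" "t \<noteq> \<zero>" "v t = 0" unfolding t_def using u ia ac a by (simp_all add: integral_iff)
  have rt: "res t = res \<one>"
    unfolding t_def using res_mult[OF uO res_inv(1)[OF ac a(5,3)]] res_inv(2)[OF ac a(5,3)] a(4) by (simp add: res_one)
  define W where "W = w \<otimes> a"
  have W: "W \<in> ?T" "W \<in> carrier R" "W \<noteq> \<zero>" unfolding W_def using Tc(6)[OF w(1) a(1)] wc ac w(2) a(5) by (simp_all add: integral_iff)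
  have YW: "Y = W \<otimes> t"
  proof -
    have "w \<otimes> a \<otimes> (Y \<otimes> s \<otimes> r) = Y \<otimes> (w \<otimes> s) \<otimes> (a \<otimes> r)" if "s \<in> carrier R" "r \<in> carrier R" for s r
      using that wc ac Y(1) by (simp add: m_ac)
    from this[of "inv w" "inv a"] show ?thesis unfolding W_def t_def u_def using iw ia Y(1) by simp
  qed
  have "above 0 (t \<ominus> \<one>)" using res_eq_iff[of t \<one>] rt t(1) by simp
  then have "above 0 (\<phi> t \<ominus> \<one>)"
    using above_Gal[OF \<phi>K, of "t \<ominus> \<one>" 0] h(10)[of t \<one>] h(7) t(1) by simp
  then have r\<phi>t: "res (\<phi> t) = res \<one>" using res_eq_iff[of "\<phi> t" \<one>] h(4)[OF t(1)] by simp
  note iy = inv_nonzero[OF assms(2,3)]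
  define s where "s = \<phi> y \<otimes> inv y"
  have fy: "\<phi> y \<in> carrier R" "\<phi> y \<noteq> \<zero>" "v (\<phi> y) = v y"
    using h(4,9)[OF assms(2)] assms(3) v_Gal[OF \<phi>K assms(2,3)] by auto
  have s: "s \<in> carrier R" "s \<noteq> \<zero>" "v s = 0" unfolding s_def using fy iy assms by (simp_all add: integral_iff)
  have sO: "s \<in> \<O>" "t \<in> \<O>" using s t by (simp_all add: mem_\<O>)
  have sy: "s \<otimes> y = \<phi> y" unfolding s_def using fy iy assms(2) by (simp add: m_assoc)
  \<comment> \<open>\<open>y\<^sup>q = W t\<close> with \<open>W\<close> fixed by \<open>\<phi>\<close> and \<open>t\<close> of residue one\<close>
  have "s [^] q \<otimes> t = \<phi> t"
  proof -
    have "s [^] q \<otimes> Y = \<phi> Y"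
      unfolding Y_def using nat_pow_distrib[OF s(1) assms(2), of q] sy h(11)[OF assms(2)] by simp
    also have "\<dots> = W \<otimes> \<phi> t" unfolding YW using h(5)[OF W(2) t(1)] h(12)[OF W(1)] by simp
    finally have "W \<otimes> (s [^] q \<otimes> t) = W \<otimes> \<phi> t"
      unfolding YW using W(2) t(1) s(1) by (simp add: m_lcomm)
    then show ?thesis using m_lcancel[OF W(3,2)] s(1) t(1) h(4)[OF t(1)] by simp
  qed
  then have "res (s [^] q) \<otimes>\<^bsub>\<kappa>\<^esub> res t = res (\<phi> t)" using res_mult[OF \<O>_pow[OF sO(1)] sO(2), of q] by simp
  then have "res s [^]\<^bsub>\<kappa>\<^esub> q = \<one>\<^bsub>\<kappa>\<^esub>" using rt r\<phi>t res_pow[OF sO(1), of q] sO(1) by (simp add: res_one)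
  then have "res s = \<one>\<^bsub>\<kappa>\<^esub>" using q[OF res_closed[OF sO(1)]] by blast
  then have "above 0 (s \<ominus> \<one>)" using res_eq_iff[of s \<one>] s(1) by (simp add: res_one)
  moreover have "(s \<ominus> \<one>) \<otimes> y = \<phi> y \<ominus> y"
    using sy s(1) assms(2) by (simp add: minus_eq l_distr l_minus)
  ultimately show ?thesis using above_mult[of "s \<ominus> \<one>" y 0] s(1) assms(2,3) by simp
qed

text \<open>
  The defining inequality of the ramification group concerns integral elements. For the others it
  follows from that for \<open>1 / x\<close>, as \<open>\<phi> x - x = - (\<phi> (1 / x) - 1 / x) x \<phi> x\<close>.
\<close>

lemma ramification_group_above:
  assumes "\<phi> \<in> ramification_group R v K" "x \<in> carrier R" "x \<noteq> \<zero>"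
  shows "\<phi> \<in> Gal K" "above (v x) (\<phi> x \<ominus> x)"
proof -
  show \<phi>: "\<phi> \<in> Gal K" using assms(1) by (auto simp: ramification_group_def Gal_def)
  have int: "above (v z) (\<phi> z \<ominus> z)" if "z \<in> \<O>" "z \<noteq> \<zero>" for z
    using assms(1) that unfolding ramification_group_def above_def by blast
  note h = Gal_hom[OF \<phi>]
  show "above (v x) (\<phi> x \<ominus> x)"
  proof (cases "x \<in> \<O>")
    case True
    then show ?thesis using int assms(3) by blast
  next
    case False
    then have "v x < 0" using assms(2,3) by (auto simp: mem_\<O>)
    note i = inv_nonzero[OF assms(2,3)]
    have iO: "inv x \<in> \<O>" using i \<open>v x < 0\<close> assms(2,3) by (simp add: mem_\<O>)
    let ?y = "\<phi> x"
    have y: "?y \<in> carrier R" "?y \<noteq> \<zero>" "v ?y = v x" using h(4,9)[OF assms(2)] assms(3) v_Gal[OF \<phi> assms(2,3)] by auto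
    note iy = inv_nonzero[OF y(1,2)]
    have "above (v (inv x)) (inv ?y \<ominus> inv x)" using int[OF iO] i Gal_inv[OF \<phi> assms(2,3)] by simp
    then have "above (v (inv x) + v (x \<otimes> ?y)) ((inv ?y \<ominus> inv x) \<otimes> (x \<otimes> ?y))"
      using above_mult[of "inv ?y \<ominus> inv x" "x \<otimes> ?y" "v (inv x)"] i iy y assms(2,3) by (simp add: integral_iff)
    moreover have "(inv ?y \<ominus> inv x) \<otimes> (x \<otimes> ?y) = \<ominus> (?y \<ominus> x)"
    proof -
      have "inv ?y \<otimes> (x \<otimes> ?y) = x" using m_lcomm[of "inv ?y" x ?y] iy assms(2) y(1) by simp
      moreover have "inv x \<otimes> (x \<otimes> ?y) = ?y" using i assms(2) y(1) by (simp add: m_assoc[symmetric])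
      ultimately have "(inv ?y \<ominus> inv x) \<otimes> (x \<otimes> ?y) = x \<ominus> ?y"
        using i iy assms(2) y(1) by (simp add: minus_eq l_distr l_minus)
      then show ?thesis using assms(2) y(1) by (simp add: minus_eq minus_add a_comm)
    qed
    ultimately show ?thesis using y assms(2,3) by simp
  qed
qed

text \<open>
  An element of the ramification group fixing \<open>M\<close> maps a well separated generator \<open>a\<close> to a conjugate
  closer to \<open>a\<close> than any other conjugate can be.
\<close>

lemma ramification_group_fixes_tower:
  assumes "\<phi> \<in> ramification_group R v K" "tower G K M" "x \<in> M"
  shows "\<phi> x = x"
  using assms(2,3)
proof (induction arbitrary: x rule: tower.induct)
  case base
  then show ?case using assms(1) by (auto simp: ramification_group_def)
next
  case (step M a)
  have a: "a \<in> carrier R" "a \<noteq> \<zero>" using step(2) by (auto simp: well_separated_def)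
  have M: "subfield M R" "K \<subseteq> M" using tower_props[OF step(1)] by blast+
  interpret M: henselian_field R v M by (rule henselian_intermediate[OF M])
  note ra = ramification_group_above[OF assms(1) a]
  note h = Gal_hom[OF ra(1)]
  have "\<phi> \<in> Gal M" using ra(1) step.IH by (simp add: Gal_def)
  then have "\<phi> a \<in> zeros (Irr M a)"
    using Gal_zeros[OF _ M.Irr_over_base(3)[OF a(1)] subfieldE(3)[OF M(1)] M.Irr_over_base(1)[OF a(1)]] by blast
  then have fa: "\<phi> a = a" using step(2) ra(2) unfolding well_separated_def by blast
  show ?case
    using step.prems
  proof (induction rule: simple_extension.induct)
    case zero
    then show ?case using h(8) .
  next
    case (lin k1 k2)
    have "k1 \<in> carrier R" "k2 \<in> carrier R"
      using lin(1,2) simple_extension_in_carrier[OF subfieldE(3)[OF M(1)] a(1)] subfieldE(3)[OF M(1)] by blast+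
    then show ?case using h(5)[of k1 a] h(6)[of "k1 \<otimes> a" k2] lin(3) fa step.IH[OF lin(2)] a(1) by simp
  qed
qed

text \<open>
  The ramification group consists precisely of the automorphisms over the tame closure, so its fixed
  field in the separable closure is the tame closure by Galois theory.
\<close>

theorem ramification_field_eq_tame_closure:
  "ramification_field R v K = tame_closure UNIV K"
proof
  let ?T = "tame_closure UNIV K"
  note Ts = tame_closure_subfield[of UNIV]
  show "?T \<subseteq> ramification_field R v K"
  proof
    fix x assume x: "x \<in> ?T"
    then obtain M where "tower UNIV K M" "x \<in> M" unfolding tame_closure_def by blast
    then have "\<forall>\<phi>\<in>ramification_group R v K. \<phi> x = x" using ramification_group_fixes_tower by blast
    then show "x \<in> ramification_field R v K"
      unfolding ramification_field_def using tame_closure_separable[OF x] subfield_closed(1)[OF Ts] x by blast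
  qed
  show "ramification_field R v K \<subseteq> ?T"
  proof
    fix x assume "x \<in> ramification_field R v K"
    then have x: "x \<in> carrier R" "separable_element R K x" "\<And>\<phi>. \<phi> \<in> ramification_group R v K \<Longrightarrow> \<phi> x = x"
      by (auto simp: ramification_field_def)
    interpret T: henselian_field R v ?T by (rule henselian_intermediate[OF Ts tame_closure_base])
    show "x \<in> ?T"
    proof (rule T.fixed_separable_mem[OF separable_mono[OF subfield_axioms Ts tame_closure_base x(1,2)] x(1)])
      fix \<phi> assume \<phi>: "\<phi> \<in> ring_iso R R" "\<And>c. c \<in> ?T \<Longrightarrow> \<phi> c = c"
      then have g: "\<phi> \<in> Gal ?T" by (simp add: Gal_def)
      have "\<phi> \<in> ramification_group R v K"
        unfolding ramification_group_def
      proof (intro CollectI conjI ballI)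
        show "\<phi> c = c" if "c \<in> K" for c using \<phi>(2) tame_closure_base that by blast
        fix y assume "y \<in> \<O> - {\<zero>}"
        then have "above (v y) (\<phi> y \<ominus> y)" using Gal_tame_closure_above[OF g] \<O>_carrier by blast
        then show "\<phi> y \<ominus> y = \<zero> \<or> v y < v (\<phi> y \<ominus> y)" by (simp add: above_def)
      qed (rule \<phi>(1))
      then show "\<phi> x = x" by (rule x(3))
    qed
  qed
qed

lemma tame_extension_of_subset_closure:
  assumes "subfield F R" "subfield E R" "K \<subseteq> F" "F \<subseteq> E" "finite_dimension F E" "E \<subseteq> tame_closure UNIV F"
  shows "tame_extension R v F E"
  unfolding tame_extension_def
proof (intro conjI allI impI ballI)
  interpret F: henselian_field R v F by (rule henselian_intermediate[OF assms(1,3)])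
  show "ring.algebraic R F x" if "x \<in> E" for x
    using F.algebraic_extension[of x] that subfield_closed(1)[OF assms(2)] by (auto simp: over_def)
  fix E' assume "subfield E' R \<and> F \<subseteq> E' \<and> E' \<subseteq> E \<and> ring.finite_dimension R F E'"
  then have E': "subfield E' R" "F \<subseteq> E'" "E' \<subseteq> E" "finite_dimension F E'" by blast+
  note te = F.tame_closure_extension[OF E'(1,2,4) subset_trans[OF E'(3) assms(6)]]
  show "ring_char \<kappa> = 0 \<or> \<not> ring_char \<kappa> dvd ramification_index R v F E'" using te(2) by blast
  show "defectless R v F E'" using te(1) .
  show "separable_extension \<kappa> (resf F) (resf E')"
    unfolding separable_extension_def
    using residue_separable[OF assms(1,3)] resf_mono[OF subfield_closed(1)[OF E'(1)]] by (auto simp: resf_carrier)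
qed (use assms in auto)

text \<open>
  The part of \<open>E\<close> in the closure has the same residue field, since well separated units suffice to lift
  residues, and the same values by assumption; defectlessness then leaves no room.
\<close>

lemma unramified_subset_closure:
  assumes "subfield F R" "subfield E R" "K \<subseteq> F" "F \<subseteq> E" "finite_dimension F E" "defectless R v F E" "vals E = vals F"
  shows "E \<subseteq> tame_closure {0} F"
proof -
  interpret F: henselian_field R v F by (rule henselian_intermediate[OF assms(1,3)])
  define M where "M = E \<inter> tame_closure {0} F"
  have M: "subfield M R" "F \<subseteq> M" "M \<subseteq> E"
    unfolding M_def using inter_subfield[OF assms(2) F.tame_closure_subfield] F.tame_closure_base assms(4) by auto
  note fd = finite_dimension_intermediate[OF assms(1) M(1) assms(2) M(2,3) assms(5)]
  have "resf E = resf (E \<inter> tame_closure {0} K)"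
    using residue_tame_part[OF assms(2) subset_trans[OF assms(3,4)], of "{0}"] by simp
  also have "\<dots> \<subseteq> resf M" unfolding M_def using tame_closure_mono[OF assms(1,3)] by (intro resf_mono) blast
  finally have f: "resf M = resf E" using resf_mono[OF M(3)] by blast
  have "vals M = vals E" using vals_mono[OF M(2)] vals_mono[OF M(3)] assms(7) by blast
  then have "ramification_index R v M E = 1" "inertia_degree R v M E = 1"
    using trivial_extension(1)[OF assms(2)] f
      k.dimI[OF resf_subfield[OF assms(2)] k.dimension_one[OF resf_subfield[OF assms(2)]]]
    by (simp_all add: ramification_index_eq inertia_degree_def over_def)
  moreover have "defectless R v M E"
    using degree_tower(3)[OF assms(1) M(1) assms(2) M(2,3) assms(5)] assms(6) by simp
  ultimately have "dim M E = 1" by (simp add: defectless_def)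
  then have "M = E" using dim_1_imp_eq[OF M(1,3) fd(2)] by simp
  then show ?thesis unfolding M_def by blast
qed

end


section \<open>Primitive elements\<close>

text \<open>
  For infinite \<open>K\<close>, choose \<open>\<theta>\<close> of maximal degree; for \<open>y\<close> outside \<open>K(\<theta>)\<close> and all but finitely many
  \<open>c\<close> in \<open>K\<close>, no automorphism fixing \<open>\<theta> + c y\<close> moves \<open>y\<close>, so \<open>\<theta> + c y\<close> generates both. For finite
  \<open>K\<close>, take a generator of the cyclic multiplicative group.
\<close>

theorem (in algebraic_closure) primitive_element:
  assumes "subfield E L" "K \<subseteq> E" "finite_dimension K E" "\<And>x. x \<in> E \<Longrightarrow> separable_element L K x"
  obtains \<theta> where "\<theta> \<in> E" "E = simple_extension K \<theta>"
proof (cases "finite K")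
  case True
  note K = subfield_axioms
  interpret E: field "L\<lparr>carrier := E\<rparr>" using subfield_iff(2)[OF assms(1)] .
  have "finite (carrier (L\<lparr>carrier := E\<rparr>))" using finite_dimension_over_finite[OF K True assms(3)] by simp
  from bexE[OF E.finite_field_mult_group_has_gen[OF this]] obtain a
    where a: "a \<in> carrier (Multiplicative_Group.mult_of (L\<lparr>carrier := E\<rparr>))"
      "carrier (Multiplicative_Group.mult_of (L\<lparr>carrier := E\<rparr>)) = {a [^]\<^bsub>L\<lparr>carrier := E\<rparr>\<^esub> i | i::nat. i \<in> UNIV}" .
  have aE: "a \<in> E" using a(1) by (simp add: Multiplicative_Group.carrier_mult_of)
  have ac: "a \<in> carrier L" using aE subfieldE(3)[OF assms(1)] by blast
  have pow: "a [^]\<^bsub>L\<lparr>carrier := E\<rparr>\<^esub> (i::nat) = a [^] i" for i by (induction i) simp_all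
  let ?S = "simple_extension K a"
  have S: "subring ?S L" using simple_extension_is_subring[OF subfieldE(1)[OF K] ac] .
  note Sc = subringE[OF S]
  have aS: "a \<in> ?S" using simple_extension_mem[OF subfieldE(1)[OF K] ac] .
  have "a [^] (i::nat) \<in> ?S" for i by (induction i) (use Sc aS in auto)
  then have "E - {\<zero>} \<subseteq> ?S" using a(2) pow by (auto simp: Multiplicative_Group.carrier_mult_of)
  then have "E \<subseteq> ?S" using Sc(2) by blast
  moreover have "?S \<subseteq> E" using simple_extension_subring_incl[OF subfieldE(1)[OF assms(1)] assms(2) aE] .
  ultimately show ?thesis using that aE by blast
next
  case False
  note K = subfield_axioms
  have Ec: "E \<subseteq> carrier L" using subfieldE(3)[OF assms(1)] .
  note Em = subringE[OF subfieldE(1)[OF assms(1)]]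
  obtain N where N: "dimension N K E" using assms(3) by (rule finite_dimensionE')
  have dS: "dimension (degree (Irr K x)) K (simple_extension K x)" "simple_extension K x \<subseteq> E" "degree (Irr K x) \<le> N"
    if "x \<in> E" for x
  proof -
    have x: "x \<in> carrier L" using that Ec by blast
    show d: "dimension (degree (Irr K x)) K (simple_extension K x)"
      using dimension_simple_extension[OF K x algebraic_extension[OF x]] .
    show s: "simple_extension K x \<subseteq> E" using simple_extension_subring_incl[OF subfieldE(1)[OF assms(1)] assms(2) that] .
    show "degree (Irr K x) \<le> N" using dimension_le[OF K d N s] .
  qed
  define P where "P d \<longleftrightarrow> (\<exists>x\<in>E. degree (Irr K x) = d)" for d
  have "P (degree (Irr K \<one>))" unfolding P_def using Em(3) by blast
  moreover have bd: "d \<le> N" if "P d" for d using that dS(3) unfolding P_def by blast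
  ultimately have "P (Greatest P)" using GreatestI_nat[of P _ N] by blast
  then obtain \<theta> where \<theta>: "\<theta> \<in> E" "degree (Irr K \<theta>) = Greatest P" unfolding P_def by blast
  have \<theta>c: "\<theta> \<in> carrier L" using \<theta>(1) Ec by blast
  have "E \<subseteq> simple_extension K \<theta>"
  proof (rule ccontr)
    assume "\<not> E \<subseteq> simple_extension K \<theta>"
    then obtain y where y: "y \<in> E" "y \<notin> simple_extension K \<theta>" by blast
    have yc: "y \<in> carrier L" using y(1) Ec by blast
    \<comment> \<open>the values of \<open>c\<close> for which some conjugates \<open>x'\<close> of \<open>\<theta>\<close> and \<open>y' \<noteq> y\<close> of \<open>y\<close> satisfy \<open>x' + c y' = \<theta> + c y\<close>\<close>
    define B where "B = (\<lambda>(x', y'). (x' \<ominus> \<theta>) \<otimes> inv (y \<ominus> y')) ` (zeros (Irr K \<theta>) \<times> zeros (Irr K y))"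
    have fz: "finite (zeros (Irr K x))" if "x \<in> carrier L" for x
      using card_zeros_le(1) Irr_not_Nil(1,3)[OF K that algebraic_extension[OF that]] by blast
    have "finite B" unfolding B_def using fz[OF \<theta>c] fz[OF yc] by blast
    then obtain c where c: "c \<in> K" "c \<notin> B" using False by (meson ex_new_if_finite finite_subset subsetI)
    have cc: "c \<in> carrier L" using c(1) subfieldE(3)[OF K] by blast
    define \<eta> where "\<eta> = \<theta> \<oplus> c \<otimes> y"
    have \<eta>E: "\<eta> \<in> E" 
      unfolding \<eta>_def by (rule Em(7)[OF \<theta>(1) Em(6)[OF subsetD[OF assms(2) c(1)] y(1)]])
    have \<eta>c: "\<eta> \<in> carrier L" using \<eta>E Ec by blast
    let ?S = "simple_extension K \<eta>"
    have S: "subfield ?S L" "K \<subseteq> ?S" "\<eta> \<in> ?S"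
      using simple_extension_props[OF K \<eta>c algebraic_extension[OF \<eta>c]] by blast+
    interpret S: algebraic_closure L ?S by (rule algebraic_closure_intermediate[OF S(1,2)])
    have yS: "y \<in> ?S"
    proof (rule S.fixed_separable_mem[OF separable_mono[OF K S(1,2) yc assms(4)[OF y(1)]] yc])
      fix \<phi> assume \<phi>: "\<phi> \<in> ring_iso L L" "\<And>c. c \<in> ?S \<Longrightarrow> \<phi> c = c"
      then have g: "\<phi> \<in> Gal K" using S(2) by (auto simp: Gal_def)
      note h = Gal_hom[OF g]
      have z: "\<phi> x \<in> zeros (Irr K x)" "\<phi> x \<in> carrier L" if "x \<in> carrier L" for x
        using Gal_zeros[OF g _ subfieldE(3)[OF K], of "Irr K x" x] h(4)[OF that] that
          IrrE(4)[OF K that algebraic_extension[OF that]] Irr_not_Nil(4)[OF K that algebraic_extension[OF that]]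
        by (simp_all add: zeros_def)
      have e: "\<phi> \<theta> \<oplus> c \<otimes> \<phi> y = \<theta> \<oplus> c \<otimes> y"
        using \<phi>(2)[OF S(3)] h(5)[OF cc yc] h(6)[of \<theta> "c \<otimes> y"] h(12)[OF c(1)] \<theta>c yc cc by (simp add: \<eta>_def)
      show "\<phi> y = y"
      proof (rule ccontr)
        assume ne: "\<phi> y \<noteq> y"
        have nz: "y \<ominus> \<phi> y \<in> carrier L - {\<zero>}" using ne yc z(2)[OF yc] by auto
        have "\<phi> \<theta> \<ominus> \<theta> = c \<otimes> (y \<ominus> \<phi> y)"
        proof -
          have "p \<ominus> q = c \<otimes> (y \<ominus> r)" if "p \<oplus> c \<otimes> r = q \<oplus> c \<otimes> y" "p \<in> carrier L" "q \<in> carrier L" "r \<in> carrier L" for p q r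
          proof -
            have "p \<ominus> q = (p \<oplus> c \<otimes> r) \<ominus> (q \<oplus> c \<otimes> r)"
              using that(2-4) cc unfolding minus_eq by algebra
            also have "\<dots> = c \<otimes> (y \<ominus> r)"
              unfolding that(1) using that(2-4) cc yc unfolding minus_eq by algebra
            finally show ?thesis .
          qed
          from this[OF e] show ?thesis using z(2) \<theta>c yc by blast
        qed
        then have "(\<phi> \<theta> \<ominus> \<theta>) \<otimes> inv (y \<ominus> \<phi> y) = c"
          using nz cc field_Units by (simp add: m_assoc)
        then have "c \<in> B" unfolding B_def using z(1)[OF \<theta>c] z(1)[OF yc] by force
        then show False using c(2) by blast
      qed
    qed
    note Sc = subringE[OF subfieldE(1)[OF S(1)]]
    have "\<theta> = \<eta> \<oplus> \<ominus> (c \<otimes> y)" unfolding \<eta>_def using \<theta>c cc yc by (simp add: a_assoc r_neg)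
    also have "\<dots> \<in> ?S" 
      by (rule Sc(7)[OF S(3) Sc(5)[OF Sc(6)[OF subsetD[OF S(2) c(1)] yS]]])
    finally have "\<theta> \<in> ?S" .
    then have sub: "simple_extension K \<theta> \<subseteq> ?S" using simple_extension_subring_incl[OF subfieldE(1)[OF S(1)] S(2)] by blast
    have "P (degree (Irr K \<eta>))" unfolding P_def using \<eta>E by blast
    then have "degree (Irr K \<eta>) \<le> Greatest P" using Greatest_le_nat[of P _ N] bd by blast
    moreover have "degree (Irr K \<theta>) \<le> degree (Irr K \<eta>)" using dimension_le[OF K dS(1)[OF \<theta>(1)] dS(1)[OF \<eta>E] sub] .
    ultimately have "degree (Irr K \<theta>) = degree (Irr K \<eta>)" using \<theta>(2) by simp
    then have "simple_extension K \<theta> = ?S"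
      using same_dimension_imp_eq[OF K dS(1)[OF \<theta>(1)] _ sub] dS(1)[OF \<eta>E] by simp
    then show False using yS y(2) by simp
  qed
  then show ?thesis using that[OF \<theta>(1)] dS(2)[OF \<theta>(1)] by blast
qed


section \<open>The criterion\<close>

context perfect_henselian_field
begin

text \<open>
  All extensions in question are tame, so only values matter. If \<open>L\<close> has no more values than \<open>L2\<close>, then
  the values of \<open>L'\<close> belong to \<open>L2\<close>, and a multiple prime to the residue characteristic belongs to \<open>L2'\<close>;
  hence they belong to \<open>L2'\<close>, the tame part of \<open>L2\<close>. If conversely \<open>L'\<close> has no more values than \<open>L2'\<close>,
  it lies in the unramified closure of \<open>L2'\<close>, thus in that of \<open>L2\<close>, and so does \<open>L\<close>.
\<close>

lemma tame_compositum_unramified_iff: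
  assumes "subfield L1 R" "K \<subseteq> L1" "finite_dimension K L1" "L1 \<subseteq> tame_closure UNIV K"
    and "subfield L2 R" "K \<subseteq> L2" "finite_dimension K L2"
    and "L = generate_field R (L1 \<union> L2)" "L2' = L2 \<inter> tame_closure UNIV K" "L' = generate_field R (L1 \<union> L2')"
  shows "unramified_extension R v L2 L \<longleftrightarrow> ramification_index R v L2' L' = 1"
    and "subfield L' R" "subfield L2' R" "K \<subseteq> L2'" "L1 \<subseteq> L'" "L2' \<subseteq> L'" "finite_dimension K L'"
    and "dim L1 L' = ramification_index R v L1 L' * inertia_degree R v L1 L'"
proof -
  let ?T = "tame_closure UNIV K"
  note Ts = tame_closure_subfield[of UNIV] and K = subfield_axioms
  have c1: "L1 \<subseteq> carrier R" and c2: "L2 \<subseteq> carrier R" using subfieldE(3)[OF assms(1)] subfieldE(3)[OF assms(5)] by auto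
  show s2: "subfield L2' R" unfolding assms(9) by (rule inter_subfield[OF assms(5) Ts])
  show k2: "K \<subseteq> L2'" unfolding assms(9) using assms(6) tame_closure_base by blast
  have c2': "L2' \<subseteq> carrier R" using subfieldE(3)[OF s2] .
  have sub2: "L2' \<subseteq> L2" unfolding assms(9) by blast
  have L: "subfield L R" "L1 \<union> L2 \<subseteq> L" using generate_fieldE(1,2)[OF _ assms(8)] c1 c2 by auto
  have L': "subfield L' R" "L1 \<union> L2' \<subseteq> L'" using generate_fieldE(1,2)[OF _ assms(10)] c1 c2' by auto
  then show s': "subfield L' R" and i1: "L1 \<subseteq> L'" and i2: "L2' \<subseteq> L'" by auto
  have fL: "finite_dimension L2 L"
    unfolding assms(8) by (rule compositum_finite_dimension[OF K assms(1,5,2,6,3)])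
  have fL': "finite_dimension L2' L'"
    unfolding assms(10) by (rule compositum_finite_dimension[OF K assms(1) s2 assms(2) k2 assms(3)])
  have f2': "finite_dimension K L2'" using finite_dimension_intermediate(1)[OF K s2 assms(5) k2 sub2 assms(7)] .
  show fKL': "finite_dimension K L'" using telescopic_base_dim(1)[OF K s2 f2' fL'] .
  have f1L': "finite_dimension L1 L'" using finite_dimension_intermediate(2)[OF K assms(1) s' assms(2) i1 fKL'] .
  interpret L1: henselian_field R v L1 by (rule henselian_intermediate[OF assms(1,2)])
  interpret L2: henselian_field R v L2 by (rule henselian_intermediate[OF assms(5,6)])
  interpret L2': henselian_field R v L2' by (rule henselian_intermediate[OF s2 k2])
  have L'T: "L' \<subseteq> ?T"
    unfolding assms(10) by (rule generate_field_min_subfield1[OF _ Ts]) (use c1 c2' assms(4,9) in auto)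
  have "defectless R v L1 L'"
    using L1.tame_closure_extension(1)[OF s' i1 f1L'] L'T tame_closure_mono[OF assms(1,2)] by blast
  then show "dim L1 L' = ramification_index R v L1 L' * inertia_degree R v L1 L'" by (simp add: defectless_def)
  have L'T2: "L' \<subseteq> tame_closure UNIV L2'" using L'T tame_closure_mono[OF s2 k2] by blast
  note te = L2'.tame_closure_extension[OF s' i2 fL' L'T2]
  have c12: "L1 \<union> L2 \<subseteq> carrier R" using c1 c2 by (rule Un_least)
  have "L1 \<union> L2 \<subseteq> tame_closure UNIV L2"
    using subset_trans[OF assms(4) tame_closure_mono[OF assms(5,6)]] L2.tame_closure_base by (rule Un_least)
  then have "L \<subseteq> tame_closure UNIV L2"
    unfolding assms(8) by (rule generate_field_min_subfield1[OF c12 L2.tame_closure_subfield])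
  then have "tame_extension R v L2 L"
    using tame_extension_of_subset_closure[OF assms(5) L(1) assms(6) _ fL] L(2) by blast
  then have un: "unramified_extension R v L2 L \<longleftrightarrow> vals L = vals L2"
    by (simp add: unramified_extension_def value_group_eq_iff)
  have e1: "ramification_index R v L2' L' = 1 \<longleftrightarrow> vals L2' = vals L'"
    unfolding ramification_index_eq by (rule gindex_eq_1_iff[OF vals_is_subgrp[OF s2] vals_is_subgrp[OF s'] vals_mono[OF i2]])
  have "vals L = vals L2 \<longleftrightarrow> vals L2' = vals L'"
  proof
    assume eq: "vals L = vals L2"
    have "L' \<subseteq> L"
      unfolding assms(10) by (rule generate_field_min_subfield1[OF _ L(1)]) (use c1 c2' L(2) sub2 in auto)
    have "vals L' \<subseteq> vals L2'"
    proof
      fix g assume g: "g \<in> vals L'"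
      then have "g \<in> vals L2" using vals_mono[OF \<open>L' \<subseteq> L\<close>] eq by blast
      moreover have "nmult (ramification_index R v L2' L') g \<in> vals L2'"
        using nmult_gindex_mem[OF vals_is_subgrp[OF s2] vals_is_subgrp[OF s'] _ g]
          fundamental_inequality(2)[OF s2 s' i2 fL'] by (simp add: ramification_index_eq)
      ultimately show "g \<in> vals L2'"
        using values_tame_part[OF assms(5,6) _ te(2)] unfolding assms(9)[symmetric] by blast
    qed
    then show "vals L2' = vals L'" using vals_mono[OF i2] by blast
  next
    assume eq: "vals L2' = vals L'"
    have "L' \<subseteq> tame_closure {0} L2'"
      using unramified_subset_closure[OF s2 s' k2 i2 fL' te(1)] eq by simp
    then have "L1 \<subseteq> tame_closure {0} L2" using L2'.tame_closure_mono[OF assms(5) sub2] i1 by blast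
    then have "L1 \<union> L2 \<subseteq> tame_closure {0} L2" using L2.tame_closure_base by (rule Un_least)
    then have "L \<subseteq> tame_closure {0} L2"
      unfolding assms(8) by (rule generate_field_min_subfield1[OF c12 L2.tame_closure_subfield])
    moreover have "{0} \<subseteq> vals L2" using is_subgrpD(1)[OF vals_is_subgrp[OF assms(5)]] by blast
    ultimately show "vals L = vals L2"
      using L2.tame_closure_extension(3)[OF L(1) _ fL] L(2) by blast
  qed
  then show "unramified_extension R v L2 L \<longleftrightarrow> ramification_index R v L2' L' = 1" using un e1 by blast
qed

text \<open>
  As \<open>\<theta>\<close> varies, the field generated by its residue runs through the simple subextensions of the
  residue extension, and the whole extension is among them because it has a primitive element.
\<close>

lemma residue_generation:
  assumes "subfield F R" "K \<subseteq> F" "subfield E R" "F \<subseteq> E" "finite_dimension F E"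
  defines "d \<equiv> \<lambda>\<theta>. ring.dim \<kappa> (resf F) (generate_field \<kappa> (resf F \<union> {res \<theta>}))"
  shows "\<And>\<theta>. \<theta> \<in> valuation_ring R v E \<Longrightarrow> d \<theta> \<le> inertia_degree R v F E"
    and "\<And>\<theta>. \<theta> \<in> valuation_ring R v E \<Longrightarrow> d \<theta> = inertia_degree R v F E \<Longrightarrow>
      resf E = generate_field \<kappa> (resf F \<union> {res \<theta>})"
    and "\<exists>\<theta>\<in>valuation_ring R v E. d \<theta> = inertia_degree R v F E"
proof -
  note kF = resf_subfield[OF assms(1)] and kE = resf_subfield[OF assms(3)] and FE = resf_mono[OF assms(4)]
  note fi = fundamental_inequality[OF assms(1,3,4,5)]
  interpret kF: algebraic_closure \<kappa> "resf F" by (rule residue_algebraic_closure[OF assms(1,2)])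
  have f: "k.dimension (inertia_degree R v F E) (resf F) (resf E)"
    using k.finite_dimensionE[OF kF fi(1)] by (simp add: inertia_degree_def over_def)
  have mem: "res \<theta> \<in> resf E" "res \<theta> \<in> carrier \<kappa>" if "\<theta> \<in> valuation_ring R v E" for \<theta>
    using that subfieldE(3)[OF kE] by (auto simp: residue_subfield_def)
  have gen: "generate_field \<kappa> (resf F \<union> {\<alpha>}) = k.simple_extension (resf F) \<alpha>" if "\<alpha> \<in> carrier \<kappa>" for \<alpha>
    using k.generate_field_eq_simple_extension[OF kF that kF.algebraic_extension[OF that]] .
  have dd: "k.dimension (d \<theta>) (resf F) (generate_field \<kappa> (resf F \<union> {res \<theta>}))" if "\<theta> \<in> valuation_ring R v E" for \<theta>
  proof -
    note m = mem(2)[OF that]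
    have "k.dimension (degree (k.Irr (resf F) (res \<theta>))) (resf F) (generate_field \<kappa> (resf F \<union> {res \<theta>}))"
      using k.dimension_simple_extension[OF kF m kF.algebraic_extension[OF m]] gen[OF m] by simp
    then show ?thesis unfolding d_def using k.dimI[OF kF] by (simp add: over_def)
  qed
  have sub: "generate_field \<kappa> (resf F \<union> {res \<theta>}) \<subseteq> resf E" if "\<theta> \<in> valuation_ring R v E" for \<theta>
  proof -
    have "resf F \<union> {res \<theta>} \<subseteq> resf E" using FE mem(1)[OF that] by simp
    from k.generate_field_min_subfield1[OF subset_trans[OF this subfieldE(3)[OF kE]] kE this] show ?thesis .
  qed
  show "d \<theta> \<le> inertia_degree R v F E" if "\<theta> \<in> valuation_ring R v E" for \<theta>
    using k.dimension_le[OF kF dd[OF that] f sub[OF that]] .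
  show "resf E = generate_field \<kappa> (resf F \<union> {res \<theta>})"
    if "\<theta> \<in> valuation_ring R v E" "d \<theta> = inertia_degree R v F E" for \<theta>
    using k.same_dimension_imp_eq[OF kF dd[OF that(1)] _ sub[OF that(1)]] f that(2) by simp
  obtain \<alpha> where \<alpha>: "\<alpha> \<in> resf E" "resf E = k.simple_extension (resf F) \<alpha>"
    using kF.primitive_element[OF kE FE fi(1)] residue_separable[OF assms(1,2)] subfieldE(3)[OF kE] by blast
  then obtain \<theta> where \<theta>: "\<theta> \<in> valuation_ring R v E" "\<alpha> = res \<theta>" by (auto simp: residue_subfield_def)
  have "generate_field \<kappa> (resf F \<union> {res \<theta>}) = resf E" using gen[OF mem(2)[OF \<theta>(1)]] \<alpha>(2) \<theta>(2) by simp
  then have "d \<theta> = inertia_degree R v F E" by (simp add: d_def inertia_degree_def)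
  then show "\<exists>\<theta>\<in>valuation_ring R v E. d \<theta> = inertia_degree R v F E" using \<theta>(1) by blast
qed

end

lemma henselian_fieldI:
  assumes "henselian R v K"
  shows "henselian_field R v K"
proof -
  interpret algebraic_closure R K using assms by (simp add: henselian_def)
  show ?thesis
  proof
    show "valuation R v" using assms by (simp add: henselian_def)
    fix w and x
    assume "valuation R w" "\<And>y. y \<in> K - {\<zero>\<^bsub>R\<^esub>} \<Longrightarrow> w y = v y" "x \<in> carrier R - {\<zero>\<^bsub>R\<^esub>}"
    then show "w x = v x" using assms unfolding henselian_def by blast
  qed
qed

text \<open>
  By \<open>tame_compositum_unramified_iff\<close>, it remains to compare
  \<open>e\<^sub>1 [L' : L\<^sub>1] = e\<^sub>2' e(L' / L\<^sub>2') f(L' / L\<^sub>1)\<close> with \<open>e\<^sub>2' d\<^sub>\<theta>\<close>.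
\<close>

theorem theorem1p4:
  fixes R :: "('a, 'b) ring_scheme"
    and v :: "'a \<Rightarrow> 'g::linordered_ab_group_add"
    and K L1 L2 L L2' L' :: "'a set"
    and e1 e2' :: nat
    and d :: "'a \<Rightarrow> nat"
  assumes "henselian R v K"
    and "perfect_subfield (residue_field R v) (residue_subfield R v K)"
    and "subfield L1 R" "K \<subseteq> L1" "ring.finite_dimension R K L1"
    and "tame_extension R v K L1"
    and "subfield L2 R" "K \<subseteq> L2" "ring.finite_dimension R K L2"
    and "L = generate_field R (L1 \<union> L2)"
    and "L2' = L2 \<inter> ramification_field R v K"
    and "L' = generate_field R (L1 \<union> L2')"
    and "e1 = ramification_index R v K L1"
    and "e2' = ramification_index R v K L2'"
    and "\<And>\<theta>. \<theta> \<in> valuation_ring R v L' \<Longrightarrow>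
          d \<theta> = ring.dim (residue_field R v) (residue_subfield R v L1)
                  (generate_field (residue_field R v) (residue_subfield R v L1 \<union> {residue R v \<theta>}))"
  shows "(unramified_extension R v L2 L \<longleftrightarrow>
            (\<exists>\<theta> \<in> valuation_ring R v L'. e2' * d \<theta> = e1 * ring.dim R L1 L')) \<and>
         (\<forall>\<theta> \<in> valuation_ring R v L'. e2' * d \<theta> = e1 * ring.dim R L1 L' \<longrightarrow>
            residue_subfield R v L' =
              generate_field (residue_field R v) (residue_subfield R v L1 \<union> {residue R v \<theta>}) \<and>
            e1 dvd e2')"
proof -
  interpret henselian_field R v K by (rule henselian_fieldI[OF assms(1)])
  interpret perfect_henselian_field R v K by unfold_locales (rule assms(2))
  have T: "ramification_field R v K = tame_closure UNIV K" by (rule ramification_field_eq_tame_closure)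
  note c = tame_compositum_unramified_iff[OF assms(3-5) tame_extension_subset_closure[OF assms(6,5)] assms(7-10)
    assms(11)[unfolded T] assms(12)]
  note K = subfield_axioms
  note f1 = finite_dimension_intermediate(2)[OF K assms(3) c(2) assms(4) c(5,7)]
  note f2 = finite_dimension_intermediate(1,2)[OF K c(3,2) c(4,6,7)]
  let ?f = "inertia_degree R v L1 L'" and ?e = "ramification_index R v L2' L'"
  have d: "d \<theta> \<le> ?f" "d \<theta> = ?f \<Longrightarrow> resf L' = generate_field \<kappa> (resf L1 \<union> {res \<theta>})"
    if "\<theta> \<in> valuation_ring R v L'" for \<theta>
    unfolding assms(15)[OF that] by (rule residue_generation(1,2)[OF assms(3,4) c(2,5) f1 that]; assumption?)+
  have ex: "\<exists>\<theta>\<in>valuation_ring R v L'. d \<theta> = ?f"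
    using residue_generation(3)[OF assms(3,4) c(2,5) f1] assms(15) by auto
  have f0: "?f > 0" using fundamental_inequality(3)[OF assms(3) c(2,5) f1] .
  have e0: "?e > 0" "e2' > 0"
    using fundamental_inequality(2)[OF c(3,2,6) f2(2)] fundamental_inequality(2)[OF K c(3,4) f2(1)]
    by (simp_all add: assms(14))
  have tower: "e1 * ramification_index R v L1 L' = e2' * ?e"
    using degree_tower(1)[OF K assms(3) c(2) assms(4) c(5,7)] degree_tower(1)[OF K c(3,2) c(4,6,7)]
    by (simp add: assms(13,14))
  have rhs: "e1 * dim L1 L' = e2' * (?e * ?f)"
    unfolding c(8) mult.assoc[symmetric] tower by (rule refl)
  \<comment> \<open>as \<open>d \<theta> \<le> f\<close>, the numerical condition forces both the ramification of \<open>L' / L2'\<close> to be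
    trivial and \<open>\<theta>\<close> to generate the residue field\<close>
  have cond: "e2' * d \<theta> = e1 * dim L1 L' \<longleftrightarrow> ?e = 1 \<and> d \<theta> = ?f" if "\<theta> \<in> valuation_ring R v L'" for \<theta>
  proof -
    have "e2' * d \<theta> = e1 * dim L1 L' \<longleftrightarrow> d \<theta> = ?e * ?f" unfolding rhs using e0(2) by simp
    also have "\<dots> \<longleftrightarrow> ?e = 1 \<and> d \<theta> = ?f"
    proof
      assume eq: "d \<theta> = ?e * ?f"
      have "?e \<le> 1"
      proof (rule ccontr)
        assume "\<not> ?e \<le> 1"
        then have "2 * ?f \<le> ?e * ?f" by (intro mult_right_mono) auto
        then show False using d(1)[OF that] eq f0 by linarith
      qed
      then have "?e = 1" using e0(1) by linarith
      then show "?e = 1 \<and> d \<theta> = ?f" using eq by simp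
    qed simp
    finally show ?thesis .
  qed
  have "unramified_extension R v L2 L \<longleftrightarrow> (\<exists>\<theta>\<in>valuation_ring R v L'. e2' * d \<theta> = e1 * dim L1 L')"
    using c(1) cond ex by blast
  moreover have "resf L' = generate_field \<kappa> (resf L1 \<union> {res \<theta>}) \<and> e1 dvd e2'"
    if "\<theta> \<in> valuation_ring R v L'" "e2' * d \<theta> = e1 * dim L1 L'" for \<theta>
  proof -
    have "?e = 1" "d \<theta> = ?f" using cond[OF that(1)] that(2) by auto
    moreover from this(1) have "e1 dvd e2'" using tower by (metis dvd_triv_left mult.right_neutral)
    ultimately show ?thesis using d(2)[OF that(1)] by blast
  qed
  ultimately show ?thesis by blast
qed

end
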